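(* Let $m,n\geq 3$ be integers, let $G=\mathbb{Z}_n\rtimes_{\theta}\mathbb{Z}_m$, where $\theta\colon\mathbb{Z}_m\to\operatorname{Aut}(\mathbb{Z}_n)$ is the associated action, and let $1\leq t<n$ be such that $\theta(1_m)$ is multiplication by $t$ in $\mathbb{Z}_n$. Assume that $\gcd(t^l-1,n)=1$ for all $1\leq l\leq m-1$. (i) If $mn$ is odd, then $G$ embeds in $B_n/\Gamma_2(P_n)$. (ii) If $\gcd(mn,6)=1$, then $G$ embeds in $B_n/\Gamma_3(P_n)$.
   Context: For $n\in\mathbb{N}$, $B_n$ denotes the Artin braid group on $n$ strings, with generators $\sigma_1,\ldots,\sigma_{n-1}$ and relations $\sigma_i\sigma_j=\sigma_j\sigma_i$ for $|i-j|\geq 2$ and $\sigma_i\sigma_{i+1}\sigma_i=\sigma_{i+1}\sigma_i\sigma_{i+1}$ for $1\leq i\leq n-2$. The pure braid group $P_n$ is the kernel of the surjective homomorphism $\sigma\colon B_n\to S_n$ onto the symmetric group given by $\sigma(\sigma_i)=(i,i+1)$. For a group $\Pi$, the lower central series is defined by $\Gamma_1(\Pi)=\Pi$ and $\Gamma_k(\Pi)=[\Gamma_{k-1}(\Pi),\Pi]$ for $k\geq 2$. Since $P_n$ is normal in $B_n$, $\Gamma_k(P_n)$ is normal in $B_n$, so the quotient $B_n/\Gamma_k(P_n)$ is a group. $\mathbb{Z}_q$ denotes the (additive) cyclic group of order $q$ and $1_q$ denotes the class of $1$ in $\mathbb{Z}_q$. A group $G$ embeds in a group $\Pi$ if there is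 an injective homomorphism $G\to\Pi$. *)

theory Defs
  imports "HOL-Algebra.Sym_Groups" "HOL-Algebra.Elementary_Groups" "HOL-Algebra.Bij"
begin

section \<open>Groups given by generators and relations\<close>

text \<open>A word over \<open>S\<close> is a list of signed letters: \<open>(a, True)\<close> stands for the generator \<open>a\<close>
  and \<open>(a, False)\<close> for its formal inverse. A relation \<open>u = v\<close> is a pair of words.\<close>

type_synonym 'a word = "('a \<times> bool) list"

definition words :: "'a set \<Rightarrow> 'a word set" where
  "words S = lists (S \<times> UNIV)"

inductive word_eq :: "'a set \<Rightarrow> ('a word \<times> 'a word) set \<Rightarrow> 'a word \<Rightarrow> 'a word \<Rightarrow> bool"
  for S :: "'a set" and R :: "('a word \<times> 'a word) set" where
  refl: "w \<in> words S \<Longrightarrow> word_eq S R w w"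
| sym: "word_eq S R u v \<Longrightarrow> word_eq S R v u"
| trans: "word_eq S R u v \<Longrightarrow> word_eq S R v w \<Longrightarrow> word_eq S R u w"
| append: "word_eq S R u u' \<Longrightarrow> word_eq S R v v' \<Longrightarrow> word_eq S R (u @ v) (u' @ v')"
| cancel: "a \<in> S \<Longrightarrow> word_eq S R [(a, b), (a, \<not> b)] []"
| relation: "(u, v) \<in> R \<Longrightarrow> u \<in> words S \<Longrightarrow> v \<in> words S \<Longrightarrow> word_eq S R u v"

definition word_rel :: "'a set \<Rightarrow> ('a word \<times> 'a word) set \<Rightarrow> ('a word \<times> 'a word) set" where
  "word_rel S R = {(u, v). word_eq S R u v}"

definition presented_group :: "'a set \<Rightarrow> ('a word \<times> 'a word) set \<Rightarrow> 'a word set monoid" where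
  "presented_group S R =
    \<lparr>carrier = words S // word_rel S R,
     mult = (\<lambda>X Y. \<Union>u\<in>X. \<Union>v\<in>Y. word_rel S R `` {u @ v}),
     one = word_rel S R `` {[]}\<rparr>"

primrec word_eval :: "('b, 'c) monoid_scheme \<Rightarrow> ('a \<Rightarrow> 'b) \<Rightarrow> 'a word \<Rightarrow> 'b" where
  "word_eval H f [] = \<one>\<^bsub>H\<^esub>"
| "word_eval H f (x # w) =
    (if snd x then f (fst x) else inv\<^bsub>H\<^esub> f (fst x)) \<otimes>\<^bsub>H\<^esub> word_eval H f w"

text \<open>The homomorphism out of a presented group determined by the images \<open>f a\<close> of the generators;
  it is well defined when the \<open>f a\<close> satisfy the relations (see \<open>presented_lift_hom\<close>).\<close>

definition presented_lift :: "('b, 'c) monoid_scheme \<Rightarrow> ('a \<Rightarrow> 'b) \<Rightarrow> 'a word set \<Rightarrow> 'b" where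
  "presented_lift H f X = the_elem (word_eval H f ` X)"

lemma word_eq_words: "word_eq S R u v \<Longrightarrow> u \<in> words S \<and> v \<in> words S"
  by (induction rule: word_eq.induct) (auto simp: words_def)

lemma equiv_word_rel: "equiv (words S) (word_rel S R)"
proof (rule equivI)
  show "word_rel S R \<subseteq> words S \<times> words S"
    by (auto simp: word_rel_def dest: word_eq_words)
  show "refl_on (words S) (word_rel S R)"
    by (auto simp: refl_on_def word_rel_def intro: word_eq.refl)
  show "sym_on UNIV (word_rel S R)"
    by (auto simp: sym_on_def word_rel_def intro: word_eq.sym)
  show "trans_on UNIV (word_rel S R)"
    by (auto simp: trans_on_def word_rel_def intro: word_eq.trans)
qed

lemma word_class_eq_iff:
  "u \<in> words S \<Longrightarrow> v \<in> words S \<Longrightarrow>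
    word_rel S R `` {u} = word_rel S R `` {v} \<longleftrightarrow> word_eq S R u v"
  using eq_equiv_class_iff[OF equiv_word_rel] by (fastforce simp: word_rel_def)

lemma carrier_presented_group:
  "carrier (presented_group S R) = (\<lambda>w. word_rel S R `` {w}) ` words S"
  by (auto simp: presented_group_def quotient_def)

lemma mult_presented_group:
  assumes "u \<in> words S" "v \<in> words S"
  shows "(word_rel S R `` {u}) \<otimes>\<^bsub>presented_group S R\<^esub> (word_rel S R `` {v}) = word_rel S R `` {u @ v}"
proof -
  have "congruent2 (word_rel S R) (word_rel S R) (\<lambda>u v. word_rel S R `` {u @ v})"
  proof (rule congruent2I')
    fix u u' v v' assume "(u, u') \<in> word_rel S R" "(v, v') \<in> word_rel S R"
    then have "word_eq S R (u @ v) (u' @ v')"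
      by (auto simp: word_rel_def intro: word_eq.append)
    then show "word_rel S R `` {u @ v} = word_rel S R `` {u' @ v'}"
      using word_class_eq_iff word_eq_words by metis
  qed
  from UN_equiv_class2[OF equiv_word_rel equiv_word_rel this assms]
  show ?thesis by (simp add: presented_group_def)
qed

lemma word_eq_inverse:
  "w \<in> words S \<Longrightarrow> word_eq S R (rev (map (\<lambda>(a, b). (a, \<not> b)) w) @ w) []"
proof (induction w)
  case Nil
  then show ?case by (simp add: word_eq.refl words_def)
next
  case (Cons x w)
  obtain a b where x: "x = (a, b)" by fastforce
  have w: "w \<in> words S" and a: "a \<in> S" using Cons.prems x by (auto simp: words_def)
  let ?v = "rev (map (\<lambda>(a, b). (a, \<not> b)) w)"
  have v: "?v \<in> words S" using w by (auto simp: words_def)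
  have "word_eq S R [(a, \<not> b), (a, b)] []" using word_eq.cancel[OF a, of R "\<not> b"] by simp
  from word_eq.append[OF word_eq.refl[OF v] word_eq.append[OF this word_eq.refl[OF w]]]
  have "word_eq S R (?v @ [(a, \<not> b), (a, b)] @ w) (?v @ w)" by simp
  from word_eq.trans[OF this Cons.IH[OF w]] show ?case by (simp add: x)
qed

lemma group_presented_group: "group (presented_group S R)"
proof (rule groupI)
  have nil: "[] \<in> words S" by (simp add: words_def)
  have app: "u @ v \<in> words S" if "u \<in> words S" "v \<in> words S" for u v
    using that by (auto simp: words_def)
  have one: "\<one>\<^bsub>presented_group S R\<^esub> = word_rel S R `` {[]}"
    by (simp add: presented_group_def)
  show "\<one>\<^bsub>presented_group S R\<^esub> \<in> carrier (presented_group S R)"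
    using nil by (simp add: one carrier_presented_group)
  fix X assume "X \<in> carrier (presented_group S R)"
  then obtain u where u: "u \<in> words S" "X = word_rel S R `` {u}"
    by (auto simp: carrier_presented_group)
  show "\<one>\<^bsub>presented_group S R\<^esub> \<otimes>\<^bsub>presented_group S R\<^esub> X = X"
    by (simp add: one u nil mult_presented_group)
  let ?v = "rev (map (\<lambda>(a, b). (a, \<not> b)) u)"
  have v: "?v \<in> words S" using u(1) by (auto simp: words_def)
  have "(word_rel S R `` {?v}) \<otimes>\<^bsub>presented_group S R\<^esub> X = \<one>\<^bsub>presented_group S R\<^esub>"
    using word_eq_inverse[OF u(1)] u v nil app[OF v u(1)]
    by (simp add: one mult_presented_group word_class_eq_iff)
  then show "\<exists>Y\<in>carrier (presented_group S R). Y \<otimes>\<^bsub>presented_group S R\<^esub> X = \<one>\<^bsub>presented_group S R\<^esub>"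
    using v by (auto simp: carrier_presented_group)
  fix Y assume "Y \<in> carrier (presented_group S R)"
  then obtain v where v: "v \<in> words S" "Y = word_rel S R `` {v}"
    by (auto simp: carrier_presented_group)
  show "X \<otimes>\<^bsub>presented_group S R\<^esub> Y \<in> carrier (presented_group S R)"
    using u v app by (simp add: carrier_presented_group mult_presented_group)
  fix Z assume "Z \<in> carrier (presented_group S R)"
  then obtain w where w: "w \<in> words S" "Z = word_rel S R `` {w}"
    by (auto simp: carrier_presented_group)
  show "(X \<otimes>\<^bsub>presented_group S R\<^esub> Y) \<otimes>\<^bsub>presented_group S R\<^esub> Z =
      X \<otimes>\<^bsub>presented_group S R\<^esub> (Y \<otimes>\<^bsub>presented_group S R\<^esub> Z)"
    using u v w app by (simp add: mult_presented_group)
qed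

context
  fixes H :: "('b, 'c) monoid_scheme" (structure) and S :: "'a set" and R and f :: "'a \<Rightarrow> 'b"
  assumes H: "group H" and f: "\<And>a. a \<in> S \<Longrightarrow> f a \<in> carrier H"
    and rels: "\<And>u v. (u, v) \<in> R \<Longrightarrow> word_eval H f u = word_eval H f v"
begin

lemma word_eval_closed: "w \<in> words S \<Longrightarrow> word_eval H f w \<in> carrier H"
proof (induction w)
  case Nil
  show ?case by (simp add: group.is_monoid[OF H])
next
  case (Cons x w)
  then have "fst x \<in> S" "w \<in> words S" by (auto simp: words_def)
  with Cons.IH f show ?case
    by (simp add: group.inv_closed[OF H] monoid.m_closed[OF group.is_monoid[OF H]])
qed

lemma word_eval_append:
  "u \<in> words S \<Longrightarrow> v \<in> words S \<Longrightarrow> word_eval H f (u @ v) = word_eval H f u \<otimes> word_eval H f v"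
proof (induction u)
  case Nil
  then show ?case by (simp add: word_eval_closed group.is_monoid[OF H])
next
  case (Cons x u)
  then have "fst x \<in> S" "u \<in> words S" by (auto simp: words_def)
  with Cons f show ?case
    by (simp add: word_eval_closed monoid.m_assoc[OF group.is_monoid[OF H]] group.inv_closed[OF H])
qed

lemma word_eval_cong: "word_eq S R u v \<Longrightarrow> word_eval H f u = word_eval H f v"
proof (induction rule: word_eq.induct)
  case (append u u' v v')
  then show ?case using word_eq_words by (metis word_eval_append)
next
  case (cancel a b)
  then show ?case
    using f[of a] group.is_monoid[OF H]
    by (cases b) (simp_all add: group.r_inv[OF H] group.l_inv[OF H] group.inv_closed[OF H])
qed (auto simp: rels)

lemma presented_lift_class:
  assumes "w \<in> words S"
  shows "presented_lift H f (word_rel S R `` {w}) = word_eval H f w"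
proof -
  have "word_eval H f ` (word_rel S R `` {w}) = {word_eval H f w}"
    using assms by (auto simp: word_rel_def dest: word_eval_cong intro: word_eq.refl)
  then show ?thesis by (simp add: presented_lift_def)
qed

lemma presented_lift_hom: "presented_lift H f \<in> hom (presented_group S R) H"
proof (rule homI)
  fix X assume "X \<in> carrier (presented_group S R)"
  then obtain u where u: "u \<in> words S" "X = word_rel S R `` {u}"
    by (auto simp: carrier_presented_group)
  show "presented_lift H f X \<in> carrier H"
    using u by (simp add: presented_lift_class word_eval_closed)
  fix Y assume "Y \<in> carrier (presented_group S R)"
  then obtain v where v: "v \<in> words S" "Y = word_rel S R `` {v}"
    by (auto simp: carrier_presented_group)
  have "u @ v \<in> words S" using u v by (auto simp: words_def)
  then show "presented_lift H f (X \<otimes>\<^bsub>presented_group S R\<^esub> Y) =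
      presented_lift H f X \<otimes> presented_lift H f Y"
    using u v by (simp add: presented_lift_class mult_presented_group word_eval_append)
qed

end

section \<open>Braid groups and pure braid groups\<close>

definition braid_rels :: "nat \<Rightarrow> (nat word \<times> nat word) set" where
  "braid_rels n =
    {([(i, True), (j, True)], [(j, True), (i, True)]) | i j.
       i \<in> {1..<n} \<and> j \<in> {1..<n} \<and> \<bar>int i - int j\<bar> \<ge> 2} \<union>
    {([(i, True), (i + 1, True), (i, True)], [(i + 1, True), (i, True), (i + 1, True)]) | i.
       1 \<le> i \<and> i + 2 \<le> n}"

definition braid_group :: "nat \<Rightarrow> nat word set monoid" where
  "braid_group n = presented_group {1..<n} (braid_rels n)"

definition braid_perm :: "nat \<Rightarrow> nat word set \<Rightarrow> (nat \<Rightarrow> nat)" where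
  "braid_perm n = presented_lift (sym_group n) (\<lambda>i. transpose i (i + 1))"

definition pure_braids :: "nat \<Rightarrow> nat word set set" where
  "pure_braids n = kernel (braid_group n) (sym_group n) (braid_perm n)"

definition pure_braid_group :: "nat \<Rightarrow> nat word set monoid" where
  "pure_braid_group n = (braid_group n)\<lparr>carrier := pure_braids n\<rparr>"

lemma group_braid_group: "group (braid_group n)"
  by (simp add: braid_group_def group_presented_group)

lemma
  shows braid_perm_hom: "braid_perm n \<in> hom (braid_group n) (sym_group n)"
    and braid_perm_generator: "i \<in> {1..<n} \<Longrightarrow>
      braid_perm n (word_rel {1..<n} (braid_rels n) `` {[(i, True)]}) = transpose i (i + 1)"
proof -
  let ?f = "\<lambda>i::nat. transpose i (i + 1)"
  have f: "?f i \<in> carrier (sym_group n)" if "i \<in> {1..<n}" for i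
    using that by (simp add: sym_group_carrier permutes_swap_id)
  have rels: "word_eval (sym_group n) ?f u = word_eval (sym_group n) ?f v"
    if "(u, v) \<in> braid_rels n" for u v
    using that
    by (auto simp: braid_rels_def sym_group_mult sym_group_one transpose_def fun_eq_iff)
  show "braid_perm n \<in> hom (braid_group n) (sym_group n)"
    unfolding braid_perm_def braid_group_def
    by (rule presented_lift_hom[OF sym_group_is_group f rels])
  assume i: "i \<in> {1..<n}"
  then have "[(i, True)] \<in> words {1..<n}" by (simp add: words_def)
  from presented_lift_class[OF sym_group_is_group f rels this]
  show "braid_perm n (word_rel {1..<n} (braid_rels n) `` {[(i, True)]}) = transpose i (i + 1)"
    by (simp add: braid_perm_def sym_group_mult sym_group_one)
qed

lemma pure_braids_normal: "pure_braids n \<lhd> braid_group n"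
proof -
  have "group_hom (braid_group n) (sym_group n) (braid_perm n)"
    using group_braid_group sym_group_is_group braid_perm_hom
    by (simp add: group_hom_def group_hom_axioms_def)
  then show ?thesis unfolding pure_braids_def by (rule group_hom.normal_kernel)
qed

section \<open>Lower central series\<close>

definition commutator_subgroup :: "('a, 'b) monoid_scheme \<Rightarrow> 'a set \<Rightarrow> 'a set \<Rightarrow> 'a set" where
  "commutator_subgroup G A B =
    generate G (\<Union>a\<in>A. \<Union>b\<in>B. {a \<otimes>\<^bsub>G\<^esub> b \<otimes>\<^bsub>G\<^esub> inv\<^bsub>G\<^esub> a \<otimes>\<^bsub>G\<^esub> inv\<^bsub>G\<^esub> b})"

text \<open>The series is indexed from 1; the value at index 0 is a dummy.\<close>

fun lower_central :: "('a, 'b) monoid_scheme \<Rightarrow> nat \<Rightarrow> 'a set" where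
  "lower_central G 0 = carrier G"
| "lower_central G (Suc 0) = carrier G"
| "lower_central G (Suc (Suc k)) =
    commutator_subgroup G (lower_central G (Suc k)) (carrier G)"

lemma (in group) commutator_subgroup_normal:
  assumes "A \<lhd> G" "B \<lhd> G"
  shows "commutator_subgroup G A B \<lhd> G"
  unfolding commutator_subgroup_def
proof (rule normal_generateI)
  have A: "A \<subseteq> carrier G" and B: "B \<subseteq> carrier G"
    using assms by (auto dest!: normal_imp_subgroup subgroup.subset)
  then show "(\<Union>a\<in>A. \<Union>b\<in>B. {a \<otimes> b \<otimes> inv a \<otimes> inv b}) \<subseteq> carrier G" by (auto simp: subset_iff)
  fix h g assume "h \<in> (\<Union>a\<in>A. \<Union>b\<in>B. {a \<otimes> b \<otimes> inv a \<otimes> inv b})" and g: "g \<in> carrier G"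
  then obtain a b where ab: "a \<in> A" "b \<in> B" and h: "h = a \<otimes> b \<otimes> inv a \<otimes> inv b" by auto
  then have c: "a \<in> carrier G" "b \<in> carrier G" using A B by auto
  let ?a = "g \<otimes> a \<otimes> inv g" and ?b = "g \<otimes> b \<otimes> inv g"
  have x: "inv g \<otimes> (g \<otimes> y) = y" if "y \<in> carrier G" for y
    using that g by (simp flip: m_assoc)
  have "g \<otimes> h \<otimes> inv g = ?a \<otimes> ?b \<otimes> inv ?a \<otimes> inv ?b"
    using c g by (simp add: h m_assoc inv_mult_group x)
  moreover have "?a \<in> A" "?b \<in> B"
    using ab g assms by (auto intro: normal.inv_op_closed2)
  ultimately show "g \<otimes> h \<otimes> inv g \<in> (\<Union>a\<in>A. \<Union>b\<in>B. {a \<otimes> b \<otimes> inv a \<otimes> inv b})" by blast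
qed

lemma (in group) lower_central_normal:
  assumes P: "P \<lhd> G"
  shows "lower_central (G\<lparr>carrier := P\<rparr>) k \<lhd> G \<and> lower_central (G\<lparr>carrier := P\<rparr>) k \<subseteq> P"
proof (induction "G\<lparr>carrier := P\<rparr>" k rule: lower_central.induct)
  case (3 k)
  let ?L = "lower_central (G\<lparr>carrier := P\<rparr>) (Suc k)"
  have sP: "subgroup P G" using P by (rule normal_imp_subgroup)
  have LP: "?L \<subseteq> P" using 3 by blast
  let ?C = "\<Union>a\<in>?L. \<Union>b\<in>P. {a \<otimes> b \<otimes> inv a \<otimes> inv b}"
  have C: "?C \<subseteq> P"
    using LP sP by (auto intro!: subgroup.m_closed subgroup.m_inv_closed)
  have "(\<Union>a\<in>?L. \<Union>b\<in>P. {a \<otimes> b \<otimes> inv\<^bsub>G\<lparr>carrier := P\<rparr>\<^esub> a \<otimes> inv\<^bsub>G\<lparr>carrier := P\<rparr>\<^esub> b}) = ?C"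
    using LP by (intro SUP_cong refl) (auto simp: m_inv_consistent[OF sP])
  then have eq: "lower_central (G\<lparr>carrier := P\<rparr>) (Suc (Suc k)) = commutator_subgroup G ?L P"
    using generate_consistent[OF C sP] by (simp add: commutator_subgroup_def)
  have "commutator_subgroup G ?L P \<lhd> G"
    using 3 P by (blast intro: commutator_subgroup_normal)
  moreover have "commutator_subgroup G ?L P \<subseteq> P"
    unfolding commutator_subgroup_def by (rule generate_subgroup_incl[OF C sP])
  ultimately show ?case unfolding eq by blast
qed (use P in auto)

definition braid_quotient :: "nat \<Rightarrow> nat \<Rightarrow> nat word set set monoid" where
  "braid_quotient n k = braid_group n Mod lower_central (pure_braid_group n) k"

lemma group_braid_quotient: "group (braid_quotient n k)"
  unfolding braid_quotient_def pure_braid_group_def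
  using group.lower_central_normal[OF group_braid_group pure_braids_normal]
  by (blast intro: normal.factorgroup_is_group)

section \<open>Semidirect products and embeddings\<close>

definition semidirect_product ::
  "('a, 'c) monoid_scheme \<Rightarrow> ('b, 'd) monoid_scheme \<Rightarrow> ('b \<Rightarrow> 'a \<Rightarrow> 'a) \<Rightarrow> ('a \<times> 'b) monoid" where
  "semidirect_product N H \<theta> =
    \<lparr>carrier = carrier N \<times> carrier H,
     mult = (\<lambda>(a, h) (b, k). (a \<otimes>\<^bsub>N\<^esub> \<theta> h b, h \<otimes>\<^bsub>H\<^esub> k)),
     one = (\<one>\<^bsub>N\<^esub>, \<one>\<^bsub>H\<^esub>)\<rparr>"

definition embeds :: "('a, 'c) monoid_scheme \<Rightarrow> ('b, 'd) monoid_scheme \<Rightarrow> bool" where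
  "embeds G H \<longleftrightarrow> (\<exists>\<phi>. \<phi> \<in> mon G H)"

lemma group_semidirect_product:
  assumes N: "group N" and H: "group H" and \<theta>: "\<theta> \<in> hom H (AutoGroup N)"
  shows "group (semidirect_product N H \<theta>)"
proof -
  interpret N: group N by (rule N)
  interpret H: group H by (rule H)
  have aut: "\<theta> h \<in> auto N" if "h \<in> carrier H" for h
    using \<theta> that by (auto simp: hom_def AutoGroup_def)
  have cl: "\<theta> h a \<in> carrier N" if "h \<in> carrier H" "a \<in> carrier N" for h a
    using aut[OF that(1)] that(2) by (auto simp: auto_def hom_def)
  have mlt: "\<theta> h (a \<otimes>\<^bsub>N\<^esub> b) = \<theta> h a \<otimes>\<^bsub>N\<^esub> \<theta> h b"
    if "h \<in> carrier H" "a \<in> carrier N" "b \<in> carrier N" for h a b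
    using aut[OF that(1)] that(2,3) by (auto simp: auto_def hom_def)
  have act: "\<theta> (h \<otimes>\<^bsub>H\<^esub> k) a = \<theta> h (\<theta> k a)"
    if "h \<in> carrier H" "k \<in> carrier H" "a \<in> carrier N" for h k a
  proof -
    have "\<theta> h \<in> Bij (carrier N)" "\<theta> k \<in> Bij (carrier N)"
      using aut that by (auto simp: auto_def)
    then show ?thesis
      using \<theta> that by (simp add: hom_def AutoGroup_def BijGroup_def compose_def)
  qed
  have "group_hom H (AutoGroup N) \<theta>"
    using H \<theta> N.AutoGroup by (simp add: group_hom_def group_hom_axioms_def)
  then have "\<theta> \<one>\<^bsub>H\<^esub> = \<one>\<^bsub>AutoGroup N\<^esub>" by (rule group_hom.hom_one)
  then have one: "\<theta> \<one>\<^bsub>H\<^esub> a = a" if "a \<in> carrier N" for a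
    using that by (simp add: AutoGroup_def BijGroup_def)
  show ?thesis
  proof (rule groupI, goal_cases)
    case (5 x)
    then obtain a h where x: "x = (a, h)" "a \<in> carrier N" "h \<in> carrier H"
      by (auto simp: semidirect_product_def)
    have "\<theta> (inv\<^bsub>H\<^esub> h) (inv\<^bsub>N\<^esub> a) \<otimes>\<^bsub>N\<^esub> \<theta> (inv\<^bsub>H\<^esub> h) a = \<theta> (inv\<^bsub>H\<^esub> h) \<one>\<^bsub>N\<^esub>"
      using x by (simp flip: mlt)
    also have "\<dots> = \<one>\<^bsub>N\<^esub>"
      using mlt[of "inv\<^bsub>H\<^esub> h" "\<one>\<^bsub>N\<^esub>" "\<one>\<^bsub>N\<^esub>"] cl[of "inv\<^bsub>H\<^esub> h" "\<one>\<^bsub>N\<^esub>"] x by simp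
    finally show ?case
      using x cl
      by (intro bexI[of _ "(\<theta> (inv\<^bsub>H\<^esub> h) (inv\<^bsub>N\<^esub> a), inv\<^bsub>H\<^esub> h)"])
        (auto simp: semidirect_product_def)
  qed (auto simp: semidirect_product_def cl mlt act one N.m_assoc H.m_assoc)
qed

end

theory Submission
  imports Defs
begin

text \<open>Let \<open>U\<close> be the unipotent group with Lie algebra the degree \<open>\<le> 2\<close> part of the Drinfeld-Kohno
  Lie algebra. Sending \<open>\<sigma>\<^sub>i\<close> to \<open>exp (t\<^sub>i\<^sub>,\<^sub>i\<^sub>+\<^sub>1 / 2)\<close>, with a degree 2 correction whose denominators divide
  24, times a transposition maps \<open>B\<^sub>n\<close> to \<open>U \<rtimes> S\<^sub>n\<close>; the image of \<open>P\<^sub>n\<close> has known lattices as graded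
  pieces, and the kernel on \<open>P\<^sub>n\<close> is \<open>\<Gamma>\<^sub>3(P\<^sub>n)\<close> (\<open>\<Gamma>\<^sub>2(P\<^sub>n)\<close> in degree 1).
  Over a finite group \<open>G \<le> S\<^sub>n\<close>, lifts to \<open>B\<^sub>n\<close> give a cocycle modulo 2 in degree 1. When \<open>|G|\<close> is odd,
  averaging shows it is a coboundary, so that the lifts can be corrected by pure braids to agree
  in degree 1 with a conjugate of \<open>G\<close> in \<open>U \<rtimes> S\<^sub>n\<close>. The degree 2 error is then a cocycle modulo 24,
  again a coboundary when \<open>|G|\<close> is prime to 6. Hence every subgroup of \<open>S\<^sub>n\<close> of odd order embeds in
  \<open>B\<^sub>n/\<Gamma>\<^sub>2(P\<^sub>n)\<close>, and in \<open>B\<^sub>n/\<Gamma>\<^sub>3(P\<^sub>n)\<close> if its order is prime to 6; the gcd condition makes the affine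
  action of \<open>\<int>\<^sub>n \<rtimes> \<int>\<^sub>m\<close> on \<open>\<int>\<^sub>n\<close> faithful.\<close>

section \<open>Commutators and coordinates on nilpotent quotients\<close>

text \<open>No presentation of P_n is used. The kernel of the model on pure braids is squeezed from
  two sides: rewriting in B_n shows that one \<open>A x y\<close> per pair and one commutator per
  triple generate the two graded pieces, and on these generators the model coordinates form a scalar
  matrix, so there are no further relations. The scalars are 2 and 24: two crossings give link 2, a
  commutator of pure braids has twist 6 times the bracket of its links, and 6 * 2 * 2 = 24.
  Averaging divides by the group order only modulo these numbers, and 24 = 2^3 * 3; this is why the
  order must be odd, respectively prime to 6. The recurring obstacle is that conjugation in B_n
  permutes the \<open>A x y\<close> only up to commutators of pure braids. Such errors are harmless
  because \<open>G2\<close> is central in \<open>P\<close> modulo \<open>G3\<close>. Relations can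
  therefore be checked on the first few strands and carried to all others by conjugation.\<close>

context group
begin

text \<open>\<open>X\<close> need not be a subgroup: it is meant for sets of normal forms, where
  only multiplication by one generator can be rewritten. The induction therefore carries X y
  \<subseteq> X, which survives products, instead of y \<in> X.\<close>

lemma generate_subset_right_closed:
  assumes S: "S \<subseteq> carrier G" and X: "X \<subseteq> carrier G" "\<one> \<in> X"
    and mult: "\<And>x s. x \<in> X \<Longrightarrow> s \<in> S \<Longrightarrow> x \<otimes> s \<in> X"
    and div: "\<And>x s. x \<in> X \<Longrightarrow> s \<in> S \<Longrightarrow> x \<otimes> inv s \<in> X"
  shows "generate G S \<subseteq> X"
proof
  fix y assume y: "y \<in> generate G S"
  then have "\<forall>x\<in>X. x \<otimes> y \<in> X"
  proof induction
    case (eng h1 h2)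
    then have "h1 \<in> carrier G" "h2 \<in> carrier G" using generate_in_carrier[OF S] by auto
    with eng X show ?case by (metis m_assoc subsetD)
  qed (use X mult div in auto)
  from bspec[OF this X(2)] show "y \<in> X" using generate_in_carrier[OF S y] by simp
qed

text \<open>This is the centralizer of \<open>c\<close> modulo \<open>H\<close>, without forming
  P/H. With [a,c] = a c a^-1 c^-1, closure comes from [a^-1,c] = a^-1 [a,c]^-1 a and [ab,c] = a
  [b,c] a^-1 [a,c].\<close>

lemma subgroup_commuting_mod:
  assumes P: "subgroup P G" and H: "subgroup H G" "H \<subseteq> P"
    and conj: "\<And>p h. p \<in> P \<Longrightarrow> h \<in> H \<Longrightarrow> p \<otimes> h \<otimes> inv p \<in> H"
    and c: "c \<in> P"
  shows "subgroup {a \<in> P. a \<otimes> c \<otimes> inv a \<otimes> inv c \<in> H} G"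
proof (rule subgroupI)
  have PG: "x \<in> carrier G" if "x \<in> P" for x using subgroup.mem_carrier[OF P that] .
  have cG: "c \<in> carrier G" using c PG by blast
  show "{a \<in> P. a \<otimes> c \<otimes> inv a \<otimes> inv c \<in> H} \<subseteq> carrier G" using PG by auto
  show "{a \<in> P. a \<otimes> c \<otimes> inv a \<otimes> inv c \<in> H} \<noteq> {}"
    using subgroup.one_closed[OF P] subgroup.one_closed[OF H(1)] cG by (auto intro!: exI[of _ \<one>])
  fix a assume a: "a \<in> {a \<in> P. a \<otimes> c \<otimes> inv a \<otimes> inv c \<in> H}"
  then have aG: "a \<in> carrier G" using PG by auto
  have x: "inv a \<otimes> (a \<otimes> y) = y" if "y \<in> carrier G" for y
    using that aG by (simp flip: m_assoc)
  have "inv a \<otimes> inv (a \<otimes> c \<otimes> inv a \<otimes> inv c) \<otimes> inv (inv a) \<in> H"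
    using a conj subgroup.m_inv_closed[OF H(1)] subgroup.m_inv_closed[OF P] by blast
  also have "inv a \<otimes> inv (a \<otimes> c \<otimes> inv a \<otimes> inv c) \<otimes> inv (inv a) = inv a \<otimes> c \<otimes> inv (inv a) \<otimes> inv c"
    using aG cG by (simp add: inv_mult_group m_assoc x)
  finally show "inv a \<in> {a \<in> P. a \<otimes> c \<otimes> inv a \<otimes> inv c \<in> H}"
    using a subgroup.m_inv_closed[OF P] by simp
  fix b assume b: "b \<in> {a \<in> P. a \<otimes> c \<otimes> inv a \<otimes> inv c \<in> H}"
  then have bG: "b \<in> carrier G" using PG by auto
  have y: "inv c \<otimes> (c \<otimes> y) = y" if "y \<in> carrier G" for y
    using that cG by (simp flip: m_assoc)
  have "(a \<otimes> (b \<otimes> c \<otimes> inv b \<otimes> inv c) \<otimes> inv a) \<otimes> (a \<otimes> c \<otimes> inv a \<otimes> inv c) \<in> H"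
    using a b conj subgroup.m_closed[OF H(1)] by blast
  also have "(a \<otimes> (b \<otimes> c \<otimes> inv b \<otimes> inv c) \<otimes> inv a) \<otimes> (a \<otimes> c \<otimes> inv a \<otimes> inv c) =
    (a \<otimes> b) \<otimes> c \<otimes> inv (a \<otimes> b) \<otimes> inv c"
    using aG bG cG by (simp add: inv_mult_group m_assoc x y)
  finally show "a \<otimes> b \<in> {a \<in> P. a \<otimes> c \<otimes> inv a \<otimes> inv c \<in> H}"
    using a b subgroup.m_closed[OF P] by simp
qed

lemma commuting_mod_sym:
  assumes "subgroup H G" "a \<in> carrier G" "b \<in> carrier G" "a \<otimes> b \<otimes> inv a \<otimes> inv b \<in> H"
  shows "b \<otimes> a \<otimes> inv b \<otimes> inv a \<in> H"
proof -
  have "inv (a \<otimes> b \<otimes> inv a \<otimes> inv b) = b \<otimes> a \<otimes> inv b \<otimes> inv a"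
    using assms by (simp add: inv_mult_group m_assoc)
  then show ?thesis using subgroup.m_inv_closed[OF assms(1,4)] by simp
qed

text \<open>The centralizer argument is applied twice: first against a generator, then, after
  swapping the commutator, against any element of the generated subgroup.\<close>

lemma generate_commuting_mod:
  assumes P: "subgroup P G" and H: "subgroup H G" "H \<subseteq> P"
    and conj: "\<And>p h. p \<in> P \<Longrightarrow> h \<in> H \<Longrightarrow> p \<otimes> h \<otimes> inv p \<in> H"
    and S: "S \<subseteq> P" and com: "\<And>a b. a \<in> S \<Longrightarrow> b \<in> S \<Longrightarrow> a \<otimes> b \<otimes> inv a \<otimes> inv b \<in> H"
    and x: "x \<in> generate G S" and y: "y \<in> generate G S"
  shows "x \<otimes> y \<otimes> inv x \<otimes> inv y \<in> H"
proof -
  have PG: "x \<in> carrier G" if "x \<in> P" for x using subgroup.mem_carrier[OF P that] .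
  note sub = subgroup_commuting_mod[OF P H conj]
  have 1: "generate G S \<subseteq> {a \<in> P. a \<otimes> c \<otimes> inv a \<otimes> inv c \<in> H}" if "c \<in> S" for c
    using that S com by (intro generate_subgroup_incl sub) auto
  have gP: "generate G S \<subseteq> P" by (rule generate_subgroup_incl[OF S P])
  have "generate G S \<subseteq> {a \<in> P. a \<otimes> c \<otimes> inv a \<otimes> inv c \<in> H}" if c: "c \<in> generate G S" for c
  proof (intro generate_subgroup_incl sub subsetI)
    show "c \<in> P" using c gP by auto
    fix s assume s: "s \<in> S"
    have "c \<otimes> s \<otimes> inv c \<otimes> inv s \<in> H" using 1[OF s] c by auto
    from commuting_mod_sym[OF H(1) _ _ this]
    show "s \<in> {a \<in> P. a \<otimes> c \<otimes> inv a \<otimes> inv c \<in> H}"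
      using s S PG c gP by auto
  qed
  then show ?thesis using x y by auto
qed

text \<open>The \<open>l i\<close> are coordinates on \<open>D\<close> modulo \<open>N\<close>, dual to the generators \<open>g i\<close> up to the factor \<open>d\<close>.\<close>

context
  fixes D N :: "'a set" and I :: "'i set" and g :: "'i \<Rightarrow> 'a" and l :: "'i \<Rightarrow> 'a \<Rightarrow> int" and d :: int
  assumes D: "subgroup D G" and N: "subgroup N G" "N \<subseteq> D"
    and com: "\<And>a b. a \<in> D \<Longrightarrow> b \<in> D \<Longrightarrow> a \<otimes> b \<otimes> inv a \<otimes> inv b \<in> N"
    and I: "finite I" and g: "\<And>i. i \<in> I \<Longrightarrow> g i \<in> D"
    and add: "\<And>i a b. a \<in> D \<Longrightarrow> b \<in> D \<Longrightarrow> l i (a \<otimes> b) = l i a + l i b"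
    and dual: "\<And>i j. i \<in> I \<Longrightarrow> j \<in> I \<Longrightarrow> l i (g j) = (if i = j then d else 0)"
begin

lemma dual_pow:
  assumes "a \<in> D" shows "l i (a [^] (k::int)) = k * l i a"
proof -
  have aG: "a \<in> carrier G" using subgroup.mem_carrier[OF D assms] .
  have pD: "a [^] (k::int) \<in> D" for k using subgroup_int_pow_closed[OF D assms] .
  have one: "l i \<one> = 0" using add[of \<one> \<one> i] subgroup.one_closed[OF D] by simp
  have nat: "l i (a [^] (int k)) = int k * l i a" for k
  proof (induction k)
    case (Suc k)
    have "a [^] (int (Suc k)) = a [^] (int k) \<otimes> a" by (simp only: int_pow_int nat_pow_Suc)
    then show ?case using Suc add[OF pD[of "int k"] assms, of i] by (simp add: algebra_simps)
  qed (simp add: one)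
  show ?thesis
  proof (cases "k \<ge> 0")
    case True then show ?thesis using nat[of "nat k"] by simp
  next
    case False
    have "a [^] k \<otimes> a [^] (- k) = \<one>" using aG by (simp flip: int_pow_mult)
    then have "l i (a [^] k) + l i (a [^] (- k)) = 0" using add[OF pD pD, of i k "- k"] one by simp
    then show ?thesis using nat[of "nat (- k)"] False by simp
  qed
qed

text \<open>Modulo \<open>N\<close> the \<open>g i\<close> commute, so what they generate is a
  quotient of a free abelian group. The coordinates detect every exponent, up to the factor
  \<open>d\<close>, so an element without coordinates is trivial. The induction removes one
  generator at a time.\<close>

lemma dual_zero:
  assumes d: "d \<noteq> 0" and lN: "\<And>i a. i \<in> I \<Longrightarrow> a \<in> N \<Longrightarrow> l i a = 0"
    and J: "J \<subseteq> I" and x: "x \<in> generate G (N \<union> g ` J)" and zero: "\<And>i. i \<in> J \<Longrightarrow> l i x = 0"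
  shows "x \<in> N"
proof -
  have DG: "a \<in> carrier G" if "a \<in> D" for a using subgroup.mem_carrier[OF D that] .
  have "finite J" using I J finite_subset by blast
  then show ?thesis using J x zero
  proof (induction J arbitrary: x)
    case empty
    then show ?case using generate_subgroup_incl[OF subset_refl N(1)] by auto
  next
    case (insert j J)
    have S: "N \<union> g ` J \<subseteq> D" "g j \<in> D" using insert.prems g N by auto
    let ?H = "generate G (N \<union> g ` J)"
    have HD: "?H \<subseteq> D" by (rule generate_subgroup_incl[OF S(1) D])
    have H: "subgroup ?H G" using S(1) DG by (intro generate_is_subgroup) auto
    have NH: "N \<subseteq> ?H" by (auto intro: generate.incl)
    have gG: "g j \<in> carrier G" using S DG by auto
    \<comment> \<open>Since b^-1 a b = a [a^-1, b^-1] and the commutator lies in \<open>N\<close>,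
      all of \<open>D\<close> normalizes \<open>?H\<close>.\<close>
    have conj: "inv b \<otimes> a \<otimes> b \<in> ?H" if a: "a \<in> ?H" and b: "b \<in> D" for a b
    proof -
      have aD: "a \<in> D" using a HD by auto
      have "inv a \<otimes> inv b \<otimes> inv (inv a) \<otimes> inv (inv b) \<in> ?H"
        using com[of "inv a" "inv b"] aD b subgroup.m_inv_closed[OF D] NH by blast
      then have "a \<otimes> (inv a \<otimes> inv b \<otimes> inv (inv a) \<otimes> inv (inv b)) \<in> ?H"
        using a subgroup.m_closed[OF H] by blast
      also have "a \<otimes> (inv a \<otimes> inv b \<otimes> inv (inv a) \<otimes> inv (inv b)) = inv b \<otimes> a \<otimes> b"
        using DG[OF aD] DG[OF b] by (simp add: m_assoc[symmetric])
      finally show ?thesis .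
    qed
    \<comment> \<open>Normal form with the power of the new generator in front. Its exponent is read
      off by \<open>l j\<close>, which vanishes on \<open>?H\<close>.\<close>
    let ?X = "{g j [^] (k::int) \<otimes> y | k y. y \<in> ?H}"
    have pG: "g j [^] (k::int) \<in> carrier G" for k using gG by simp
    have HG: "y \<in> carrier G" if "y \<in> ?H" for y using that HD DG by auto
    have "generate G (N \<union> g ` insert j J) \<subseteq> ?X"
    proof (rule generate_subset_right_closed)
      show "N \<union> g ` insert j J \<subseteq> carrier G" using S DG by auto
      show "?X \<subseteq> carrier G" using HG gG by auto
      show "\<one> \<in> ?X" using subgroup.one_closed[OF H] by (auto intro!: exI[of _ "0::int"] exI[of _ \<one>])
      fix x s assume "x \<in> ?X" and s: "s \<in> N \<union> g ` insert j J"
      then obtain k y where x: "x = g j [^] (k::int) \<otimes> y" "y \<in> ?H" by blast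
      consider "s \<in> ?H" | "s = g j" using s by (auto intro: generate.incl)
      then have "x \<otimes> s \<in> ?X \<and> x \<otimes> inv s \<in> ?X"
      proof cases
        case 1
        have i: "inv s \<in> ?H" using 1 subgroup.m_inv_closed[OF H] by blast
        have "x \<otimes> s = g j [^] k \<otimes> (y \<otimes> s)" "x \<otimes> inv s = g j [^] k \<otimes> (y \<otimes> inv s)"
          using x HG 1 i gG by (auto simp: m_assoc)
        moreover have "y \<otimes> s \<in> ?H" "y \<otimes> inv s \<in> ?H"
          using x 1 i subgroup.m_closed[OF H] by auto
        ultimately show ?thesis by blast
      next
        case 2
        have y: "y \<in> carrier G" using x HG by auto
        have e: "g j \<otimes> (inv (g j) \<otimes> z) = z" "inv (g j) \<otimes> (g j \<otimes> z) = z" if "z \<in> carrier G" for z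
          using that gG by (simp_all flip: m_assoc)
        have "g j [^] (k + 1) = g j [^] k \<otimes> g j" "g j [^] (k - 1) = g j [^] k \<otimes> inv (g j)"
          using gG int_pow_mult[of "g j" k 1] int_pow_mult[of "g j" k "-1"]
          by (simp_all add: int_pow_neg)
        \<comment> \<open>A new factor \<open>g j\<close> on the right moves to the front by
          conjugating \<open>y\<close>, which stays in \<open>?H\<close>.\<close>
        then have "x \<otimes> s = g j [^] (k + 1) \<otimes> (inv (g j) \<otimes> y \<otimes> g j)"
            "x \<otimes> inv s = g j [^] (k - 1) \<otimes> (inv (inv (g j)) \<otimes> y \<otimes> inv (g j))"
          using x y 2 gG pG by (simp_all add: m_assoc e)
        moreover have "inv (g j) \<otimes> y \<otimes> g j \<in> ?H" "inv (inv (g j)) \<otimes> y \<otimes> inv (g j) \<in> ?H"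
          using x(2) S(2) subgroup.m_inv_closed[OF D] by (blast intro: conj)+
        ultimately show ?thesis by blast
      qed
      then show "x \<otimes> s \<in> ?X" "x \<otimes> inv s \<in> ?X" by auto
    qed
    then obtain k y where x: "x = g j [^] (k::int) \<otimes> y" "y \<in> ?H" using insert.prems by blast
    have yD: "y \<in> D" using x HD by auto
    have jI: "j \<in> I" and JI: "J \<subseteq> I" using insert.prems by auto
    have gD: "g j \<in> D" "g j [^] k \<in> D" using g jI subgroup_int_pow_closed[OF D] by auto
    have li: "l i x = k * (if i = j then d else 0) + l i y" if "i \<in> I" for i
      using x add[OF gD(2) yD, of i] dual_pow[OF gD(1), of i k] dual[OF that jI] by simp
    have "l j y = 0"
    proof -
      have "subgroup {a \<in> D. l j a = 0} G"
      proof (rule subgroupI)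
        have o: "l j \<one> = 0" using add[of \<one> \<one> j] subgroup.one_closed[OF D] by simp
        show "{a \<in> D. l j a = 0} \<subseteq> carrier G" using DG by auto
        show "{a \<in> D. l j a = 0} \<noteq> {}" using o subgroup.one_closed[OF D] by auto
        fix a assume a: "a \<in> {a \<in> D. l j a = 0}"
        then have "l j (a \<otimes> inv a) = l j a + l j (inv a)" using add subgroup.m_inv_closed[OF D] by blast
        then show "inv a \<in> {a \<in> D. l j a = 0}" using a o subgroup.m_inv_closed[OF D] DG by auto
        fix b assume "b \<in> {a \<in> D. l j a = 0}"
        then show "a \<otimes> b \<in> {a \<in> D. l j a = 0}" using a add subgroup.m_closed[OF D] by auto
      qed
      moreover have "l j (g i) = 0" if "i \<in> J" for i
        using dual[OF jI, of i] that JI insert.hyps by auto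
      then have "N \<union> g ` J \<subseteq> {a \<in> D. l j a = 0}" using S(1) lN[OF jI] by auto
      ultimately show ?thesis using generate_subgroup_incl[of "N \<union> g ` J" "{a \<in> D. l j a = 0}"] x(2) by auto
    qed
    then have "k = 0" using li[OF jI] insert.prems(3)[of j] d by simp
    then have "x = y" using x HG by simp
    moreover have "y \<in> N"
      using insert.IH[OF JI x(2)] insert.prems(3) \<open>x = y\<close> by auto
    ultimately show ?case by simp
  qed
qed

text \<open>The witness is the product of the \<open>g i\<close> to the powers \<open>e i\<close>,
  assembled one index at a time.\<close>

lemma dual_surj: "\<exists>x\<in>D. \<forall>i\<in>I. l i x = d * e i"
proof -
  have "\<exists>x\<in>D. \<forall>i\<in>I. l i x = (if i \<in> J then d * e i else 0)" if "finite J" "J \<subseteq> I" for J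
    using that
  proof (induction J)
    case empty
    have "l i \<one> = 0" for i using add[of \<one> \<one> i] subgroup.one_closed[OF D] by simp
    then show ?case using subgroup.one_closed[OF D] by auto
  next
    case (insert j J)
    then obtain x where x: "x \<in> D" "\<And>i. i \<in> I \<Longrightarrow> l i x = (if i \<in> J then d * e i else 0)" by auto
    have jI: "j \<in> I" using insert.prems by auto
    have "l i (x \<otimes> g j [^] e j) = (if i \<in> insert j J then d * e i else 0)" if "i \<in> I" for i
      using add[OF x(1) subgroup_int_pow_closed[OF D g[OF jI]], of i "e j"]
        dual_pow[OF g[OF jI], of i "e j"] dual[OF that jI] x(2)[OF that] insert.hyps by auto
    then show ?case
      using subgroup.m_closed[OF D x(1) subgroup_int_pow_closed[OF D g[OF jI]]] by blast
  qed
  from this[OF I subset_refl] show ?thesis by auto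
qed

end

end

section \<open>The unipotent model\<close>

type_synonym pair_fun = "nat \<Rightarrow> nat \<Rightarrow> int"
type_synonym triple_fun = "nat \<Rightarrow> nat \<Rightarrow> nat \<Rightarrow> int"

text \<open>The coefficient of [t_xy, t_yz] in the bracket of two degree 1 elements. The
  Drinfeld-Kohno relations identify [t_xy, t_yz], [t_yz, t_zx] and [t_zx, t_xy], hence the cyclic
  sum.\<close>

definition bracket :: "pair_fun \<Rightarrow> pair_fun \<Rightarrow> triple_fun" where
  "bracket V W x y z =
    V x y * W y z - V y z * W x y + V y z * W z x - V z x * W y z + V z x * W x y - V x y * W z x"

definition pair_alg :: "nat \<Rightarrow> pair_fun set" where
  "pair_alg n = {V. (\<forall>x y. V x y = V y x) \<and> (\<forall>x. V x x = 0) \<and> (\<forall>x y. x \<notin> {1..n} \<longrightarrow> V x y = 0)}"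

text \<open>Alternating functions, because degree 2 has one basis element [t_xy, t_yz] per triple of
  strands and exchanging two strands reverses its sign.\<close>

definition triple_alg :: "nat \<Rightarrow> triple_fun set" where
  "triple_alg n = {w. (\<forall>x y z. w x y z = w y z x) \<and> (\<forall>x y z. w y x z = - w x y z) \<and>
    (\<forall>x y z. x \<notin> {1..n} \<longrightarrow> w x y z = 0)}"

text \<open>The semidirect product of the unipotent group by the symmetric group, acting on the right by
  precomposition. Degree 1 is scaled by 2 and degree 2 by 24 to keep everything integral, so the
  Baker-Campbell-Hausdorff term \<open>1/2 [V, W]\<close> becomes \<open>24/2 \<cdot> 1/4 \<cdot> bracket V W\<close>.\<close>

definition braid_model :: "nat \<Rightarrow> ((nat \<Rightarrow> nat) \<times> pair_fun \<times> triple_fun) monoid" where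
  "braid_model n =
    \<lparr>carrier = {p. p permutes {1..n}} \<times> pair_alg n \<times> triple_alg n,
     mult = (\<lambda>(p, V, w) (p', V', w'). (p \<circ> p', \<lambda>x y. V (p' x) (p' y) + V' x y,
       \<lambda>x y z. w (p' x) (p' y) (p' z) + w' x y z + 3 * bracket (\<lambda>x y. V (p' x) (p' y)) V' x y z)),
     one = (id, \<lambda>x y. 0, \<lambda>x y z. 0)\<rparr>"

lemma pair_alg_comp:
  assumes "V \<in> pair_alg n" "p permutes {1..n}"
  shows "(\<lambda>x y. V (p x) (p y)) \<in> pair_alg n"
  using assms permutes_in_image[OF assms(2)] unfolding pair_alg_def by blast

lemma triple_alg_comp:
  assumes "w \<in> triple_alg n" "p permutes {1..n}"
  shows "(\<lambda>x y z. w (p x) (p y) (p z)) \<in> triple_alg n"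
  using assms permutes_in_image[OF assms(2)] unfolding triple_alg_def by blast

lemma triple_algD:
  assumes "w \<in> triple_alg n"
  shows "w x y z = w y z x" "w y x z = - w x y z" "x \<notin> {1..n} \<Longrightarrow> w x y z = 0"
  using assms unfolding triple_alg_def by blast+

lemma pair_algD:
  assumes "V \<in> pair_alg n"
  shows "V x y = V y x" "V x x = 0" "x \<notin> {1..n} \<Longrightarrow> V x y = 0" "x \<notin> {1..n} \<Longrightarrow> V y x = 0"
proof -
  have *: "\<forall>x y. V x y = V y x" "\<forall>x. V x x = 0" "\<forall>x y. x \<notin> {1..n} \<longrightarrow> V x y = 0"
    using assms unfolding pair_alg_def by blast+
  show "V x y = V y x" "V x x = 0" using *(1,2) by blast+
  show "V x y = 0" "V y x = 0" if "x \<notin> {1..n}" using *(1,3) that by metis+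
qed

lemma pair_alg_add: "V \<in> pair_alg n \<Longrightarrow> V' \<in> pair_alg n \<Longrightarrow> (\<lambda>x y. V x y + V' x y) \<in> pair_alg n"
  and pair_alg_scale: "V \<in> pair_alg n \<Longrightarrow> (\<lambda>x y. c * V x y) \<in> pair_alg n"
  and pair_alg_zero: "(\<lambda>x y. 0) \<in> pair_alg n"
  by (auto simp: pair_alg_def)

lemma triple_alg_add: "w \<in> triple_alg n \<Longrightarrow> w' \<in> triple_alg n \<Longrightarrow> (\<lambda>x y z. w x y z + w' x y z) \<in> triple_alg n"
  and triple_alg_scale: "w \<in> triple_alg n \<Longrightarrow> (\<lambda>x y z. c * w x y z) \<in> triple_alg n"
  and triple_alg_zero: "(\<lambda>x y z. 0) \<in> triple_alg n"
  unfolding triple_alg_def mem_Collect_eq by (metis add.inverse_distrib_swap add.commute add_0, metis mult_minus_right mult_zero_right, simp)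

lemma bracket_in_triple_alg:
  assumes V: "V \<in> pair_alg n" and W: "W \<in> pair_alg n"
  shows "bracket V W \<in> triple_alg n"
proof -
  have "bracket V W x y z = bracket V W y z x" for x y z by (simp add: bracket_def)
  moreover have "bracket V W y x z = - bracket V W x y z" for x y z
    using pair_algD(1)[OF V, of y x] pair_algD(1)[OF V, of x z] pair_algD(1)[OF V, of z y]
      pair_algD(1)[OF W, of y x] pair_algD(1)[OF W, of x z] pair_algD(1)[OF W, of z y]
    by (simp add: bracket_def)
  moreover have "bracket V W x y z = 0" if "x \<notin> {1..n}" for x y z
    using that V W by (simp add: bracket_def pair_algD(3,4)[OF V that] pair_algD(3,4)[OF W that])
  ultimately show ?thesis unfolding triple_alg_def by blast
qed

lemmas alg_closed = pair_alg_comp triple_alg_comp pair_alg_add pair_alg_scale pair_alg_zero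
  triple_alg_add triple_alg_scale triple_alg_zero bracket_in_triple_alg

lemma group_braid_model: "group (braid_model n)"
proof (rule groupI)
  show "\<one>\<^bsub>braid_model n\<^esub> \<in> carrier (braid_model n)"
    by (simp add: braid_model_def permutes_id alg_closed)
  fix a assume "a \<in> carrier (braid_model n)"
  then obtain p V w where a: "a = (p, V, w)" "p permutes {1..n}" "V \<in> pair_alg n" "w \<in> triple_alg n"
    by (auto simp: braid_model_def)
  show "\<one>\<^bsub>braid_model n\<^esub> \<otimes>\<^bsub>braid_model n\<^esub> a = a"
    by (simp add: a braid_model_def bracket_def)
  show "\<exists>b\<in>carrier (braid_model n). b \<otimes>\<^bsub>braid_model n\<^esub> a = \<one>\<^bsub>braid_model n\<^esub>"
  proof
    let ?q = "inv_into UNIV p"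
    have q: "?q permutes {1..n}" using a permutes_inv by blast
    \<comment> \<open>No bracket term is needed: \<open>V\<close> brackets to zero with its own
      negative.\<close>
    let ?b = "(?q, \<lambda>x y. (-1) * V (?q x) (?q y), \<lambda>x y z. (-1) * w (?q x) (?q y) (?q z))"
    show "?b \<in> carrier (braid_model n)"
      using q pair_alg_scale[OF pair_alg_comp[OF a(3) q], of "-1"]
        triple_alg_scale[OF triple_alg_comp[OF a(4) q], of "-1"]
      by (simp add: braid_model_def)
    show "?b \<otimes>\<^bsub>braid_model n\<^esub> a = \<one>\<^bsub>braid_model n\<^esub>"
      using a permutes_inv_o[OF a(2)] permutes_inverses[OF a(2)]
      by (simp add: braid_model_def bracket_def)
  qed
  fix b assume "b \<in> carrier (braid_model n)"
  then obtain p' V' w' where b: "b = (p', V', w')" "p' permutes {1..n}" "V' \<in> pair_alg n" "w' \<in> triple_alg n"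
    by (auto simp: braid_model_def)
  show "a \<otimes>\<^bsub>braid_model n\<^esub> b \<in> carrier (braid_model n)"
    using a b by (auto simp: braid_model_def intro!: permutes_compose alg_closed)
  fix c assume "c \<in> carrier (braid_model n)"
  then obtain p'' V'' w'' where c: "c = (p'', V'', w'')"
    by (auto simp: braid_model_def)
  show "a \<otimes>\<^bsub>braid_model n\<^esub> b \<otimes>\<^bsub>braid_model n\<^esub> c = a \<otimes>\<^bsub>braid_model n\<^esub> (b \<otimes>\<^bsub>braid_model n\<^esub> c)"
    by (simp add: a b c braid_model_def bracket_def fun_eq_iff algebra_simps)
qed

text \<open>The coefficient 1/2 of t_{i,i+1}, scaled by 2.\<close>

definition model_cross :: "nat \<Rightarrow> pair_fun" where
  "model_cross i x y = (if x = i \<and> y = i + 1 \<or> x = i + 1 \<and> y = i then 1 else 0)"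

definition model_sign :: "nat \<Rightarrow> pair_fun" where
  "model_sign i x y = (if x = i \<and> y = i + 1 then 1 else if x = i + 1 \<and> y = i then - 1 else 0)"

text \<open>Conjugating by an associator with degree 2 term 1/24 [X, Y], where X is the sum of the
  t_{z,i} over z < i and Y = t_{i,i+1}, changes degree 2 by 1/12 [X, Y] up to sign. Scaled by 24
  this is a 2 for every z < i.\<close>

definition model_low :: "nat \<Rightarrow> nat \<Rightarrow> int" where
  "model_low i z = (if 1 \<le> z \<and> z < i then 2 else 0)"

text \<open>The braid relation forces the coefficients of this correction at \<open>(i, i + 1, z)\<close> for \<open>z < i\<close> and
  for \<open>z > i + 1\<close> to differ by 2.\<close>

definition model_twist :: "nat \<Rightarrow> triple_fun" where
  "model_twist i x y z =
    model_sign i x y * model_low i z + model_sign i y z * model_low i x + model_sign i z x * model_low i y"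

section \<open>The braid relations for the images of the generators\<close>

definition model_gen :: "nat \<Rightarrow> (nat \<Rightarrow> nat) \<times> pair_fun \<times> triple_fun" where
  "model_gen i = (transpose i (i + 1), model_cross i, model_twist i)"

lemma model_gen_closed:
  assumes "i \<in> {1..<n}" shows "model_gen i \<in> carrier (braid_model n)"
proof -
  have "transpose i (i + 1) permutes {1..n}" using assms by (intro permutes_swap_id) auto
  moreover have "model_cross i \<in> pair_alg n" using assms by (auto simp: pair_alg_def model_cross_def)
  moreover have "model_twist i x y z = model_twist i y z x"
      "model_twist i y x z = - model_twist i x y z" for x y z
    by (auto simp: model_twist_def model_sign_def)
  moreover have "model_twist i x y z = 0" if "x \<notin> {1..n}" for x y z
    using that assms by (auto simp: model_twist_def model_sign_def model_low_def)
  ultimately have "model_cross i \<in> pair_alg n" "model_twist i \<in> triple_alg n"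
    unfolding triple_alg_def by blast+
  then show ?thesis using \<open>transpose i (i + 1) permutes {1..n}\<close> by (simp add: model_gen_def braid_model_def)
qed

text \<open>Over the integers an alternating function vanishes at repeated arguments; elsewhere
  sorting the arguments changes only the sign.\<close>

lemma triple_alg_eqI:
  assumes w: "w \<in> triple_alg n" and w': "w' \<in> triple_alg n"
    and eq: "\<And>x y z. x \<in> {1..n} \<Longrightarrow> y \<in> {1..n} \<Longrightarrow> z \<in> {1..n} \<Longrightarrow> x < y \<Longrightarrow> y < z \<Longrightarrow> w x y z = w' x y z"
  shows "w = w'"
proof (intro ext)
  fix x y z
  have dist: "v a b c = 0" if "v \<in> triple_alg n" "a = b \<or> b = c \<or> c = a \<or> \<not> {a, b, c} \<subseteq> {1..n}" for v a b c
  proof -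
    have "v a a c = 0" "v a c c = 0" "v a c a = 0" for a c
      using triple_algD(1)[OF that(1), of a c c] triple_algD(1)[OF that(1), of a c a] triple_algD(1)[OF that(1), of c a a]
        triple_algD(1)[OF that(1), of a a c]
        triple_algD(2)[OF that(1), of a a c] triple_algD(2)[OF that(1), of c c a]
        triple_algD(2)[OF that(1), of a a c] by auto
    moreover have "v a b c = 0" if "\<not> {a, b, c} \<subseteq> {1..n}"
      using that triple_algD(1,3)[OF \<open>v \<in> triple_alg n\<close>] by (metis empty_subsetI insert_subset)
    ultimately show ?thesis using that by auto
  qed
  show "w x y z = w' x y z"
  proof (cases "x = y \<or> y = z \<or> z = x \<or> \<not> {x, y, z} \<subseteq> {1..n}")
    case True then show ?thesis using dist[OF w] dist[OF w'] by metis
  next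
    case False
    then have r: "x \<in> {1..n}" "y \<in> {1..n}" "z \<in> {1..n}" by auto
    have cyc: "v x y z = v y z x" "v x y z = v z x y" "v x y z = - v y x z" "v x y z = - v x z y"
      "v x y z = - v z y x" if "v \<in> triple_alg n" for v
      using triple_algD(1,2)[OF that] by metis+
    consider "x < y" "y < z" | "x < z" "z < y" | "y < x" "x < z" | "y < z" "z < x" | "z < x" "x < y" | "z < y" "y < x"
      using False by fastforce
    then show ?thesis
    proof cases
      case 1 then show ?thesis using eq r by auto
    next
      case 2 then show ?thesis using eq[of x z y] r cyc(4)[OF w] cyc(4)[OF w'] by simp
    next
      case 3 then show ?thesis using eq[of y x z] r cyc(3)[OF w] cyc(3)[OF w'] by simp
    next
      case 4 then show ?thesis using eq[of y z x] r cyc(1)[OF w] cyc(1)[OF w'] by simp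
    next
      case 5 then show ?thesis using eq[of z x y] r cyc(2)[OF w] cyc(2)[OF w'] by simp
    next
      case 6 then show ?thesis using eq[of z y x] r cyc(5)[OF w] cyc(5)[OF w'] by simp
    qed
  qed
qed

lemma model_eqI:
  assumes "a \<in> carrier (braid_model n)" "b \<in> carrier (braid_model n)" "fst a = fst b" 
    "\<And>x y. x < y \<Longrightarrow> fst (snd a) x y = fst (snd b) x y"
    "\<And>x y z. x < y \<Longrightarrow> y < z \<Longrightarrow> snd (snd a) x y z = snd (snd b) x y z"
  shows "a = b"
proof -
  obtain p V w where a: "a = (p, V, w)" "V \<in> pair_alg n" "w \<in> triple_alg n"
    using assms(1) by (auto simp: braid_model_def)
  obtain p' V' w' where b: "b = (p', V', w')" "V' \<in> pair_alg n" "w' \<in> triple_alg n"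
    using assms(2) by (auto simp: braid_model_def)
  have "w = w'" using triple_alg_eqI[OF a(3) b(3)] assms(5) a b by auto
  moreover have "V x y = V' x y" for x y
    using assms(4)[of x y] assms(4)[of y x] pair_algD(1,2)[OF a(2)] pair_algD(1,2)[OF b(2)] a b
    by (cases x y rule: linorder_cases) auto
  then have "V = V'" by blast
  ultimately show ?thesis using a b assms(3) by simp
qed

lemma model_mult:
  "(p, V, w) \<otimes>\<^bsub>braid_model n\<^esub> (p', V', w') = (p \<circ> p', \<lambda>x y. V (p' x) (p' y) + V' x y,
       \<lambda>x y z. w (p' x) (p' y) (p' z) + w' x y z + 3 * bracket (\<lambda>x y. V (p' x) (p' y)) V' x y z)"
  by (simp add: braid_model_def)

lemma model_far:
  assumes "i \<in> {1..<n}" "j \<in> {1..<n}" "i + 2 \<le> j"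
  shows "model_gen i \<otimes>\<^bsub>braid_model n\<^esub> model_gen j = model_gen j \<otimes>\<^bsub>braid_model n\<^esub> model_gen i"
proof -
  interpret M: group "braid_model n" by (rule group_braid_model)
  show ?thesis
  proof (rule model_eqI[of _ n])
    show "model_gen i \<otimes>\<^bsub>braid_model n\<^esub> model_gen j \<in> carrier (braid_model n)"
      "model_gen j \<otimes>\<^bsub>braid_model n\<^esub> model_gen i \<in> carrier (braid_model n)"
      using assms model_gen_closed by auto
    show "fst (model_gen i \<otimes>\<^bsub>braid_model n\<^esub> model_gen j) = fst (model_gen j \<otimes>\<^bsub>braid_model n\<^esub> model_gen i)"
      using assms by (auto simp: model_gen_def model_mult fun_eq_iff transpose_def)
    have 1: "(transpose j (Suc j) x = i) = (x = i)" "(transpose j (Suc j) x = Suc i) = (x = Suc i)"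
      "(transpose i (Suc i) x = j) = (x = j)" "(transpose i (Suc i) x = Suc j) = (x = Suc j)" for x
      using assms by (auto simp: transpose_def)
    have c: "model_cross i (transpose j (j + 1) x) (transpose j (j + 1) y) = model_cross i x y" 
      "model_cross j (transpose i (i + 1) x) (transpose i (i + 1) y) = model_cross j x y" for x y
      by (simp_all add: model_cross_def 1)
    then show "fst (snd (model_gen i \<otimes>\<^bsub>braid_model n\<^esub> model_gen j)) x y =
        fst (snd (model_gen j \<otimes>\<^bsub>braid_model n\<^esub> model_gen i)) x y" for x y
      by (simp add: model_gen_def model_mult)
    have d: "model_twist i (transpose j (j + 1) x) (transpose j (j + 1) y) (transpose j (j + 1) z) = model_twist i x y z" 
      "model_twist j (transpose i (i + 1) x) (transpose i (i + 1) y) (transpose i (i + 1) z) = model_twist j x y z" for x y z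
    proof -
      \<comment> \<open>Two neighbouring strands of one crossing lie on the same side of the other
        crossing, and the correction treats all strands below a crossing alike.\<close>
      have "model_low i (transpose j (j + 1) x) = model_low i x"
        "model_low j (transpose i (i + 1) x) = model_low j x" for x
        using assms by (auto simp: model_low_def transpose_def)
      moreover have "model_sign i (transpose j (j + 1) x) (transpose j (j + 1) y) = model_sign i x y"
        "model_sign j (transpose i (i + 1) x) (transpose i (i + 1) y) = model_sign j x y" for x y
        by (simp_all add: model_sign_def 1)
      ultimately show "model_twist i (transpose j (j + 1) x) (transpose j (j + 1) y) (transpose j (j + 1) z) = model_twist i x y z" 
      "model_twist j (transpose i (i + 1) x) (transpose i (i + 1) y) (transpose i (i + 1) z) = model_twist j x y z" for x y z
        by (simp_all only: model_twist_def)
    qed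
    have b: "bracket (model_cross i) (model_cross j) x y z = 0" "bracket (model_cross j) (model_cross i) x y z = 0" for x y z
    proof -
      \<comment> \<open>Crossing pairs without a common strand have no bracket.\<close>
      have "model_cross i x y * model_cross j y z = 0" "model_cross i x y * model_cross j z x = 0"
        "model_cross j x y * model_cross i y z = 0" "model_cross j x y * model_cross i z x = 0" for x y z
        using assms by (auto simp: model_cross_def)
      note p = this
      have "model_cross i y z * model_cross j x y = 0" "model_cross j y z * model_cross i x y = 0" for x y z
        using p(1,3)[of x y z] by (simp_all only: mult.commute)
      with p show "bracket (model_cross i) (model_cross j) x y z = 0" "bracket (model_cross j) (model_cross i) x y z = 0" for x y z
        by (simp_all only: bracket_def diff_0_right add_0 diff_self)
    qed
    show "snd (snd (model_gen i \<otimes>\<^bsub>braid_model n\<^esub> model_gen j)) x y z =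
        snd (snd (model_gen j \<otimes>\<^bsub>braid_model n\<^esub> model_gen i)) x y z" for x y z
      using c d b by (simp add: model_gen_def model_mult)
  qed
qed

lemma model_braid:
  assumes "1 \<le> i" "i + 2 \<le> n"
  shows "model_gen i \<otimes>\<^bsub>braid_model n\<^esub> model_gen (i + 1) \<otimes>\<^bsub>braid_model n\<^esub> model_gen i =
    model_gen (i + 1) \<otimes>\<^bsub>braid_model n\<^esub> model_gen i \<otimes>\<^bsub>braid_model n\<^esub> model_gen (i + 1)"
    (is "?a = ?b")
proof -
  interpret M: group "braid_model n" by (rule group_braid_model)
  show ?thesis
  proof (rule model_eqI[of _ n])
    have "i \<in> {1..<n}" "i + 1 \<in> {1..<n}" using assms by auto
    then show "?a \<in> carrier (braid_model n)" "?b \<in> carrier (braid_model n)"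
      using model_gen_closed by auto
    show "fst ?a = fst ?b"
      by (auto simp: model_gen_def model_mult fun_eq_iff transpose_def)
    have s: "(transpose i (Suc i) x = i) = (x = Suc i)" "(transpose i (Suc i) x = Suc i) = (x = i)"
      "(transpose i (Suc i) x = Suc (Suc i)) = (x = Suc (Suc i))"
      "(transpose (Suc i) (Suc (Suc i)) x = i) = (x = i)"
      "(transpose (Suc i) (Suc (Suc i)) x = Suc i) = (x = Suc (Suc i))"
      "(transpose (Suc i) (Suc (Suc i)) x = Suc (Suc i)) = (x = Suc i)" for x
      by (auto simp: transpose_def)
    show "fst (snd ?a) x y = fst (snd ?b) x y" for x y
      by (simp add: model_gen_def model_mult model_cross_def s)
    show "snd (snd ?a) x y z = snd (snd ?b) x y z" if lt: "x < y" "y < z" for x y z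
    proof -
      have low: "model_low i (transpose i (Suc i) x) = model_low i x"
        "model_low i (transpose (Suc i) (Suc (Suc i)) x) = model_low i x"
        "model_low (Suc i) x = model_low i x + (if x = i then 2 else 0)"
        "model_low i i = 0" "model_low i (Suc i) = 0" "model_low i (Suc (Suc i)) = 0" for x
        using assms by (auto simp: model_low_def transpose_def)
      let ?m = "\<lambda>x. x = i \<or> x = Suc i \<or> x = Suc (Suc i)"
      note defs = model_gen_def model_mult model_twist_def model_sign_def model_cross_def bracket_def s low
      \<comment> \<open>Brackets survive only when all three arguments are among the strands
        \<open>i\<close>, \<open>i + 1\<close>, \<open>i + 2\<close>. In case \<open>three\<close>
        they contribute 3 on the left and -3 on the right, and the coefficient 2 of the second
        generator at strand \<open>i\<close> balances them: -2 + 3 = 2 * 2 - 3.\<close>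
      consider (three) "x = i" "y = Suc i" "z = Suc (Suc i)"
        | (yz) "\<not> ?m x" "y = i" "z = Suc i" | (yz') "\<not> ?m x" "y = i" "z = Suc (Suc i)"
        | (yz'') "\<not> ?m x" "y = Suc i" "z = Suc (Suc i)"
        | (xy) "\<not> ?m z" "x = i" "y = Suc i" | (xy') "\<not> ?m z" "x = i" "y = Suc (Suc i)"
        | (xy'') "\<not> ?m z" "x = Suc i" "y = Suc (Suc i)"
        | (x_y) "\<not> ?m x" "\<not> ?m y" | (x_z) "\<not> ?m x" "\<not> ?m z" | (y_z) "\<not> ?m y" "\<not> ?m z"
      proof (cases "?m x")
        case x: True
        show ?thesis
        proof (cases "?m y")
          case y: True
          have 1: "x = i \<and> y = Suc i \<or> x = i \<and> y = Suc (Suc i) \<or> x = Suc i \<and> y = Suc (Suc i)"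
            using lt(1) x y by auto
          show ?thesis
          proof (cases "?m z")
            case True
            then have "z = Suc (Suc i)" "x = i" "y = Suc i" using 1 lt(2) by auto
            then show ?thesis by (intro three)
          next
            case False
            then show ?thesis using 1 xy xy' xy'' by meson
          qed
        next
          case False
          moreover from False x lt have "\<not> ?m z" by auto
          ultimately show ?thesis by (rule y_z)
        qed
      next
        case x: False
        show ?thesis
        proof (cases "?m y")
          case y: True
          show ?thesis
          proof (cases "?m z")
            case True
            have "y = i \<and> z = Suc i \<or> y = i \<and> z = Suc (Suc i) \<or> y = Suc i \<and> z = Suc (Suc i)"
              using lt(2) y True by auto
            then show ?thesis using x yz yz' yz'' by meson
          next
            case False
            with x show ?thesis by (rule x_z)
          qed
        next
          case False
          with x show ?thesis by (rule x_y)
        qed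
      qed
      then show ?thesis
        by cases (simp_all add: defs)
    qed
  qed
qed

section \<open>Pure braids and the squares of the generators\<close>

text \<open>Inverses and generated subgroups of the group restricted to \<open>P\<close> agree with
  those of \<open>G\<close>, so all later commutators can be computed in \<open>G\<close>.\<close>

lemma (in group) lower_central_Suc:
  assumes P: "P \<lhd> G"
  shows "lower_central (G\<lparr>carrier := P\<rparr>) (Suc (Suc k)) =
    commutator_subgroup G (lower_central (G\<lparr>carrier := P\<rparr>) (Suc k)) P"
proof -
  let ?L = "lower_central (G\<lparr>carrier := P\<rparr>) (Suc k)"
  let ?C = "\<Union>a\<in>?L. \<Union>b\<in>P. {a \<otimes> b \<otimes> inv a \<otimes> inv b}"
  have sP: "subgroup P G" using P by (rule normal_imp_subgroup)
  have LP: "?L \<subseteq> P" using lower_central_normal[OF P] by blast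
  have C: "?C \<subseteq> P" using LP sP by (auto intro!: subgroup.m_closed subgroup.m_inv_closed)
  have "(\<Union>a\<in>?L. \<Union>b\<in>P. {a \<otimes> b \<otimes> inv\<^bsub>G\<lparr>carrier := P\<rparr>\<^esub> a \<otimes> inv\<^bsub>G\<lparr>carrier := P\<rparr>\<^esub> b}) = ?C"
    using LP by (intro SUP_cong refl) (auto simp: m_inv_consistent[OF sP])
  then show ?thesis using generate_consistent[OF C sP] by (simp add: commutator_subgroup_def)
qed

section \<open>The homomorphism from the braid group to the model\<close>

locale braid = group B for B :: "nat word set monoid" (structure) + 
  fixes n :: nat
  assumes B_def: "B = braid_group n"
begin

definition sig :: "nat \<Rightarrow> nat word set" where
  "sig i = word_rel {1..<n} (braid_rels n) `` {[(i, True)]}"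

definition Phi :: "nat word set \<Rightarrow> (nat \<Rightarrow> nat) \<times> pair_fun \<times> triple_fun" where
  "Phi = presented_lift (braid_model n) model_gen"

definition perm :: "nat word set \<Rightarrow> nat \<Rightarrow> nat" where "perm x = fst (Phi x)"
definition link :: "nat word set \<Rightarrow> pair_fun" where "link x = fst (snd (Phi x))"
definition twist :: "nat word set \<Rightarrow> triple_fun" where "twist x = snd (snd (Phi x))"

lemma gen_word: "i \<in> {1..<n} \<Longrightarrow> [(i, b)] \<in> words {1..<n}"
  by (simp add: words_def)

lemma sig_closed: "i \<in> {1..<n} \<Longrightarrow> sig i \<in> carrier B"
  unfolding sig_def B_def braid_group_def carrier_presented_group using gen_word by blast

lemma one_class: "\<one> = word_rel {1..<n} (braid_rels n) `` {[]}"
  by (simp add: B_def braid_group_def presented_group_def)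

lemma mult_class:
  assumes "u \<in> words {1..<n}" "v \<in> words {1..<n}"
  shows "(word_rel {1..<n} (braid_rels n) `` {u}) \<otimes> (word_rel {1..<n} (braid_rels n) `` {v}) =
    word_rel {1..<n} (braid_rels n) `` {u @ v}"
  unfolding B_def braid_group_def by (rule mult_presented_group[OF assms])

lemma inv_sig:
  assumes i: "i \<in> {1..<n}"
  shows "inv (sig i) = word_rel {1..<n} (braid_rels n) `` {[(i, False)]}"
proof -
  have "sig i \<otimes> (word_rel {1..<n} (braid_rels n) `` {[(i, False)]}) = \<one>"
    unfolding sig_def mult_class[OF gen_word[OF i] gen_word[OF i]] one_class
    using word_eq.cancel[OF i, of "braid_rels n" True] i
    by (subst word_class_eq_iff) (auto simp: words_def)
  moreover have "word_rel {1..<n} (braid_rels n) `` {[(i, False)]} \<in> carrier B"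
    unfolding B_def braid_group_def carrier_presented_group using gen_word[OF i] by blast
  ultimately show ?thesis using sig_closed[OF i] inv_equality inv_comm by metis
qed

lemma braid_induct [consumes 1, case_names one sig inv]:
  assumes x: "x \<in> carrier B" and one: "Q \<one>"
    and sig: "\<And>i x. i \<in> {1..<n} \<Longrightarrow> x \<in> carrier B \<Longrightarrow> Q x \<Longrightarrow> Q (sig i \<otimes> x)"
    and inv: "\<And>i x. i \<in> {1..<n} \<Longrightarrow> x \<in> carrier B \<Longrightarrow> Q x \<Longrightarrow> Q (inv (sig i) \<otimes> x)"
  shows "Q x"
proof -
  have "Q (word_rel {1..<n} (braid_rels n) `` {w})" if "w \<in> words {1..<n}" for w
    using that
  proof (induction w)
    case Nil
    then show ?case using one one_class by simp
  next
    case (Cons y w)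
    obtain i b where y: "y = (i, b)" by fastforce
    have i: "i \<in> {1..<n}" and w: "w \<in> words {1..<n}" using Cons.prems y by (auto simp: words_def)
    have wB: "word_rel {1..<n} (braid_rels n) `` {w} \<in> carrier B"
      unfolding B_def braid_group_def carrier_presented_group using w by blast
    have "word_rel {1..<n} (braid_rels n) `` {y # w} =
        (word_rel {1..<n} (braid_rels n) `` {[(i, b)]}) \<otimes> (word_rel {1..<n} (braid_rels n) `` {w})"
      using mult_class[OF gen_word[OF i] w, of b] y by simp
    then show ?case
      using sig[OF i wB Cons.IH[OF w]] inv[OF i wB Cons.IH[OF w]] inv_sig[OF i]
      by (cases b) (simp_all add: sig_def)
  qed
  then show ?thesis using x unfolding B_def braid_group_def carrier_presented_group by auto
qed

lemma sig_rel:
  assumes "(u, v) \<in> braid_rels n" "u \<in> words {1..<n}" "v \<in> words {1..<n}"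
  shows "word_rel {1..<n} (braid_rels n) `` {u} = word_rel {1..<n} (braid_rels n) `` {v}"
  using assms word_class_eq_iff word_eq.relation by metis

lemma sig_far:
  assumes "i \<in> {1..<n}" "j \<in> {1..<n}" "i + 2 \<le> j \<or> j + 2 \<le> i"
  shows "sig i \<otimes> sig j = sig j \<otimes> sig i"
  unfolding sig_def mult_class[OF gen_word[OF assms(1)] gen_word[OF assms(2)]]
    mult_class[OF gen_word[OF assms(2)] gen_word[OF assms(1)]]
  by (rule sig_rel) (use assms in \<open>auto simp: braid_rels_def words_def\<close>)

lemma sig_braid:
  assumes "1 \<le> i" "i + 2 \<le> n"
  shows "sig i \<otimes> sig (Suc i) \<otimes> sig i = sig (Suc i) \<otimes> sig i \<otimes> sig (Suc i)"
proof -
  have i: "i \<in> {1..<n}" "Suc i \<in> {1..<n}" using assms by auto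
  have w: "[(i, True), (Suc i, True)] \<in> words {1..<n}" "[(Suc i, True), (i, True)] \<in> words {1..<n}"
    using i by (auto simp: words_def)
  have "sig i \<otimes> sig (Suc i) \<otimes> sig i =
      word_rel {1..<n} (braid_rels n) `` {[(i, True), (i + 1, True), (i, True)]}"
    unfolding sig_def using mult_class[OF gen_word[OF i(1)] gen_word[OF i(2)]]
      mult_class[OF w(1) gen_word[OF i(1)]] by simp
  also have "\<dots> = word_rel {1..<n} (braid_rels n) `` {[(i + 1, True), (i, True), (i + 1, True)]}"
    by (rule sig_rel) (use assms in \<open>auto simp: braid_rels_def words_def\<close>)
  also have "\<dots> = sig (Suc i) \<otimes> sig i \<otimes> sig (Suc i)"
    unfolding sig_def using mult_class[OF gen_word[OF i(2)] gen_word[OF i(1)]]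
      mult_class[OF w(2) gen_word[OF i(2)]] by simp
  finally show ?thesis .
qed

lemma
  shows Phi_hom: "Phi \<in> hom B (braid_model n)"
    and Phi_sig: "i \<in> {1..<n} \<Longrightarrow> Phi (sig i) = model_gen i"
proof -
  interpret M: group "braid_model n" by (rule group_braid_model)
  have rels: "word_eval (braid_model n) model_gen u = word_eval (braid_model n) model_gen v"
    if uv: "(u, v) \<in> braid_rels n" for u v
  proof -
    from uv consider i j where "i \<in> {1..<n}" "j \<in> {1..<n}" "\<bar>int i - int j\<bar> \<ge> 2"
        "u = [(i, True), (j, True)]" "v = [(j, True), (i, True)]"
      | i where "1 \<le> i" "i + 2 \<le> n" "u = [(i, True), (i + 1, True), (i, True)]"
        "v = [(i + 1, True), (i, True), (i + 1, True)]"
      unfolding braid_rels_def by blast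
    then show ?thesis
    proof cases
      case 1
      then have "i + 2 \<le> j \<or> j + 2 \<le> i" by linarith
      then show ?thesis using 1 model_far[of i n j] model_far[of j n i] model_gen_closed by auto
    next
      case 2
      have "i \<in> {1..<n}" "i + 1 \<in> {1..<n}" using 2 by auto
      then show ?thesis using 2 model_braid[OF 2(1,2)] model_gen_closed
        by (simp add: M.m_assoc)
    qed
  qed
  show "Phi \<in> hom B (braid_model n)"
    unfolding Phi_def B_def braid_group_def
    by (rule presented_lift_hom[OF group_braid_model model_gen_closed rels])
  assume i: "i \<in> {1..<n}"
  from presented_lift_class[OF group_braid_model model_gen_closed rels gen_word[OF i]]
  show "Phi (sig i) = model_gen i" using model_gen_closed[OF i] by (simp add: Phi_def sig_def)
qed

lemma Phi_eq: "Phi x = (perm x, link x, twist x)"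
  by (simp add: perm_def link_def twist_def)

lemma Phi_closed:
  assumes "x \<in> carrier B"
  shows "perm x permutes {1..n}" "link x \<in> pair_alg n" "twist x \<in> triple_alg n"
  using hom_in_carrier[OF Phi_hom assms] by (auto simp: Phi_eq braid_model_def)

lemma Phi_mult:
  assumes "x \<in> carrier B" "y \<in> carrier B"
  shows "perm (x \<otimes> y) = perm x \<circ> perm y"
    "link (x \<otimes> y) = (\<lambda>a b. link x (perm y a) (perm y b) + link y a b)"
    "twist (x \<otimes> y) = (\<lambda>a b c. twist x (perm y a) (perm y b) (perm y c) + twist y a b c +
      3 * bracket (\<lambda>a b. link x (perm y a) (perm y b)) (link y) a b c)"
  using hom_mult[OF Phi_hom assms] by (simp_all add: Phi_eq model_mult)

lemma Phi_one: "perm \<one> = id" "link \<one> = (\<lambda>a b. 0)" "twist \<one> = (\<lambda>a b c. 0)"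
proof -
  have "group_hom B (braid_model n) Phi"
    using Phi_hom group_braid_model is_group by (simp add: group_hom_def group_hom_axioms_def)
  from group_hom.hom_one[OF this] show "perm \<one> = id" "link \<one> = (\<lambda>a b. 0)" "twist \<one> = (\<lambda>a b c. 0)"
    by (simp_all add: Phi_eq braid_model_def)
qed

lemma Phi_gen:
  assumes "i \<in> {1..<n}"
  shows "perm (sig i) = transpose i (Suc i)" "link (sig i) = model_cross i"
  using Phi_sig[OF assms] by (simp_all add: Phi_eq model_gen_def)

lemma perm_inv:
  assumes "x \<in> carrier B"
  shows "perm (inv x) (perm x a) = a" "perm x (perm (inv x) a) = a"
  using Phi_mult(1)[of "inv x" x] Phi_mult(1)[of x "inv x"] assms Phi_one(1)
  by (simp_all add: fun_eq_iff)

lemma perm_inv_sig: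
  assumes "i \<in> {1..<n}" shows "perm (inv (sig i)) = transpose i (Suc i)"
proof
  fix a
  show "perm (inv (sig i)) a = transpose i (Suc i) a"
    using perm_inv(1)[OF sig_closed[OF assms], of "transpose i (Suc i) a"]
    by (simp add: Phi_gen[OF assms])
qed

lemma braid_perm_eq: "x \<in> carrier B \<Longrightarrow> braid_perm n x = perm x"
proof (induction rule: braid_induct)
  interpret S: group "sym_group n" by (rule sym_group_is_group)
  have hom: "group_hom B (sym_group n) (braid_perm n)"
    using braid_perm_hom B_def is_group sym_group_is_group by (simp add: group_hom_def group_hom_axioms_def)
  then interpret h: group_hom B "sym_group n" "braid_perm n" .
  case one
  show ?case using h.hom_one by (simp add: Phi_one sym_group_one)
  fix i x assume i: "i \<in> {1..<n}" and x: "x \<in> carrier B" and eq: "braid_perm n x = perm x"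
  have gi: "braid_perm n (sig i) = transpose i (Suc i)"
    using braid_perm_generator[OF i] by (simp add: sig_def)
  show "braid_perm n (sig i \<otimes> x) = perm (sig i \<otimes> x)"
    using h.hom_mult[OF sig_closed[OF i] x] gi eq
    by (simp add: Phi_mult(1)[OF sig_closed[OF i] x] Phi_gen[OF i] sym_group_mult)
  have "transpose i (Suc i) \<in> carrier (sym_group n)"
    using i by (auto simp: sym_group_carrier intro!: permutes_swap_id)
  then have "inv\<^bsub>sym_group n\<^esub> (transpose i (Suc i)) = transpose i (Suc i)"
    by (intro S.inv_equality) (auto simp: sym_group_mult sym_group_one)
  then have "braid_perm n (inv (sig i)) = transpose i (Suc i)"
    using h.hom_inv[OF sig_closed[OF i]] gi by simp
  then show "braid_perm n (inv (sig i) \<otimes> x) = perm (inv (sig i) \<otimes> x)"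
    using h.hom_mult[OF inv_closed[OF sig_closed[OF i]] x] eq
    by (simp add: Phi_mult(1)[OF inv_closed[OF sig_closed[OF i]] x] perm_inv_sig[OF i] sym_group_mult)
qed

definition P :: "nat word set set" where "P = {x \<in> carrier B. perm x = id}"

lemma pure_braids_eq: "pure_braids n = P"
  using braid_perm_eq by (auto simp: pure_braids_def kernel_def P_def sym_group_one B_def[symmetric])

lemma P_normal: "P \<lhd> B"
  using pure_braids_normal[of n] by (simp only: pure_braids_eq B_def[symmetric])

lemma P_subgroup: "subgroup P B"
  using P_normal by (rule normal_imp_subgroup)

lemma P_carrier: "x \<in> P \<Longrightarrow> x \<in> carrier B" and P_perm: "x \<in> P \<Longrightarrow> perm x = id"
  by (auto simp: P_def)

text \<open>The descending product sigma_m ... sigma_j, empty for j > m. It carries strand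
  \<open>j\<close> to position m + 1.\<close>

primrec desc :: "nat \<Rightarrow> nat \<Rightarrow> nat word set" where
  "desc j 0 = \<one>"
| "desc j (Suc m) = (if j > Suc m then \<one> else sig (Suc m) \<otimes> desc j m)"

lemma desc_closed: "m < n \<Longrightarrow> desc j m \<in> carrier B"
  by (induction m) (auto intro!: sig_closed)

lemma desc_empty: "j > m \<Longrightarrow> desc j m = \<one>"
  by (cases m) auto

lemma desc_comm_low:
  "m < n \<Longrightarrow> i \<in> {1..<n} \<Longrightarrow> i + 2 \<le> j \<Longrightarrow> desc j m \<otimes> sig i = sig i \<otimes> desc j m"
proof (induction m)
  case (Suc m)
  have c: "sig (Suc m) \<in> carrier B" "sig i \<in> carrier B" "desc j m \<in> carrier B"
    using Suc.prems by (auto intro!: sig_closed desc_closed)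
  show ?case
  proof (cases "j > Suc m")
    case False
    have "sig (Suc m) \<otimes> sig i = sig i \<otimes> sig (Suc m)"
      using Suc.prems False by (intro sig_far) auto
    then show ?thesis using False Suc c by simp (metis m_assoc)
  qed (use c in simp)
qed (auto simp: sig_closed)

lemma desc_comm_high:
  "i \<in> {1..<n} \<Longrightarrow> m + 2 \<le> i \<Longrightarrow> desc j m \<otimes> sig i = sig i \<otimes> desc j m"
proof (induction m)
  case (Suc m)
  have c: "sig (Suc m) \<in> carrier B" "sig i \<in> carrier B" "desc j m \<in> carrier B"
    using Suc.prems by (auto intro!: sig_closed desc_closed)
  have "sig (Suc m) \<otimes> sig i = sig i \<otimes> sig (Suc m)"
    using Suc.prems by (intro sig_far) auto
  then show ?case using Suc c by simp (metis m_assoc)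
qed (auto simp: sig_closed)

lemma desc_extend:
  "m < n \<Longrightarrow> 1 \<le> j \<Longrightarrow> j \<le> m \<Longrightarrow> desc (Suc j) m \<otimes> sig j = desc j m"
proof (induction m)
  case (Suc m)
  have c: "sig (Suc m) \<in> carrier B" "sig j \<in> carrier B" "desc (Suc j) m \<in> carrier B"
    using Suc.prems by (auto intro!: sig_closed desc_closed)
  show ?case
  proof (cases "j = Suc m")
    case True
    then show ?thesis using c by (simp add: desc_empty)
  next
    case False
    then show ?thesis using Suc c by (simp add: m_assoc)
  qed
qed simp

text \<open>sigma_{k+1} commutes past sigma_{k-1} ... sigma_j; then sigma_{k+1} sigma_k sigma_{k+1}
  becomes sigma_k sigma_{k+1} sigma_k, whose first factor commutes with sigma_m ...
  sigma_{k+2}.\<close>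

lemma desc_shift:
  "m < n \<Longrightarrow> 1 \<le> j \<Longrightarrow> j \<le> k \<Longrightarrow> Suc k \<le> m \<Longrightarrow> desc j m \<otimes> sig (Suc k) = sig k \<otimes> desc j m"
proof (induction m)
  case (Suc m)
  have c: "sig (Suc m) \<in> carrier B" "sig k \<in> carrier B" "sig (Suc k) \<in> carrier B" "desc j m \<in> carrier B"
    using Suc.prems by (auto intro!: sig_closed desc_closed)
  show ?case
  proof (cases "k = m")
    case False
    have "sig (Suc m) \<otimes> sig k = sig k \<otimes> sig (Suc m)"
      using Suc.prems False by (intro sig_far) auto
    moreover have "desc j m \<otimes> sig (Suc k) = sig k \<otimes> desc j m" using Suc False by auto
    ultimately show ?thesis using Suc.prems c by simp (metis m_assoc)
  next
    case True
    obtain m' where m: "m = Suc m'" using True Suc.prems by (cases m) auto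
    have c': "desc j m' \<in> carrier B" using Suc.prems m by (intro desc_closed) auto
    have h: "desc j m' \<otimes> sig (Suc m) = sig (Suc m) \<otimes> desc j m'"
      using Suc.prems m by (intro desc_comm_high) auto
    have b: "sig m \<otimes> sig (Suc m) \<otimes> sig m = sig (Suc m) \<otimes> sig m \<otimes> sig (Suc m)"
      using Suc.prems m by (intro sig_braid) auto
    have "desc j (Suc m) \<otimes> sig (Suc k) = sig (Suc m) \<otimes> (sig m \<otimes> (desc j m' \<otimes> sig (Suc m)))"
      using Suc.prems True m c c' by (simp add: m_assoc)
    also have "\<dots> = sig (Suc m) \<otimes> sig m \<otimes> sig (Suc m) \<otimes> desc j m'"
      unfolding h using c c' True by (simp add: m_assoc)
    also have "\<dots> = sig m \<otimes> (sig (Suc m) \<otimes> (sig m \<otimes> desc j m'))"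
      unfolding b[symmetric] using c c' True by (simp add: m_assoc)
    also have "\<dots> = sig k \<otimes> desc j (Suc m)" using Suc.prems True m by simp
    finally show ?thesis .
  qed
qed simp

lemma perm_desc: "m < n \<Longrightarrow> 1 \<le> j \<Longrightarrow> j \<le> Suc m \<Longrightarrow> perm (desc j m) j = Suc m"
proof (induction m)
  case (Suc m)
  have c: "Suc m \<in> {1..<n}" "desc j m \<in> carrier B"
    using Suc.prems by (auto intro!: desc_closed)
  show ?case
    using Suc c by (cases "j = Suc (Suc m)")
      (auto simp: Phi_one Phi_mult(1)[OF sig_closed[OF c(1)] c(2)] Phi_gen[OF c(1)])
qed (auto simp: Phi_one)

text \<open>Modulo the squares of the generators, every braid on \<open>m + 1\<close> strands is a braid on \<open>m\<close> strands
  times one of the \<open>m + 1\<close> coset representatives \<open>desc j m\<close>. A pure braid has trivial representative.\<close>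

lemma pure_subset_normal:
  assumes N: "N \<lhd> B" "N \<subseteq> P" and sq: "\<And>i. i \<in> {1..<n} \<Longrightarrow> sig i \<otimes> sig i \<in> N"
  shows "P \<subseteq> N"
proof -
  have sN: "subgroup N B" using N by (simp add: normal_imp_subgroup)
  have NB: "x \<in> carrier B" if "x \<in> N" for x using that N P_carrier by auto
  have conj: "x \<otimes> h \<otimes> inv x \<in> N" if "x \<in> carrier B" "h \<in> N" for x h
    using N(1) that by (rule normal.inv_op_closed2)
  let ?T = "\<lambda>m. generate B (N \<union> sig ` {1..<m})"
  have S: "N \<union> sig ` {1..<m} \<subseteq> carrier B" if "m \<le> n" for m
    using that NB by (auto intro!: sig_closed)
  have T: "subgroup (?T m) B" if "m \<le> n" for m
    using S[OF that] by (rule generate_is_subgroup)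
  have step: "?T (Suc m) \<subseteq> {h \<otimes> desc j m | h j. h \<in> ?T m \<and> j \<in> {1..Suc m}}" (is "_ \<subseteq> ?X")
    if m: "1 \<le> m" "m < n" for m
  proof (rule generate_subset_right_closed)
    have TB: "h \<in> carrier B" if "h \<in> ?T m" for h
      using subgroup.mem_carrier[OF T that] m by auto
    note Tm = subgroup.m_closed[OF T[OF less_imp_le[OF m(2)]]]
    have d: "desc j m \<in> carrier B" for j using m by (simp add: desc_closed)
    show "N \<union> sig ` {1..<Suc m} \<subseteq> carrier B" using S m by auto
    show "?X \<subseteq> carrier B" using TB d by auto
    have "\<one> = \<one> \<otimes> desc (Suc m) m" by (simp add: desc_empty)
    moreover have "\<one> \<in> ?T m" using subgroup.one_closed[OF T] m by auto
    moreover have "Suc m \<in> {1..Suc m}" by simp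
    ultimately show "\<one> \<in> ?X" by blast
    have Nin: "x \<otimes> s \<in> ?X" if x: "x \<in> ?X" and s: "s \<in> N" for x s
    proof -
      obtain h j where x: "x = h \<otimes> desc j m" "h \<in> ?T m" "j \<in> {1..Suc m}" using x by blast
      have "desc j m \<otimes> s \<otimes> inv (desc j m) \<in> ?T m" using conj[OF d s] by (auto intro: generate.incl)
      then have "h \<otimes> (desc j m \<otimes> s \<otimes> inv (desc j m)) \<in> ?T m" using x Tm by blast
      moreover have "x \<otimes> s = h \<otimes> (desc j m \<otimes> s \<otimes> inv (desc j m)) \<otimes> desc j m"
        using x TB d NB[OF s] by (simp add: m_assoc)
      ultimately show ?thesis using x by blast
    qed
    have sin: "x \<otimes> sig i \<in> ?X" if x: "x \<in> ?X" and i: "i \<in> {1..<Suc m}" for x i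
    proof -
      obtain h j where x: "x = h \<otimes> desc j m" "h \<in> ?T m" "j \<in> {1..Suc m}" using x by blast
      have iB: "i \<in> {1..<n}" using i m by auto
      note c = sig_closed[OF iB] d TB[OF x(2)]
      have sT: "sig k \<in> ?T m" if "1 \<le> k" "k < m" for k using that by (auto intro: generate.incl)
      \<comment> \<open>In order: sigma_i commutes with the representative, lengthens it, meets its
        last factor, or passes through it with index lowered by one.\<close>
      consider (1) "i + 2 \<le> j" | (2) "j = Suc i" | (3) "j = i" | (4) k where "i = Suc k" "j \<le> k"
      proof (cases "i \<le> j")
        case True
        then have "i + 2 \<le> j \<or> j = Suc i \<or> j = i" by linarith
        then show ?thesis using 1 2 3 by blast
      next
        case False
        then show ?thesis using 4[of "i - 1"] by simp
      qed
      then show ?thesis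
      proof cases
        case 1
        have "x \<otimes> sig i = h \<otimes> sig i \<otimes> desc j m"
          using x(1) c desc_comm_low[OF m(2) iB 1] by (simp add: m_assoc)
        moreover have "h \<otimes> sig i \<in> ?T m" using Tm[OF x(2) sT[of i]] 1 i x(3) by auto
        ultimately show ?thesis using x(3) by blast
      next
        case 2
        have "x \<otimes> sig i = h \<otimes> desc i m"
          using x(1) c desc_extend[OF m(2), of i] 2 i by (simp add: m_assoc)
        moreover have "i \<in> {1..Suc m}" using i by auto
        ultimately show ?thesis using x(2) by blast
      next
        case 3
        \<comment> \<open>The last factor and sigma_i form a square, which \<open>N\<close>
          absorbs.\<close>
        have "desc j m = desc (Suc j) m \<otimes> sig i" using desc_extend[OF m(2), of i] 3 i by auto
        then have "x \<otimes> sig i = h \<otimes> desc (Suc j) m \<otimes> (sig i \<otimes> sig i)"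
          using x(1) c by (simp add: m_assoc)
        moreover have "Suc j \<in> {1..Suc m}" using 3 i by auto
        then have "h \<otimes> desc (Suc j) m \<in> ?X" using x(2) by blast
        ultimately show ?thesis using Nin sq[OF iB] by simp
      next
        case 4
        have k: "1 \<le> k" "k < m" using 4 i x(3) by auto
        have "x \<otimes> sig i = h \<otimes> sig k \<otimes> desc j m"
          using x(1) c desc_shift[OF m(2), of j k] 4 i x(3) sig_closed[of k] k m by (simp add: m_assoc)
        moreover have "h \<otimes> sig k \<in> ?T m" using Tm[OF x(2) sT[OF k]] .
        ultimately show ?thesis using x(3) by blast
      qed
    qed
    fix x s assume x: "x \<in> ?X" and s: "s \<in> N \<union> sig ` {1..<Suc m}"
    show "x \<otimes> s \<in> ?X" using s Nin[OF x] sin[OF x] by blast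
    show "x \<otimes> inv s \<in> ?X"
    proof (cases "s \<in> N")
      case True
      then show ?thesis using Nin[OF x] subgroup.m_inv_closed[OF sN] by blast
    next
      case False
      then obtain i where i: "i \<in> {1..<Suc m}" "s = sig i" using s by auto
      have iB: "i \<in> {1..<n}" using i m by auto
      \<comment> \<open>sigma_i^-1 = sigma_i (sigma_i sigma_i)^-1 reduces inverses to the cases
        already treated.\<close>
      have "inv (sig i \<otimes> sig i) \<in> N" using sq[OF iB] subgroup.m_inv_closed[OF sN] by blast
      then have "x \<otimes> sig i \<otimes> inv (sig i \<otimes> sig i) \<in> ?X" using Nin sin[OF x i(1)] by blast
      moreover have "x \<in> carrier B" using x TB d by auto
      moreover have "sig i \<otimes> inv (sig i \<otimes> sig i) = inv (sig i)"
        using sig_closed[OF iB] by (simp add: inv_mult_group m_assoc[symmetric])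
      ultimately show ?thesis using sig_closed[OF iB] i(2) by (simp add: m_assoc)
    qed
  qed
  \<comment> \<open>Elements over the first \<open>m\<close> strands fix all later positions. For a
    pure h desc j m this forces j = m + 1, hence an empty representative.\<close>
  have fix': "perm h a = a" if h: "h \<in> ?T m" and "m \<le> n" "a > m" for h m a
    using h
  proof (induction rule: generate.induct)
    case one show ?case by (simp add: Phi_one)
  next
    case (incl h)
    then show ?case using N(2) P_perm that(3) \<open>m \<le> n\<close> by (auto simp: Phi_gen transpose_def)
  next
    case (inv h)
    have "perm h a = a" using inv N(2) P_perm that(3) \<open>m \<le> n\<close> by (auto simp: Phi_gen transpose_def)
    moreover have "h \<in> carrier B" using inv S[OF \<open>m \<le> n\<close>] by auto
    ultimately show ?case using perm_inv(1) by metis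
  next
    case (eng h1 h2)
    then show ?case using subgroup.mem_carrier[OF T] \<open>m \<le> n\<close> by (simp add: Phi_mult)
  qed
  have "x \<in> N" if "m \<le> n" "x \<in> ?T m" "perm x = id" for m x
    using that
  proof (induction m arbitrary: x)
    case 0
    then show ?case using generate_subgroup_incl[OF subset_refl sN] by auto
  next
    case (Suc m)
    show ?case
    proof (cases "m = 0")
      case True
      then show ?thesis using Suc generate_subgroup_incl[OF subset_refl sN] by auto
    next
      case False
      then obtain h j where x: "x = h \<otimes> desc j m" "h \<in> ?T m" "j \<in> {1..Suc m}"
        using step[of m] Suc.prems by auto
      have hB: "h \<in> carrier B" using subgroup.mem_carrier[OF T x(2)] Suc.prems by auto
      have d: "desc j m \<in> carrier B" using Suc.prems by (simp add: desc_closed)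
      have "perm x j = perm h (Suc m)"
        using x Suc.prems perm_desc[of m j] by (simp add: Phi_mult(1)[OF hB d])
      also have "\<dots> = Suc m" using fix'[OF x(2)] Suc.prems by simp
      finally have "j = Suc m" using Suc.prems by simp
      then have "x = h" using x hB by (simp add: desc_empty)
      then show ?thesis using Suc x by auto
    qed
  qed
  moreover have "x \<in> ?T n" if "x \<in> carrier B" for x
    using that
  proof (induction rule: braid_induct)
    case one show ?case by (rule generate.one)
  next
    case (sig i x)
    then show ?case by (auto intro!: generate.eng intro: generate.incl)
  next
    case (inv i x)
    then show ?case by (intro generate.eng generate.inv) auto
  qed
  ultimately show ?thesis by (auto simp: P_def)
qed

end

section \<open>The conjugation action on pairs of strands\<close>

text \<open>For v > x this is Artin's generator: the square of s_x conjugated by s_{v-1} ...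
  s_{x+1}. Smaller \<open>v\<close> only carry the recursion down to 0. The group is a parameter
  because the same word is read in \<open>B\<close> and in its quotient by
  \<open>G2\<close>.\<close>

primrec arc :: "('a, 'b) monoid_scheme \<Rightarrow> (nat \<Rightarrow> 'a) \<Rightarrow> nat \<Rightarrow> nat \<Rightarrow> 'a" where
  "arc G s x 0 = \<one>\<^bsub>G\<^esub>"
| "arc G s x (Suc v) =
    (if v = x then s x \<otimes>\<^bsub>G\<^esub> s x else s v \<otimes>\<^bsub>G\<^esub> arc G s x v \<otimes>\<^bsub>G\<^esub> inv\<^bsub>G\<^esub> (s v))"

definition edge :: "('a, 'b) monoid_scheme \<Rightarrow> (nat \<Rightarrow> 'a) \<Rightarrow> nat \<Rightarrow> nat \<Rightarrow> 'a" where
  "edge G s x y = (if x < y then arc G s x y else arc G s y x)"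

lemma edge_commute: "x \<noteq> y \<Longrightarrow> edge G s x y = edge G s y x"
  by (auto simp: edge_def)

text \<open>An action of the Coxeter group \<open>S\<^sub>n\<close> in which \<open>q i\<close> has the stabilizer of \<open>{i, i + 1}\<close> in its
  stabilizer: the orbit of \<open>q 1\<close> is labelled by the pairs \<open>{x, y}\<close>.\<close>

lemma coxeter_pair_action:
  fixes \<alpha> :: "nat \<Rightarrow> 'a \<Rightarrow> 'a" and a :: "nat \<Rightarrow> nat \<Rightarrow> 'a"
  assumes closed: "\<And>k z. k \<in> {1..<n} \<Longrightarrow> z \<in> X \<Longrightarrow> \<alpha> k z \<in> X"
    and q: "\<And>i. i \<in> {1..<n} \<Longrightarrow> q i \<in> X"
    and invol: "\<And>k z. k \<in> {1..<n} \<Longrightarrow> z \<in> X \<Longrightarrow> \<alpha> k (\<alpha> k z) = z"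
    and far: "\<And>i j z. i \<in> {1..<n} \<Longrightarrow> j \<in> {1..<n} \<Longrightarrow> i + 2 \<le> j \<or> j + 2 \<le> i \<Longrightarrow> z \<in> X \<Longrightarrow> \<alpha> i (\<alpha> j z) = \<alpha> j (\<alpha> i z)"
    and braid: "\<And>i z. 1 \<le> i \<Longrightarrow> i + 2 \<le> n \<Longrightarrow> z \<in> X \<Longrightarrow> \<alpha> i (\<alpha> (Suc i) (\<alpha> i z)) = \<alpha> (Suc i) (\<alpha> i (\<alpha> (Suc i) z))"
    and qfix: "\<And>i. i \<in> {1..<n} \<Longrightarrow> \<alpha> i (q i) = q i"
    and qfar: "\<And>i j. i \<in> {1..<n} \<Longrightarrow> j \<in> {1..<n} \<Longrightarrow> i + 2 \<le> j \<or> j + 2 \<le> i \<Longrightarrow> \<alpha> i (q j) = q j"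
    and qstep: "\<And>i. 1 \<le> i \<Longrightarrow> i + 2 \<le> n \<Longrightarrow> \<alpha> i (\<alpha> (Suc i) (q i)) = q (Suc i)"
    and base: "\<And>x. a x (Suc x) = q x"
    and step: "\<And>x v. x < v \<Longrightarrow> a x (Suc v) = \<alpha> v (a x v)"
    and E: "\<And>x y. E x y = (if x < y then a x y else a y x)"
  shows "1 \<le> x \<Longrightarrow> x < v \<Longrightarrow> v \<le> n \<Longrightarrow> a x v \<in> X"
    and "1 \<le> x \<Longrightarrow> x < v \<Longrightarrow> v \<le> n \<Longrightarrow> k \<in> {1..<n} \<Longrightarrow>
      \<alpha> k (a x v) = E (transpose k (Suc k) x) (transpose k (Suc k) v)"
proof -
  have aX: "a x v \<in> X" if "1 \<le> x" "x < v" "v \<le> n" for x v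
    using that
  proof (induction v)
    case (Suc v)
    then show ?case
      by (cases "v = x") (auto simp: base step intro!: q closed)
  qed simp
  then show "1 \<le> x \<Longrightarrow> x < v \<Longrightarrow> v \<le> n \<Longrightarrow> a x v \<in> X" .
  show "\<alpha> k (a x v) = E (transpose k (Suc k) x) (transpose k (Suc k) v)"
    if "1 \<le> x" "x < v" "v \<le> n" "k \<in> {1..<n}"
    using that
  proof (induction v arbitrary: x k rule: less_induct)
    case (less v)
    then obtain u where v: "v = Suc u" and u: "x \<le> u" by (cases v) auto
    note k = less.prems(4)
    show ?case
    proof (cases "u = x")
      case True
      have x: "x \<in> {1..<n}" using less.prems v True by auto
      consider (1) "k = x" | (2) "k = Suc x" | (3) "Suc k = x" | (4) "x + 2 \<le> k \<or> k + 2 \<le> x" by linarith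
      then show ?thesis
      proof cases
        case 1
        then show ?thesis using v True x by (simp add: E base qfix)
      next
        case 2
        then show ?thesis using v True x by (simp add: E base step)
      next
        case 3
        \<comment> \<open>Here k + 1 = x: applying \<alpha> k to both sides of \<open>qstep\<close>
          and cancelling the involution expresses the image of \<open>q x\<close>.\<close>
        have "\<alpha> k (\<alpha> k (\<alpha> x (q k))) = \<alpha> k (q x)" using qstep[of k] k x 3 by auto
        moreover have "\<alpha> k (\<alpha> k (\<alpha> x (q k))) = \<alpha> x (q k)" using k x by (intro invol closed q)
        moreover have "a k v = \<alpha> x (q k)" using v True 3 step[of k x] base[of k] by simp
        ultimately show ?thesis using v True 3 by (auto simp: E base)
      next
        case 4
        then have "transpose k (Suc k) x = x" "transpose k (Suc k) v = v" using v True by (auto simp: transpose_def)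
        then show ?thesis using v True x k 4 qfar[of k x] by (auto simp: E base)
      qed
    next
      case False
      then have xu: "x < u" using u by simp
      have av: "a x v = \<alpha> u (a x u)" using v xu step by simp
      have uI: "u \<in> {1..<n}" using less.prems v xu by auto
      have auX: "a x u \<in> X" using aX less.prems v xu by auto
      consider (1) "v < k" | (2) "k = v" | (3) "k = u" | (4) "Suc k = u" | (5) "Suc k < u" using v by linarith
      then show ?thesis
      proof cases
        case 1
        have "\<alpha> k (a x u) = a x u"
          using less.IH[of u x k] less.prems v xu 1 by (simp add: E)
        moreover have "\<alpha> k (\<alpha> u (a x u)) = \<alpha> u (\<alpha> k (a x u))" using 1 v by (intro far k uI auX) auto
        moreover have "transpose k (Suc k) x = x" "transpose k (Suc k) v = v" using 1 less.prems(2) by (auto simp: transpose_def)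
        ultimately show ?thesis using av less.prems(2) by (simp add: E)
      next
        case 2
        then show ?thesis using less.prems(2) v step[of x v] by (simp add: E)
      next
        case 3
        have "transpose k (Suc k) x = x" "transpose k (Suc k) v = u" using 3 v xu by (auto simp: transpose_def)
        then show ?thesis using av 3 invol[OF uI auX] xu by (simp add: E)
      next
        case 4
        have tv: "transpose k (Suc k) v = v" using 4 v by (auto simp: transpose_def)
        show ?thesis
        proof (cases "k = x")
          case True
          have "\<alpha> x (\<alpha> (Suc x) (q x)) = q (Suc x)" using qstep[of x] less.prems v xu by auto
          moreover have "a x u = q x" "a x v = \<alpha> (Suc x) (q x)" using base[of x] av True 4 by auto
          moreover have "E u v = q u" using v base[of u] by (simp add: E)
          ultimately show ?thesis using True 4 v tv by simp
        next
          case False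
          then have xk: "x < k" using xu 4 by simp
          have akX: "a x k \<in> X" using aX less.prems xk by auto
          have au: "a x u = \<alpha> k (a x k)" using step[OF xk] 4 by simp
          \<comment> \<open>With u = k + 1, both strands of \<open>a x k\<close> lie below
            \<open>u\<close>, so \<alpha> u fixes it and drops out on the right of the braid
            relation.\<close>
          have "\<alpha> u (a x k) = a x k"
            using less.IH[of k x u] less.prems v xk xu 4 uI by (auto simp: E)
          moreover have "\<alpha> k (\<alpha> u (\<alpha> k (a x k))) = \<alpha> u (\<alpha> k (\<alpha> u (a x k)))"
            using braid[of k "a x k"] akX 4 k uI by auto
          moreover have "transpose k (Suc k) x = x" using xk by (auto simp: transpose_def)
          ultimately show ?thesis using av au tv less.prems(2) by (simp add: E)
        qed
      next
        case 5
        let ?y = "transpose k (Suc k) x"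
        have y: "?y < u" using 5 xu by (auto simp: transpose_def)
        have tu: "transpose k (Suc k) u = u" "transpose k (Suc k) v = v" using 5 v by (auto simp: transpose_def)
        have "\<alpha> k (a x u) = a ?y u"
          using less.IH[of u x k] less.prems v xu y by (simp add: E tu)
        moreover have "\<alpha> k (\<alpha> u (a x u)) = \<alpha> u (\<alpha> k (a x u))" using 5 by (intro far k uI auX) auto
        moreover have "E ?y v = \<alpha> u (a ?y u)" using step[OF y] v y by (simp add: E)
        ultimately show ?thesis using av tu by simp
      qed
    qed
  qed
qed

lemma (in group) conj_mult:
  assumes "g \<in> carrier G" "h \<in> carrier G" "z \<in> carrier G"
  shows "g \<otimes> (h \<otimes> z \<otimes> inv h) \<otimes> inv g = (g \<otimes> h) \<otimes> z \<otimes> inv (g \<otimes> h)"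
  using assms by (simp add: inv_mult_group m_assoc)

lemma (in group) conj_commuting:
  assumes "g \<in> carrier G" "z \<in> carrier G" "g \<otimes> z = z \<otimes> g"
  shows "g \<otimes> z \<otimes> inv g = z"
  using assms by (simp add: m_assoc)

text \<open>Conjugating twice by \<open>s k\<close> is conjugation by an element of the commutative
  set \<open>X\<close>, hence trivial on \<open>X\<close>. So the braid relations give an action of
  the Coxeter group on \<open>X\<close>.\<close>

lemma (in group) edge_conj:
  assumes s: "\<And>k. k \<in> {1..<n} \<Longrightarrow> s k \<in> carrier G"
    and far: "\<And>i j. i \<in> {1..<n} \<Longrightarrow> j \<in> {1..<n} \<Longrightarrow> i + 2 \<le> j \<or> j + 2 \<le> i \<Longrightarrow> s i \<otimes> s j = s j \<otimes> s i"
    and braid: "\<And>i. 1 \<le> i \<Longrightarrow> i + 2 \<le> n \<Longrightarrow> s i \<otimes> s (Suc i) \<otimes> s i = s (Suc i) \<otimes> s i \<otimes> s (Suc i)"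
    and X: "X \<subseteq> carrier G"
    and conj: "\<And>k z. k \<in> {1..<n} \<Longrightarrow> z \<in> X \<Longrightarrow> s k \<otimes> z \<otimes> inv (s k) \<in> X"
    and sq: "\<And>k. k \<in> {1..<n} \<Longrightarrow> s k \<otimes> s k \<in> X"
    and comm: "\<And>z z'. z \<in> X \<Longrightarrow> z' \<in> X \<Longrightarrow> z \<otimes> z' = z' \<otimes> z"
    and xy: "x \<in> {1..n}" "y \<in> {1..n}" "x \<noteq> y"
  shows "edge G s x y \<in> X"
    and "k \<in> {1..<n} \<Longrightarrow>
      s k \<otimes> edge G s x y \<otimes> inv (s k) = edge G s (transpose k (Suc k) x) (transpose k (Suc k) y)"
proof -
  define \<alpha> where "\<alpha> k z = s k \<otimes> z \<otimes> inv (s k)" for k z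
  define q where "q i = s i \<otimes> s i" for i
  have XG: "z \<in> carrier G" if "z \<in> X" for z using that X by auto
  have sS: "s i \<in> carrier G" "s (Suc i) \<in> carrier G" if "1 \<le> i" "i + 2 \<le> n" for i
    using that by (auto intro!: s)
  have far': "\<alpha> i (\<alpha> j z) = \<alpha> j (\<alpha> i z)"
    if "i \<in> {1..<n}" "j \<in> {1..<n}" "i + 2 \<le> j \<or> j + 2 \<le> i" "z \<in> X" for i j z
    using far[OF that(1-3)] unfolding \<alpha>_def
    by (simp only: conj_mult[OF s[OF that(1)] s[OF that(2)] XG[OF that(4)]]
        conj_mult[OF s[OF that(2)] s[OF that(1)] XG[OF that(4)]])
  have inv': "\<alpha> k (\<alpha> k z) = z" if "k \<in> {1..<n}" "z \<in> X" for k z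
    using conj_commuting[OF XG XG comm, OF sq[OF that(1)] that(2) sq[OF that(1)] that(2)]
    unfolding \<alpha>_def by (simp only: conj_mult[OF s[OF that(1)] s[OF that(1)] XG[OF that(2)]])
  have braid': "\<alpha> i (\<alpha> (Suc i) (\<alpha> i z)) = \<alpha> (Suc i) (\<alpha> i (\<alpha> (Suc i) z))"
    if "1 \<le> i" "i + 2 \<le> n" "z \<in> X" for i z
  proof -
    note c = sS[OF that(1,2)] XG[OF that(3)]
    have "s i \<otimes> (s (Suc i) \<otimes> s i) = s (Suc i) \<otimes> (s i \<otimes> s (Suc i))"
      using c braid[OF that(1,2)] by (simp add: m_assoc)
    then show ?thesis using c by (simp only: \<alpha>_def conj_mult m_closed)
  qed
  have qfix: "\<alpha> i (q i) = q i" if "i \<in> {1..<n}" for i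
    using s[OF that] by (simp add: \<alpha>_def q_def m_assoc)
  have qfar: "\<alpha> i (q j) = q j" if "i \<in> {1..<n}" "j \<in> {1..<n}" "i + 2 \<le> j \<or> j + 2 \<le> i" for i j
    unfolding \<alpha>_def q_def using s[OF that(1)] s[OF that(2)] far[OF that]
    by (intro conj_commuting) (auto, metis m_assoc)
  \<comment> \<open>Two braid moves give (s_i s_{i+1}) s_i^2 = s_{i+1}^2 (s_i s_{i+1}).\<close>
  have qstep: "\<alpha> i (\<alpha> (Suc i) (q i)) = q (Suc i)" if i: "1 \<le> i" "i + 2 \<le> n" for i
  proof -
    note c = sS[OF i]
    let ?g = "s i \<otimes> s (Suc i)"
    have "?g \<otimes> (s i \<otimes> s i) = s i \<otimes> s (Suc i) \<otimes> s i \<otimes> s i"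
      using c by (simp add: m_assoc)
    also have "\<dots> = s (Suc i) \<otimes> (s i \<otimes> s (Suc i) \<otimes> s i)"
      by (subst braid[OF i]) (use c in \<open>simp add: m_assoc\<close>)
    also have "\<dots> = s (Suc i) \<otimes> s (Suc i) \<otimes> ?g"
      by (subst braid[OF i]) (use c in \<open>simp add: m_assoc\<close>)
    finally have "?g \<otimes> (s i \<otimes> s i) \<otimes> inv ?g = s (Suc i) \<otimes> s (Suc i)"
      using c by (simp add: inv_solve_right')
    then show ?thesis using c by (simp add: \<alpha>_def q_def conj_mult)
  qed
  have closed: "\<alpha> k z \<in> X" if "k \<in> {1..<n}" "z \<in> X" for k z
    unfolding \<alpha>_def by (rule conj[OF that])
  have qX: "q i \<in> X" if "i \<in> {1..<n}" for i
    unfolding q_def by (rule sq[OF that])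
  have base: "arc G s x (Suc x) = q x" for x by (simp add: q_def)
  have step: "arc G s x (Suc v) = \<alpha> v (arc G s x v)" if "x < v" for x v using that by (simp add: \<alpha>_def)
  note * = coxeter_pair_action[of n X \<alpha> q "arc G s" "edge G s", OF closed qX inv' far' braid' qfix qfar qstep base step edge_def]
  show "edge G s x y \<in> X"
    using *(1)[of x y] *(1)[of y x] xy by (auto simp: edge_def)
  show "s k \<otimes> edge G s x y \<otimes> inv (s k) = edge G s (transpose k (Suc k) x) (transpose k (Suc k) y)"
    if k: "k \<in> {1..<n}"
  proof -
    have "transpose k (Suc k) y \<noteq> transpose k (Suc k) x" using xy by (auto simp: transpose_def)
    then show ?thesis
      using *(2)[of x y k] *(2)[of y x k] xy k edge_commute[of "transpose k (Suc k) y" "transpose k (Suc k) x" G s]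
      by (cases x y rule: linorder_cases) (auto simp: edge_def[of G s x y] \<alpha>_def)
  qed
qed

text \<open>Used to move the first three or four strands to any prescribed distinct ones, so that a
  relation has to be verified for the first strands only.\<close>

lemma permutes_extension:
  assumes "finite S" "T \<subseteq> S" "inj_on f T" "f ` T \<subseteq> S"
  obtains h where "h permutes S" "\<And>x. x \<in> T \<Longrightarrow> h x = f x"
proof -
  have "card (S - T) = card (S - f ` T)"
    using assms by (simp add: card_Diff_subset finite_subset card_image)
  then obtain b where b: "bij_betw b (S - T) (S - f ` T)"
    using assms finite_same_card_bij[of "S - T" "S - f ` T"] by auto
  define h where "h x = (if x \<in> T then f x else if x \<in> S then b x else x)" for x
  have "bij_betw h T (f ` T)" using assms by (auto simp: h_def bij_betw_def inj_on_def)
  moreover have "bij_betw h (S - T) (S - f ` T)" using b by (rule bij_betw_cong[THEN iffD1, rotated]) (auto simp: h_def)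
  ultimately have "bij_betw h (T \<union> (S - T)) (f ` T \<union> (S - f ` T))" by (rule bij_betw_combine) auto
  moreover have "T \<union> (S - T) = S" "f ` T \<union> (S - f ` T) = S" using assms by auto
  ultimately have "h permutes S" using assms(2) by (intro bij_imp_permutes) (auto simp: h_def)
  then show ?thesis by (rule that) (simp add: h_def)
qed

context braid
begin

definition G2 :: "nat word set set" where "G2 = lower_central (pure_braid_group n) 2"
definition G3 :: "nat word set set" where "G3 = lower_central (pure_braid_group n) 3"

lemma pure_braid_group_eq: "pure_braid_group n = B\<lparr>carrier := P\<rparr>"
  by (simp only: pure_braid_group_def pure_braids_eq B_def[symmetric])

lemma G2_eq: "G2 = commutator_subgroup B P P"
  using lower_central_Suc[OF P_normal, of 0] by (simp add: G2_def pure_braid_group_eq numeral_2_eq_2)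

lemma G3_eq: "G3 = commutator_subgroup B G2 P"
  using lower_central_Suc[OF P_normal, of 1] by (simp add: G2_def G3_def pure_braid_group_eq numeral_2_eq_2 numeral_3_eq_3)

lemma G_normal: "G2 \<lhd> B" "G3 \<lhd> B" and G2_P: "G2 \<subseteq> P"
  using lower_central_normal[OF P_normal] by (simp_all add: G2_def G3_def pure_braid_group_eq)

lemma G_subgroup: "subgroup G2 B" "subgroup G3 B"
  using G_normal by (auto intro: normal_imp_subgroup)

lemma comm_G2: "a \<in> P \<Longrightarrow> b \<in> P \<Longrightarrow> a \<otimes> b \<otimes> inv a \<otimes> inv b \<in> G2"
  unfolding G2_eq commutator_subgroup_def by (rule generate.incl) blast

lemma comm_G3: "a \<in> G2 \<Longrightarrow> b \<in> P \<Longrightarrow> a \<otimes> b \<otimes> inv a \<otimes> inv b \<in> G3"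
  unfolding G3_eq commutator_subgroup_def by (rule generate.incl) blast

lemma G2_least:
  assumes "subgroup K B" "\<And>a b. a \<in> P \<Longrightarrow> b \<in> P \<Longrightarrow> a \<otimes> b \<otimes> inv a \<otimes> inv b \<in> K"
  shows "G2 \<subseteq> K"
  unfolding G2_eq commutator_subgroup_def using assms by (intro generate_subgroup_incl) auto

lemma G3_least:
  assumes "subgroup K B" "\<And>a b. a \<in> G2 \<Longrightarrow> b \<in> P \<Longrightarrow> a \<otimes> b \<otimes> inv a \<otimes> inv b \<in> K"
  shows "G3 \<subseteq> K"
  unfolding G3_eq commutator_subgroup_def using assms by (intro generate_subgroup_incl) auto

lemma G3_G2: "G3 \<subseteq> G2"
  using G3_least[OF G_subgroup(1)] comm_G2 G2_P by blast

lemma comm_G3': "a \<in> P \<Longrightarrow> b \<in> G2 \<Longrightarrow> a \<otimes> b \<otimes> inv a \<otimes> inv b \<in> G3"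
  using commuting_mod_sym[OF G_subgroup(2) _ _ comm_G3[of b a]] G2_P P_carrier by blast

lemma P_conj: "g \<in> carrier B \<Longrightarrow> p \<in> P \<Longrightarrow> g \<otimes> p \<otimes> inv g \<in> P"
  by (rule normal.inv_op_closed2[OF P_normal])

lemma sig_sq_P: "i \<in> {1..<n} \<Longrightarrow> sig i \<otimes> sig i \<in> P"
  using sig_closed by (simp add: P_def Phi_mult Phi_gen)

lemma perm_surj:
  assumes "h permutes {1..n}" shows "\<exists>g\<in>carrier B. perm g = h"
proof -
  have swap: "\<exists>g\<in>carrier B. perm g = transpose a b" if "1 \<le> a" "a < b" "b \<le> n" for a b
    using that
  proof (induction b)
    case (Suc b)
    have b: "b \<in> {1..<n}" using Suc.prems by auto
    show ?case
    proof (cases "a = b")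
      case True
      then show ?thesis using b sig_closed Phi_gen(1) by blast
    next
      case False
      then obtain g where g: "g \<in> carrier B" "perm g = transpose a b" using Suc by auto
      have "perm (sig b \<otimes> (g \<otimes> sig b)) = transpose b (Suc b) \<circ> (transpose a b \<circ> transpose b (Suc b))"
        using g sig_closed[OF b] by (simp add: Phi_mult(1) Phi_gen[OF b])
      also have "\<dots> = transpose a (Suc b)" using False Suc.prems by (auto simp: fun_eq_iff transpose_def)
      finally show ?thesis using g sig_closed[OF b] by blast
    qed
  qed simp
  have swap': "\<exists>g\<in>carrier B. perm g = transpose a b" if "a \<in> {1..n}" "b \<in> {1..n}" "a \<noteq> b" for a b
    using swap[of a b] swap[of b a] that by (cases a b rule: linorder_cases) (auto simp: transpose_commute)
  from assms finite_atLeastAtMost show ?thesis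
  proof (induction rule: permutes_induct)
    case id
    show ?case using Phi_one(1) by blast
  next
    case (swap a b p)
    then obtain g h where "g \<in> carrier B" "perm g = p" "h \<in> carrier B" "perm h = transpose a b"
      using swap' by blast
    then have "perm (h \<otimes> g) = transpose a b \<circ> p" "h \<otimes> g \<in> carrier B" by (simp_all add: Phi_mult)
    then show ?case by blast
  qed
qed

abbreviation A :: "nat \<Rightarrow> nat \<Rightarrow> nat word set" where "A \<equiv> edge B sig"

lemma arc_P: "1 \<le> x \<Longrightarrow> x < v \<Longrightarrow> v \<le> n \<Longrightarrow> arc B sig x v \<in> P"
proof (induction v)
  case (Suc v)
  then show ?case by (cases "v = x") (auto intro!: sig_sq_P P_conj sig_closed)
qed simp

lemma A_P: "x \<in> {1..n} \<Longrightarrow> y \<in> {1..n} \<Longrightarrow> x \<noteq> y \<Longrightarrow> A x y \<in> P"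
  using arc_P[of x y] arc_P[of y x] by (auto simp: edge_def)

text \<open>In \<open>B\<close> itself a conjugate of an Artin generator is in general not one of
  the \<open>A x y\<close>. Modulo \<open>G2\<close> pure braids commute, so
  \<open>edge_conj\<close> applies there; \<gamma> is the discrepancy after lifting back.\<close>

lemma A_conj:
  assumes xy: "x \<in> {1..n}" "y \<in> {1..n}" "x \<noteq> y" and g: "g \<in> carrier B"
  obtains \<gamma> where "\<gamma> \<in> G2" "g \<otimes> A x y \<otimes> inv g = \<gamma> \<otimes> A (perm g x) (perm g y)"
proof -
  define Q where "Q = B Mod G2"
  define q where "q = (\<lambda>x. G2 #> x)"
  interpret N: normal G2 B by (rule G_normal(1))
  interpret Q: group Q unfolding Q_def by (rule N.factorgroup_is_group)
  have "q \<in> hom B Q" unfolding q_def Q_def by (rule N.r_coset_hom_Mod)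
  then interpret q: group_hom B Q q
    using is_group Q.is_group by (simp add: group_hom_def group_hom_axioms_def)
  have q_eq: "a \<otimes> inv b \<in> G2" if "q a = q b" "a \<in> carrier B" "b \<in> carrier B" for a b
    using N.rcos_module_imp[OF is_group that(3)] repr_independenceD[OF G_subgroup(1) that(2), of b] that
    by (simp add: q_def)
  have q_eqI: "q a = q b" if "a \<otimes> inv b \<in> G2" "a \<in> carrier B" "b \<in> carrier B" for a b
    using N.rcos_module_rev[OF is_group that(3,2,1)] repr_independence[OF _ that(3) G_subgroup(1)]
    by (simp add: q_def)
  have arc_q: "arc Q (q \<circ> sig) x v = q (arc B sig x v)" if "1 \<le> x" "x < v" "v \<le> n" for x v
    using that
  proof (induction v)
    case (Suc v)
    then have "sig v \<in> carrier B" by (intro sig_closed) auto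
    moreover have "arc B sig x v \<in> carrier B" if "v \<noteq> x"
      using arc_P[of x v] P_carrier Suc.prems that by auto
    ultimately show ?case using Suc by auto
  qed simp
  have edge_q: "edge Q (q \<circ> sig) x y = q (A x y)" if "x \<in> {1..n}" "y \<in> {1..n}" "x \<noteq> y" for x y
    using that arc_q[of x y] arc_q[of y x] by (auto simp: edge_def)
  have comm: "q a \<otimes>\<^bsub>Q\<^esub> q b = q b \<otimes>\<^bsub>Q\<^esub> q a" if "a \<in> P" "b \<in> P" for a b
  proof -
    have c: "a \<in> carrier B" "b \<in> carrier B" using that P_carrier by auto
    have "a \<otimes> b \<otimes> inv (b \<otimes> a) = a \<otimes> b \<otimes> inv a \<otimes> inv b" using c by (simp add: inv_mult_group m_assoc)
    then have "q (a \<otimes> b) = q (b \<otimes> a)" using comm_G2[OF that] c by (intro q_eqI) auto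
    then show ?thesis using c by simp
  qed
  have step: "q (sig k) \<otimes>\<^bsub>Q\<^esub> q (A x y) \<otimes>\<^bsub>Q\<^esub> inv\<^bsub>Q\<^esub> q (sig k) = q (A (transpose k (Suc k) x) (transpose k (Suc k) y))"
    if k: "k \<in> {1..<n}" and xy: "x \<in> {1..n}" "y \<in> {1..n}" "x \<noteq> y" for k x y
  proof -
    have "(q \<circ> sig) k \<otimes>\<^bsub>Q\<^esub> edge Q (q \<circ> sig) x y \<otimes>\<^bsub>Q\<^esub> inv\<^bsub>Q\<^esub> (q \<circ> sig) k =
        edge Q (q \<circ> sig) (transpose k (Suc k) x) (transpose k (Suc k) y)"
    proof (rule Q.edge_conj(2)[where X = "q ` P", OF _ _ _ _ _ _ _ xy k])
      show "(q \<circ> sig) k \<in> carrier Q" if "k \<in> {1..<n}" for k using sig_closed[OF that] by simp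
      show "(q \<circ> sig) i \<otimes>\<^bsub>Q\<^esub> (q \<circ> sig) j = (q \<circ> sig) j \<otimes>\<^bsub>Q\<^esub> (q \<circ> sig) i"
        if "i \<in> {1..<n}" "j \<in> {1..<n}" "i + 2 \<le> j \<or> j + 2 \<le> i" for i j
        using sig_far[OF that] sig_closed[OF that(1)] sig_closed[OF that(2)] by (simp flip: q.hom_mult)
      show "(q \<circ> sig) i \<otimes>\<^bsub>Q\<^esub> (q \<circ> sig) (Suc i) \<otimes>\<^bsub>Q\<^esub> (q \<circ> sig) i =
          (q \<circ> sig) (Suc i) \<otimes>\<^bsub>Q\<^esub> (q \<circ> sig) i \<otimes>\<^bsub>Q\<^esub> (q \<circ> sig) (Suc i)"
        if "1 \<le> i" "i + 2 \<le> n" for i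
        using sig_braid[OF that] sig_closed[of i] sig_closed[of "Suc i"] that by (simp flip: q.hom_mult)
      show "q ` P \<subseteq> carrier Q" using P_carrier by auto
      show "(q \<circ> sig) k \<otimes>\<^bsub>Q\<^esub> z \<otimes>\<^bsub>Q\<^esub> inv\<^bsub>Q\<^esub> (q \<circ> sig) k \<in> q ` P" if "k \<in> {1..<n}" "z \<in> q ` P" for k z
      proof -
        obtain p where p: "p \<in> P" "z = q p" using \<open>z \<in> q ` P\<close> by blast
        have "(q \<circ> sig) k \<otimes>\<^bsub>Q\<^esub> z \<otimes>\<^bsub>Q\<^esub> inv\<^bsub>Q\<^esub> (q \<circ> sig) k = q (sig k \<otimes> p \<otimes> inv (sig k))"
          using p P_carrier sig_closed[OF \<open>k \<in> {1..<n}\<close>] by simp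
        then show ?thesis using P_conj[OF sig_closed[OF \<open>k \<in> {1..<n}\<close>] p(1)] by blast
      qed
      show "(q \<circ> sig) k \<otimes>\<^bsub>Q\<^esub> (q \<circ> sig) k \<in> q ` P" if "k \<in> {1..<n}" for k
        using sig_sq_P[OF that] sig_closed[OF that] by (metis comp_apply imageI q.hom_mult)
      show "z \<otimes>\<^bsub>Q\<^esub> z' = z' \<otimes>\<^bsub>Q\<^esub> z" if "z \<in> q ` P" "z' \<in> q ` P" for z z'
        using comm that by blast
    qed
    moreover have "transpose k (Suc k) x \<in> {1..n}" "transpose k (Suc k) y \<in> {1..n}"
      "transpose k (Suc k) x \<noteq> transpose k (Suc k) y"
      using k xy by (auto simp: transpose_def)
    ultimately show ?thesis using edge_q xy by simp
  qed
  have main: "q (g \<otimes> A x y \<otimes> inv g) = q (A (perm g x) (perm g y))"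
    using g
  proof (induction g rule: braid_induct)
    case one
    then show ?case using A_P[OF xy] P_carrier by (simp add: Phi_one)
  next
    case (sig i g)
    let ?x = "perm g x" and ?y = "perm g y"
    have p: "?x \<in> {1..n}" "?y \<in> {1..n}" "?x \<noteq> ?y"
      using permutes_in_image[OF Phi_closed(1)[OF sig(2)]] permutes_inj[OF Phi_closed(1)[OF sig(2)]] xy
      by (blast, blast, auto dest: injD)
    note c = sig_closed[OF sig(1)] sig(2) P_carrier[OF A_P[OF xy]] P_carrier[OF A_P[OF p]]
    have "sig i \<otimes> g \<otimes> A x y \<otimes> inv (sig i \<otimes> g) = sig i \<otimes> (g \<otimes> A x y \<otimes> inv g) \<otimes> inv (sig i)"
      using c by (simp add: inv_mult_group m_assoc)
    then have "q (sig i \<otimes> g \<otimes> A x y \<otimes> inv (sig i \<otimes> g)) = q (sig i) \<otimes>\<^bsub>Q\<^esub> q (A ?x ?y) \<otimes>\<^bsub>Q\<^esub> inv\<^bsub>Q\<^esub> q (sig i)"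
      using c sig(3) by (simp del: q.hom_mult add: q.hom_mult[of "sig i \<otimes> (g \<otimes> A x y \<otimes> inv g)"] q.hom_mult[of "sig i"])
    then show ?case using step[OF sig(1) p] by (simp add: Phi_mult(1)[OF c(1,2)] Phi_gen[OF sig(1)])
  next
    case (inv i g)
    let ?x = "perm g x" and ?y = "perm g y"
    let ?t = "transpose i (Suc i)"
    have p: "?x \<in> {1..n}" "?y \<in> {1..n}" "?x \<noteq> ?y"
      using permutes_in_image[OF Phi_closed(1)[OF inv(2)]] permutes_inj[OF Phi_closed(1)[OF inv(2)]] xy
      by (blast, blast, auto dest: injD)
    have p': "?t ?x \<in> {1..n}" "?t ?y \<in> {1..n}" "?t ?x \<noteq> ?t ?y"
      using p inv(1) by (auto simp: transpose_def)
    note c = sig_closed[OF inv(1)] inv(2) P_carrier[OF A_P[OF xy]] P_carrier[OF A_P[OF p]] P_carrier[OF A_P[OF p']]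
    have "inv (sig i) \<otimes> g \<otimes> A x y \<otimes> inv (inv (sig i) \<otimes> g) = inv (sig i) \<otimes> (g \<otimes> A x y \<otimes> inv g) \<otimes> sig i"
      using c by (simp add: inv_mult_group m_assoc)
    then have "q (inv (sig i) \<otimes> g \<otimes> A x y \<otimes> inv (inv (sig i) \<otimes> g)) = inv\<^bsub>Q\<^esub> q (sig i) \<otimes>\<^bsub>Q\<^esub> q (A ?x ?y) \<otimes>\<^bsub>Q\<^esub> q (sig i)"
      using c inv(3) by (simp del: q.hom_mult add: q.hom_mult[of "inv (sig i) \<otimes> (g \<otimes> A x y \<otimes> inv g)"] q.hom_mult[of "inv (sig i)"])
    \<comment> \<open>The formula for the transposed pair, read backwards, handles an inverse
      generator.\<close>
    also have "q (A ?x ?y) = q (sig i) \<otimes>\<^bsub>Q\<^esub> q (A (?t ?x) (?t ?y)) \<otimes>\<^bsub>Q\<^esub> inv\<^bsub>Q\<^esub> q (sig i)"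
      using step[OF inv(1) p'] by simp
    also have "inv\<^bsub>Q\<^esub> q (sig i) \<otimes>\<^bsub>Q\<^esub> \<dots> \<otimes>\<^bsub>Q\<^esub> q (sig i) = q (A (?t ?x) (?t ?y))"
      using c by (simp add: Q.m_assoc del: q.hom_inv) (simp add: Q.m_assoc[symmetric] del: q.hom_inv)
    finally show ?case by (simp add: Phi_mult(1)[OF inv_closed[OF c(1)] c(2)] perm_inv_sig[OF inv(1)])
  qed
  let ?x = "perm g x" and ?y = "perm g y"
  have p: "?x \<in> {1..n}" "?y \<in> {1..n}" "?x \<noteq> ?y"
    using permutes_in_image[OF Phi_closed(1)[OF g]] permutes_inj[OF Phi_closed(1)[OF g]] xy
    by (blast, blast, auto dest: injD)
  have c: "A x y \<in> carrier B" "A ?x ?y \<in> carrier B" using A_P xy p P_carrier by auto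
  show ?thesis
  proof
    show "g \<otimes> A x y \<otimes> inv g \<otimes> inv (A ?x ?y) \<in> G2" using q_eq[OF main] c g by simp
    show "g \<otimes> A x y \<otimes> inv g = g \<otimes> A x y \<otimes> inv g \<otimes> inv (A ?x ?y) \<otimes> A ?x ?y"
      using c g by (simp add: m_assoc)
  qed
qed

end

section \<open>Kernel and image of the model on pure braids\<close>

context braid
begin

section \<open>The quotient of P by G2 and the link coordinates\<close>

definition pairs :: "(nat \<times> nat) set" where "pairs = {(x, y). 1 \<le> x \<and> x < y \<and> y \<le> n}"
definition triples :: "(nat \<times> nat \<times> nat) set" where
  "triples = {(x, y, z). 1 \<le> x \<and> x < y \<and> y < z \<and> z \<le> n}"

lemma finite_pairs: "finite pairs" and finite_triples: "finite triples"
proof -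
  have "pairs \<subseteq> {1..n} \<times> {1..n}" "triples \<subseteq> {1..n} \<times> {1..n} \<times> {1..n}"
    by (auto simp: pairs_def triples_def)
  then show "finite pairs" "finite triples" by (meson finite_SigmaI finite_atLeastAtMost finite_subset)+
qed

lemma pure_mult:
  assumes "x \<in> P" "y \<in> P"
  shows "link (x \<otimes> y) a b = link x a b + link y a b"
    "twist (x \<otimes> y) a b c = twist x a b c + twist y a b c + 3 * bracket (link x) (link y) a b c"
  using assms by (simp_all add: P_carrier P_perm Phi_mult)

lemma pure_inv:
  assumes "x \<in> P"
  shows "link (inv x) a b = - link x a b" "twist (inv x) a b c = - twist x a b c"
proof -
  have i: "inv x \<in> P" using assms subgroup.m_inv_closed[OF P_subgroup] by blast
  have e: "inv x \<otimes> x = \<one>" using P_carrier[OF assms] by simp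
  have l: "link (inv x) a b = - link x a b" for a b
    using pure_mult(1)[OF i assms, of a b] by (simp add: e Phi_one)
  then show "link (inv x) a b = - link x a b" .
  show "twist (inv x) a b c = - twist x a b c"
    using pure_mult(2)[OF i assms, of a b c] by (simp add: e Phi_one bracket_def l)
qed

text \<open>The two orders of multiplication contribute 3 and -3 times the same bracket, hence the
  factor 6.\<close>

lemma pure_commutator:
  assumes a: "a \<in> P" and b: "b \<in> P"
  shows "link (a \<otimes> b \<otimes> inv a \<otimes> inv b) x y = 0"
    "twist (a \<otimes> b \<otimes> inv a \<otimes> inv b) x y z = 6 * bracket (link a) (link b) x y z"
proof -
  note P = subgroup.m_closed[OF P_subgroup] subgroup.m_inv_closed[OF P_subgroup]
  show "link (a \<otimes> b \<otimes> inv a \<otimes> inv b) x y = 0"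
    using a b by (simp add: pure_mult pure_inv P)
  show "twist (a \<otimes> b \<otimes> inv a \<otimes> inv b) x y z = 6 * bracket (link a) (link b) x y z"
    using a b by (simp add: pure_mult pure_inv P bracket_def algebra_simps)
qed

lemma conj_link:
  assumes g: "g \<in> carrier B" and p: "p \<in> P"
  shows "link (g \<otimes> p \<otimes> inv g) (perm g a) (perm g b) = link p a b"
proof -
  let ?p = "g \<otimes> p \<otimes> inv g"
  have P: "?p \<in> P" using P_conj[OF g p] .
  \<comment> \<open>Comparing these two products avoids the coordinates of g^-1.\<close>
  have "?p \<otimes> g = g \<otimes> p" using g P_carrier[OF p] by (simp add: m_assoc)
  then have "link (?p \<otimes> g) a b = link (g \<otimes> p) a b" by simp
  then show ?thesis using g P_carrier[OF P] P_carrier[OF p] P_perm[OF p] by (simp add: Phi_mult(2))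
qed

lemma link_arc:
  "1 \<le> x \<Longrightarrow> x < v \<Longrightarrow> v \<le> n \<Longrightarrow> 
    link (arc B sig x v) a b = (if a = x \<and> b = v \<or> a = v \<and> b = x then 2 else 0)"
proof (induction v arbitrary: a b)
  case (Suc v)
  have v: "v \<in> {1..<n}" using Suc.prems by auto
  have s: "(transpose v (Suc v) a = v) = (a = Suc v)" "(transpose v (Suc v) a = Suc v) = (a = v)" for a
    by (auto simp: transpose_def)
  show ?case
  proof (cases "v = x")
    case True
    have "link (sig x \<otimes> sig x) a b = model_cross x (transpose x (Suc x) a) (transpose x (Suc x) b) + model_cross x a b"
      using v sig_closed[OF v] True by (simp add: Phi_mult Phi_gen)
    then show ?thesis using True by (auto simp: model_cross_def s[unfolded True])
  next
    case False
    then have xv: "x < v" using Suc.prems by simp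
    have "link (sig v \<otimes> arc B sig x v \<otimes> inv (sig v)) (perm (sig v) (transpose v (Suc v) a)) (perm (sig v) (transpose v (Suc v) b)) =
        link (arc B sig x v) (transpose v (Suc v) a) (transpose v (Suc v) b)"
      using arc_P[of x v] Suc.prems xv by (intro conj_link sig_closed[OF v]) auto
    moreover have "(transpose v (Suc v) a = x) = (a = x)" for a using xv by (auto simp: transpose_def)
    ultimately show ?thesis using False Suc.IH xv Suc.prems by (auto simp: Phi_gen[OF v] s)
  qed
qed simp

lemma link_A:
  assumes "x \<in> {1..n}" "y \<in> {1..n}" "x \<noteq> y"
  shows "link (A x y) a b = (if a = x \<and> b = y \<or> a = y \<and> b = x then 2 else 0)"
  using assms link_arc[of x y a b] link_arc[of y x a b] by (auto simp: edge_def)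

text \<open>Conjugation preserves the \<open>A x y\<close> only up to factors in \<open>G2\<close>,
  hence the enlarged set \<open>?S\<close>. What it generates is normal and contains the squares of
  the generators, so \<open>pure_subset_normal\<close> applies.\<close>

lemma pure_generated: "P \<subseteq> generate B (G2 \<union> (\<lambda>(x, y). A x y) ` pairs)"
proof -
  let ?S = "G2 \<union> {\<gamma> \<otimes> A x y | \<gamma> x y. \<gamma> \<in> G2 \<and> (x, y) \<in> pairs}"
  let ?D = "generate B (G2 \<union> (\<lambda>(x, y). A x y) ` pairs)"
  have pA: "A x y \<in> P" if "(x, y) \<in> pairs" for x y using that by (auto simp: pairs_def intro!: A_P)
  have SP: "?S \<subseteq> P"
    using G2_P pA subgroup.m_closed[OF P_subgroup] by blast
  have "P \<subseteq> generate B ?S"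
  proof (rule pure_subset_normal)
    show "generate B ?S \<subseteq> P" by (rule generate_subgroup_incl[OF SP P_subgroup])
    show "generate B ?S \<lhd> B"
    proof (rule normal_generateI)
      show "?S \<subseteq> carrier B" using SP P_carrier by blast
      fix h g assume h: "h \<in> ?S" and g: "g \<in> carrier B"
      note c2 = normal.inv_op_closed2[OF G_normal(1) g]
      consider "h \<in> G2" | \<gamma> x y where "\<gamma> \<in> G2" "(x, y) \<in> pairs" "h = \<gamma> \<otimes> A x y" using h by blast
      then show "g \<otimes> h \<otimes> inv g \<in> ?S"
      proof cases
        case 1
        then show ?thesis using c2 by blast
      next
        case 2
        have xy: "x \<in> {1..n}" "y \<in> {1..n}" "x \<noteq> y" using 2 by (auto simp: pairs_def)
        from A_conj[OF xy g] obtain \<gamma>' where g': "\<gamma>' \<in> G2"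
          "g \<otimes> A x y \<otimes> inv g = \<gamma>' \<otimes> A (perm g x) (perm g y)" .
        have p: "perm g x \<in> {1..n}" "perm g y \<in> {1..n}" "perm g x \<noteq> perm g y"
          using permutes_in_image[OF Phi_closed(1)[OF g]] permutes_inj[OF Phi_closed(1)[OF g]] xy
          by (blast, blast, auto dest: injD)
        have "\<exists>u v. (u, v) \<in> pairs \<and> A (perm g x) (perm g y) = A u v"
        proof (cases "perm g x < perm g y")
          case True
          then have "(perm g x, perm g y) \<in> pairs" using p by (auto simp: pairs_def)
          then show ?thesis by blast
        next
          case False
          then have "(perm g y, perm g x) \<in> pairs" using p by (auto simp: pairs_def)
          then show ?thesis using edge_commute[OF p(3)] by blast
        qed
        then obtain u v where uv: "(u, v) \<in> pairs" "A (perm g x) (perm g y) = A u v" by blast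
        have c: "\<gamma> \<in> carrier B" "\<gamma>' \<in> carrier B" "A x y \<in> carrier B" "A u v \<in> carrier B"
          using 2 g' pA uv G2_P P_carrier by auto
        have "g \<otimes> h \<otimes> inv g = (g \<otimes> \<gamma> \<otimes> inv g) \<otimes> (g \<otimes> A x y \<otimes> inv g)"
          using 2 c g by (simp add: m_assoc) (simp add: m_assoc[symmetric])
        also have "\<dots> = (g \<otimes> \<gamma> \<otimes> inv g \<otimes> \<gamma>') \<otimes> A u v"
          unfolding g'(2) uv(2) using c g by (simp add: m_assoc)
        finally show ?thesis using uv(1) subgroup.m_closed[OF G_subgroup(1) c2[OF 2(1)] g'(1)] by blast
      qed
    qed
    fix i assume i: "i \<in> {1..<n}"
    have "sig i \<otimes> sig i = \<one> \<otimes> A i (Suc i)" using sig_closed[OF i] by (simp add: edge_def)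
    moreover have "(i, Suc i) \<in> pairs" using i by (auto simp: pairs_def)
    moreover have "\<one> \<in> G2" using subgroup.one_closed[OF G_subgroup(1)] .
    ultimately have "sig i \<otimes> sig i \<in> ?S" by blast
    then show "sig i \<otimes> sig i \<in> generate B ?S" by (rule generate.incl)
  qed
  also have "generate B ?S \<subseteq> ?D"
  proof (rule generate_subgroup_incl)
    have "G2 \<union> (\<lambda>(x, y). A x y) ` pairs \<subseteq> carrier B" using G2_P pA P_carrier by auto
    then show "subgroup ?D B" by (rule generate_is_subgroup)
    show "?S \<subseteq> ?D" by (auto intro!: generate.eng intro: generate.incl)
  qed
  finally show ?thesis .
qed

lemma G2_link: "x \<in> G2 \<Longrightarrow> link x a b = 0"
proof -
  note Pc = subgroup.m_closed[OF P_subgroup] subgroup.m_inv_closed[OF P_subgroup] subgroup.one_closed[OF P_subgroup]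
  have "subgroup {x \<in> P. \<forall>a b. link x a b = 0} B"
    by (rule subgroupI) (use Pc P_carrier in \<open>auto simp: pure_mult pure_inv Phi_one\<close>)
  then have "G2 \<subseteq> {x \<in> P. \<forall>a b. link x a b = 0}"
    by (rule G2_least) (auto simp: pure_commutator Pc)
  then show "x \<in> G2 \<Longrightarrow> link x a b = 0" by blast
qed

lemma pure_link_even: assumes "x \<in> P" shows "2 dvd link x a b"
proof -
  note Pc = subgroup.m_closed[OF P_subgroup] subgroup.m_inv_closed[OF P_subgroup] subgroup.one_closed[OF P_subgroup]
  have "subgroup {x \<in> P. \<forall>a b. 2 dvd link x a b} B"
    by (rule subgroupI) (use Pc P_carrier in \<open>auto simp: pure_mult pure_inv Phi_one\<close>)
  moreover have "G2 \<union> (\<lambda>(x, y). A x y) ` pairs \<subseteq> {x \<in> P. \<forall>a b. 2 dvd link x a b}"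
  proof -
    have "A x y \<in> P \<and> (\<forall>a b. 2 dvd link (A x y) a b)" if "(x, y) \<in> pairs" for x y
    proof -
      have "x \<in> {1..n}" "y \<in> {1..n}" "x \<noteq> y" using that by (auto simp: pairs_def)
      then show ?thesis by (simp add: A_P link_A)
    qed
    then show ?thesis using G2_P G2_link by auto
  qed
  ultimately have "generate B (G2 \<union> (\<lambda>(x, y). A x y) ` pairs) \<subseteq> {x \<in> P. \<forall>a b. 2 dvd link x a b}"
    by (intro generate_subgroup_incl)
  then show ?thesis using pure_generated assms by blast
qed

lemma pair_alg_eqI:
  assumes "V \<in> pair_alg n" "W \<in> pair_alg n" "\<And>x y. (x, y) \<in> pairs \<Longrightarrow> V x y = W x y"
  shows "V = W"
proof (intro ext)
  fix x y
  note D = pair_algD[OF assms(1)] pair_algD[OF assms(2)]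
  consider "x \<notin> {1..n} \<or> y \<notin> {1..n}" | "x = y" | "(x, y) \<in> pairs" | "(y, x) \<in> pairs"
    by (cases x y rule: linorder_cases) (auto simp: pairs_def)
  then show "V x y = W x y"
  proof cases
    case 1 then show ?thesis using D(3,4,7,8) by metis
  next
    case 4 then show ?thesis using assms(3)[OF 4] D(1,5) by metis
  qed (use assms(3) D in auto)
qed

text \<open>Uncurried to fit the coordinate lemmas \<open>dual_zero\<close> and
  \<open>dual_surj\<close>, with index set \<open>pairs\<close> and d = 2.\<close>

lemma pair_dual:
  shows "\<And>i. i \<in> pairs \<Longrightarrow> (\<lambda>(x, y). A x y) i \<in> P"
    and "\<And>i a b. a \<in> P \<Longrightarrow> b \<in> P \<Longrightarrow> (\<lambda>(x, y) p. link p x y) i (a \<otimes> b) =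
      (\<lambda>(x, y) p. link p x y) i a + (\<lambda>(x, y) p. link p x y) i b"
    and "\<And>i j. i \<in> pairs \<Longrightarrow> j \<in> pairs \<Longrightarrow>
      (\<lambda>(x, y) p. link p x y) i ((\<lambda>(x, y). A x y) j) = (if i = j then 2 else 0)"
proof -
  show "(\<lambda>(x, y). A x y) i \<in> P" if "i \<in> pairs" for i
    using that by (auto simp: pairs_def intro!: A_P)
  show "(\<lambda>(x, y) p. link p x y) i (a \<otimes> b) =
      (\<lambda>(x, y) p. link p x y) i a + (\<lambda>(x, y) p. link p x y) i b" if "a \<in> P" "b \<in> P" for i a b
    using that by (auto simp: pure_mult split: prod.splits)
  show "(\<lambda>(x, y) p. link p x y) i ((\<lambda>(x, y). A x y) j) = (if i = j then 2 else 0)"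
    if "i \<in> pairs" "j \<in> pairs" for i j
  proof -
    obtain x y u v where ij: "i = (x, y)" "j = (u, v)" by fastforce
    have "u \<in> {1..n}" "v \<in> {1..n}" "u \<noteq> v" using that ij by (auto simp: pairs_def)
    then show ?thesis using that ij by (auto simp: link_A pairs_def)
  qed
qed

lemma pure_link_zero:
  assumes x: "x \<in> P" and zero: "\<And>a b. link x a b = 0"
  shows "x \<in> G2"
proof (rule dual_zero[OF P_subgroup G_subgroup(1) G2_P comm_G2 finite_pairs pair_dual])
  show "x \<in> generate B (G2 \<union> (\<lambda>(x, y). A x y) ` pairs)" using x pure_generated by blast
qed (auto simp: zero G2_link)

lemma pure_link_surj:
  assumes V: "V \<in> pair_alg n" and even: "\<And>x y. 2 dvd V x y"
  obtains p where "p \<in> P" "link p = V"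
proof -
  from dual_surj[OF P_subgroup G_subgroup(1) G2_P comm_G2 finite_pairs pair_dual, of "\<lambda>(x, y). V x y div 2"]
  obtain p where p: "p \<in> P" "\<And>x y. (x, y) \<in> pairs \<Longrightarrow> link p x y = 2 * (V x y div 2)" by fastforce
  have "link p = V" by (rule pair_alg_eqI[OF Phi_closed(2)[OF P_carrier[OF p(1)]] V]) (use p even in simp)
  with p that show ?thesis by blast
qed

text \<open>Conjugation carries the relation over exactly, but the conjugates are known only up to
  factors in \<open>G2\<close>. As \<open>G2\<close> is central in \<open>P\<close> modulo
  \<open>G3\<close>, these factors do not affect the commutator.\<close>

lemma commuting_transport:
  assumes g: "g \<in> carrier B" and ab: "a \<in> P" "b \<in> P" "a \<otimes> b = b \<otimes> a"
    and a': "a' \<in> P" "\<gamma> \<in> G2" "g \<otimes> a \<otimes> inv g = \<gamma> \<otimes> a'"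
    and b': "b' \<in> P" "\<delta> \<in> G2" "g \<otimes> b \<otimes> inv g = \<delta> \<otimes> b'"
  shows "a' \<otimes> b' \<otimes> inv a' \<otimes> inv b' \<in> G3"
proof -
  let ?a = "g \<otimes> a \<otimes> inv g" and ?b = "g \<otimes> b \<otimes> inv g"
  have P: "?a \<in> P" "?b \<in> P" using P_conj g ab by auto
  have c: "a \<in> carrier B" "b \<in> carrier B" "a' \<in> carrier B" "b' \<in> carrier B" "\<gamma> \<in> carrier B" "\<delta> \<in> carrier B"
    using assms G2_P P_carrier by auto
  have conj2: "g \<otimes> u \<otimes> inv g \<otimes> (g \<otimes> v \<otimes> inv g) = g \<otimes> (u \<otimes> v) \<otimes> inv g" if "u \<in> carrier B" "v \<in> carrier B" for u v
    using that g by (simp add: m_assoc) (simp add: m_assoc[symmetric])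
  have eq: "?a \<otimes> ?b = ?b \<otimes> ?a" by (simp only: conj2 c ab(3))
  have one: "u \<otimes> v \<otimes> inv u \<otimes> inv v \<in> G3" if "u \<in> P" "v \<in> P" "u \<otimes> v = v \<otimes> u" for u v
  proof -
    have "u \<otimes> v \<otimes> inv u \<otimes> inv v = \<one>" using that P_carrier by (simp add: m_assoc)
    then show ?thesis using subgroup.one_closed[OF G_subgroup(2)] by simp
  qed
  \<comment> \<open>The conjugates and \<open>G2\<close> commute pairwise modulo \<open>G3\<close>,
    and together they generate \<gamma>^-1 g a g^-1 = a' and likewise b'.\<close>
  let ?S = "G2 \<union> {?a, ?b}"
  show ?thesis
  proof (rule generate_commuting_mod[OF P_subgroup G_subgroup(2), of ?S])
    show "G3 \<subseteq> P" using G3_G2 G2_P by blast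
    show "p \<otimes> h \<otimes> inv p \<in> G3" if "p \<in> P" "h \<in> G3" for p h
      using normal.inv_op_closed2[OF G_normal(2)] P_carrier that by blast
    show "?S \<subseteq> P" using G2_P P by blast
    show "u \<otimes> v \<otimes> inv u \<otimes> inv v \<in> G3" if uv: "u \<in> ?S" "v \<in> ?S" for u v
    proof -
      have "u \<in> P" "v \<in> P" using uv P G2_P by auto
      then show ?thesis
        using uv comm_G3[of u v] comm_G3'[of u v] one[of u v] eq by auto
    qed
    have e: "a' = inv \<gamma> \<otimes> ?a" "b' = inv \<delta> \<otimes> ?b"
      using c unfolding a'(3) b'(3) by (simp_all add: m_assoc[symmetric])
    have "inv \<gamma> \<in> ?S" "inv \<delta> \<in> ?S" using a' b' subgroup.m_inv_closed[OF G_subgroup(1)] by auto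
    moreover have "?a \<in> ?S" "?b \<in> ?S" by auto
    ultimately have "inv \<gamma> \<otimes> ?a \<in> generate B ?S" "inv \<delta> \<otimes> ?b \<in> generate B ?S"
      using generate.incl generate.eng by metis+
    then show "a' \<in> generate B ?S" "b' \<in> generate B ?S" using e by simp_all
  qed
qed

lemma A_disjoint:
  assumes xy: "x \<in> {1..n}" "y \<in> {1..n}" and uv: "u \<in> {1..n}" "v \<in> {1..n}"
    and ne: "x \<noteq> y" "u \<noteq> v" "x \<noteq> u" "x \<noteq> v" "y \<noteq> u" "y \<noteq> v"
  shows "A x y \<otimes> A u v \<otimes> inv (A x y) \<otimes> inv (A u v) \<in> G3"
proof -
  have "card {x, y, u, v} \<le> card {1..n}" using xy uv by (intro card_mono) auto
  then have n: "4 \<le> n" using ne by simp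
  let ?f = "\<lambda>i::nat. if i = 1 then x else if i = 2 then y else if i = 3 then u else v"
  have "inj_on ?f {1, 2, 3, 4}" "{1, 2, 3, 4} \<subseteq> {1..n}" "?f ` {1, 2, 3, 4} \<subseteq> {1..n}"
    using ne n xy uv by (auto simp: inj_on_def)
  from permutes_extension[OF finite_atLeastAtMost this(2,1,3)]
  obtain h where h: "h permutes {1..n}" "\<And>i. i \<in> {1, 2, 3, 4} \<Longrightarrow> h i = ?f i" by blast
  obtain g where g: "g \<in> carrier B" "perm g = h" using perm_surj[OF h(1)] by blast
  have i: "1 \<in> {1..<n}" "3 \<in> {1..<n}" and i': "1 \<in> {1..n}" "2 \<in> {1..n}" "3 \<in> {1..n}" "4 \<in> {1..n}" using n by auto
  have A: "A 1 2 = sig 1 \<otimes> sig 1" "A 3 4 = sig 3 \<otimes> sig 3" by (simp_all add: edge_def eval_nat_numeral)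
  have s: "sig 1 \<in> carrier B" "sig 3 \<in> carrier B" using i sig_closed by auto
  have f: "sig 1 \<otimes> sig 3 = sig 3 \<otimes> sig 1" using i by (intro sig_far) auto
  have f': "sig 1 \<otimes> (sig 3 \<otimes> z) = sig 3 \<otimes> (sig 1 \<otimes> z)" if "z \<in> carrier B" for z
    using f s that by (simp flip: m_assoc)
  have comm: "A 1 2 \<otimes> A 3 4 = A 3 4 \<otimes> A 1 2" unfolding A using s f by (simp add: m_assoc f' del: One_nat_def)
  from A_conj[OF i'(1,2) _ g(1)] obtain \<gamma> where 1: "\<gamma> \<in> G2" "g \<otimes> A 1 2 \<otimes> inv g = \<gamma> \<otimes> A x y"
    using g h by auto
  from A_conj[OF i'(3,4) _ g(1)] obtain \<delta> where 2: "\<delta> \<in> G2" "g \<otimes> A 3 4 \<otimes> inv g = \<delta> \<otimes> A u v"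
    using g h by auto
  show ?thesis
    by (rule commuting_transport[OF g(1) _ _ comm _ 1 _ 2]) (use i' xy uv ne in \<open>auto intro: A_P\<close>)
qed

text \<open>The full twist \<open>A 1 2 A 1 3 A 2 3\<close> is central in the braid group on three strands.\<close>

lemma A_triangle:
  assumes xyz: "x \<in> {1..n}" "y \<in> {1..n}" "z \<in> {1..n}" and ne: "x \<noteq> y" "y \<noteq> z" "x \<noteq> z"
  shows "A x y \<otimes> (A x z \<otimes> A y z) \<otimes> inv (A x y) \<otimes> inv (A x z \<otimes> A y z) \<in> G3"
proof -
  have "card {x, y, z} \<le> card {1..n}" using xyz by (intro card_mono) auto
  then have n: "3 \<le> n" using ne by simp
  let ?f = "\<lambda>i::nat. if i = 1 then x else if i = 2 then y else z"
  have "inj_on ?f {1, 2, 3}" "{1, 2, 3} \<subseteq> {1..n}" "?f ` {1, 2, 3} \<subseteq> {1..n}"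
    using ne n xyz by (auto simp: inj_on_def)
  from permutes_extension[OF finite_atLeastAtMost this(2,1,3)]
  obtain h where h: "h permutes {1..n}" "\<And>i. i \<in> {1, 2, 3} \<Longrightarrow> h i = ?f i" by blast
  obtain g where g: "g \<in> carrier B" "perm g = h" using perm_surj[OF h(1)] by blast
  have i: "1 \<in> {1..<n}" "2 \<in> {1..<n}" and i': "1 \<in> {1..n}" "2 \<in> {1..n}" "3 \<in> {1..n}" using n by auto
  let ?s = "sig 1" and ?t = "sig 2"
  have s: "?s \<in> carrier B" "?t \<in> carrier B" using i sig_closed by auto
  have A: "A 1 2 = ?s \<otimes> ?s" "A 2 3 = ?t \<otimes> ?t" "A 1 3 = ?t \<otimes> (?s \<otimes> ?s) \<otimes> inv ?t"
    by (simp_all add: edge_def eval_nat_numeral)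
  have b: "?s \<otimes> ?t \<otimes> ?s = ?t \<otimes> ?s \<otimes> ?t" using sig_braid[of 1] n by (simp add: eval_nat_numeral)
  have A': "A 1 3 \<otimes> A 2 3 = ?t \<otimes> ?s \<otimes> (?s \<otimes> ?t)"
    unfolding A using s by (simp add: m_assoc) (simp add: m_assoc[symmetric])
  have "?s \<otimes> (?t \<otimes> ?s \<otimes> (?s \<otimes> ?t)) = (?s \<otimes> ?t \<otimes> ?s) \<otimes> (?s \<otimes> ?t)" using s by (simp add: m_assoc)
  also have "\<dots> = ?t \<otimes> ?s \<otimes> (?t \<otimes> ?s \<otimes> ?t)" by (subst b) (use s in \<open>simp add: m_assoc\<close>)
  also have "\<dots> = ?t \<otimes> ?s \<otimes> (?s \<otimes> ?t \<otimes> ?s)" by (simp only: b)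
  also have "\<dots> = (?t \<otimes> ?s \<otimes> (?s \<otimes> ?t)) \<otimes> ?s" using s by (simp add: m_assoc)
  finally have c: "?s \<otimes> (A 1 3 \<otimes> A 2 3) = (A 1 3 \<otimes> A 2 3) \<otimes> ?s" unfolding A' .
  have AB: "A 1 3 \<otimes> A 2 3 \<in> P" "A 1 2 \<in> P" "A 1 3 \<in> P" "A 2 3 \<in> P"
    using i' by (auto intro!: A_P subgroup.m_closed[OF P_subgroup])
  have comm: "A 1 2 \<otimes> (A 1 3 \<otimes> A 2 3) = (A 1 3 \<otimes> A 2 3) \<otimes> A 1 2"
    unfolding A(1) using s P_carrier[OF AB(1)] c by (metis m_assoc)
  from A_conj[OF i'(1,2) _ g(1)] obtain \<gamma> where 1: "\<gamma> \<in> G2" "g \<otimes> A 1 2 \<otimes> inv g = \<gamma> \<otimes> A x y"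
    using g h by auto
  from A_conj[OF i'(1,3) _ g(1)] obtain \<delta> where 2: "\<delta> \<in> G2" "g \<otimes> A 1 3 \<otimes> inv g = \<delta> \<otimes> A x z"
    using g h by auto
  from A_conj[OF i'(2,3) _ g(1)] obtain \<epsilon> where 3: "\<epsilon> \<in> G2" "g \<otimes> A 2 3 \<otimes> inv g = \<epsilon> \<otimes> A y z"
    using g h by auto
  have Axyz: "A x y \<in> P" "A x z \<in> P" "A y z \<in> P" using xyz ne by (auto intro: A_P)
  note C = P_carrier[OF Axyz(2)] P_carrier[OF Axyz(3)] P_carrier[OF AB(3)] P_carrier[OF AB(4)]
    P_carrier[OF subsetD[OF G2_P 2(1)]] P_carrier[OF subsetD[OF G2_P 3(1)]]
  have "g \<otimes> (A 1 3 \<otimes> A 2 3) \<otimes> inv g = (g \<otimes> A 1 3 \<otimes> inv g) \<otimes> (g \<otimes> A 2 3 \<otimes> inv g)"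
    using C g(1) by (simp add: m_assoc) (simp add: m_assoc[symmetric])
  \<comment> \<open>Collects both \<open>G2\<close> factors on the left, as
    \<open>commuting_transport\<close> requires.\<close>
  also have "\<dots> = \<delta> \<otimes> (A x z \<otimes> \<epsilon> \<otimes> inv (A x z)) \<otimes> (A x z \<otimes> A y z)"
    unfolding 2(2) 3(2) using C by (simp add: m_assoc) (simp add: m_assoc[symmetric])
  finally have 4: "g \<otimes> (A 1 3 \<otimes> A 2 3) \<otimes> inv g = \<delta> \<otimes> (A x z \<otimes> \<epsilon> \<otimes> inv (A x z)) \<otimes> (A x z \<otimes> A y z)" .
  have 5: "\<delta> \<otimes> (A x z \<otimes> \<epsilon> \<otimes> inv (A x z)) \<in> G2"
    using subgroup.m_closed[OF G_subgroup(1) 2(1)] normal.inv_op_closed2[OF G_normal(1) C(1) 3(1)] by blast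
  show ?thesis
    by (rule commuting_transport[OF g(1) AB(2,1) comm Axyz(1) 1 subgroup.m_closed[OF P_subgroup Axyz(2,3)] 5 4])
qed

section \<open>The quotient of G2 by G3 and the twist coordinates\<close>

definition omega :: "nat \<times> nat \<times> nat \<Rightarrow> nat word set" where
  "omega = (\<lambda>(x, y, z). A x y \<otimes> A y z \<otimes> inv (A x y) \<otimes> inv (A y z))"

lemma omega_G2: "i \<in> triples \<Longrightarrow> omega i \<in> G2"
  by (auto simp: omega_def triples_def intro!: comm_G2 A_P)

text \<open>It is enough that the \<open>A x y\<close> commute modulo \<open>?H\<close>. Disjoint
  pairs do; within a triple, \<open>omega\<close> makes two of the three generators commute, and the
  full twist then forces the other two commutations.\<close>

lemma G2_generated: "G2 \<subseteq> generate B (G3 \<union> omega ` triples)"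
proof -
  let ?H = "generate B (G3 \<union> omega ` triples)"
  have S: "G3 \<union> omega ` triples \<subseteq> G2" using G3_G2 omega_G2 by auto
  have HG2: "?H \<subseteq> G2" by (rule generate_subgroup_incl[OF S G_subgroup(1)])
  have H: "subgroup ?H B" using S G2_P P_carrier by (intro generate_is_subgroup) blast
  have HP: "?H \<subseteq> P" using HG2 G2_P by blast
  have G3H: "G3 \<subseteq> ?H" by (auto intro: generate.incl)
  have conj: "p \<otimes> h \<otimes> inv p \<in> ?H" if "p \<in> P" "h \<in> ?H" for p h
  proof -
    have "p \<otimes> h \<otimes> inv p \<otimes> inv h \<in> ?H" using comm_G3'[of p h] that HG2 G3H by blast
    then have "p \<otimes> h \<otimes> inv p \<otimes> inv h \<otimes> h \<in> ?H" using that subgroup.m_closed[OF H] by blast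
    then show ?thesis using that HP P_carrier by (auto simp: m_assoc)
  qed
  define com where "com a b \<longleftrightarrow> a \<otimes> b \<otimes> inv a \<otimes> inv b \<in> ?H" for a b
  have sym: "com b a" if "com a b" "a \<in> P" "b \<in> P" for a b
    unfolding com_def by (rule commuting_mod_sym[OF H]) (use that P_carrier in \<open>auto simp: com_def\<close>)
  have sub: "subgroup {a \<in> P. com a c} B" if "c \<in> P" for c
    unfolding com_def by (rule subgroup_commuting_mod[OF P_subgroup H HP conj that])
  have prod: "com c b \<longleftrightarrow> com c a" if "com c (a \<otimes> b)" "a \<in> P" "b \<in> P" "c \<in> P" for a b c
  proof -
    have ab: "a \<otimes> b \<in> {a \<in> P. com a c}" using that sym subgroup.m_closed[OF P_subgroup] by auto
    note m = subgroup.m_closed[OF sub[OF that(4)]] subgroup.m_inv_closed[OF sub[OF that(4)]]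
    have e: "inv a \<otimes> (a \<otimes> b) = b" "a \<otimes> b \<otimes> inv b = a"
      using that P_carrier by (simp_all add: m_assoc) (simp_all flip: m_assoc)
    have "a \<in> {a \<in> P. com a c}" if "b \<in> {a \<in> P. com a c}" using m(1)[OF ab m(2)[OF that]] e by simp
    moreover have "b \<in> {a \<in> P. com a c}" if "a \<in> {a \<in> P. com a c}" using m(1)[OF m(2)[OF that] ab] e by simp
    ultimately show ?thesis using that sym by blast
  qed
  have adj: "com (A x y) (A y z) \<and> com (A x y) (A x z) \<and> com (A x z) (A y z)"
    if "(x, y, z) \<in> triples" for x y z
  proof -
    have xyz: "x \<in> {1..n}" "y \<in> {1..n}" "z \<in> {1..n}" "x \<noteq> y" "y \<noteq> z" "x \<noteq> z" "z \<noteq> x"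
      using that by (auto simp: triples_def)
    note AP = A_P[OF xyz(1,2,4)] A_P[OF xyz(1,3,6)] A_P[OF xyz(2,3,5)]
    have 1: "com (A x y) (A y z)" using that unfolding com_def by (auto simp: omega_def intro!: generate.incl rev_image_eqI)
    have "com (A x y) (A x z \<otimes> A y z)" using A_triangle[OF xyz(1-6)] G3H unfolding com_def by blast
    from prod[OF this AP(2,3,1)] 1 have 2: "com (A x y) (A x z)" by simp
    \<comment> \<open>The triangle relation with the vertices rotated to (y, z, x) yields the
      remaining commutation.\<close>
    have "com (A y z) (A y x \<otimes> A z x)" using A_triangle[OF xyz(2,3,1,5,7)] xyz G3H unfolding com_def by blast
    then have "com (A y z) (A x y \<otimes> A x z)" using edge_commute xyz by metis
    from prod[OF this AP(1,2,3)] sym[OF 1 AP(1,3)] have "com (A y z) (A x z)" by simp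
    then show ?thesis using 1 2 sym AP by blast
  qed
  have one: "com a a" if "a \<in> P" for a
    using that P_carrier subgroup.one_closed[OF H] by (simp add: com_def m_assoc)
  have pair: "com (A x y) (A u v)" if xy: "(x, y) \<in> pairs" and uv: "(u, v) \<in> pairs" for x y u v
  proof -
    have r: "x \<in> {1..n}" "y \<in> {1..n}" "u \<in> {1..n}" "v \<in> {1..n}" "x < y" "u < v" using that by (auto simp: pairs_def)
    have AP: "A x y \<in> P" "A u v \<in> P" using r by (auto intro: A_P)
    show ?thesis
    proof (cases "x = u \<or> x = v \<or> y = u \<or> y = v")
      case False
      then show ?thesis using A_disjoint[of x y u v] r G3H unfolding com_def by blast
    next
      case True
      then consider "x = u" "y = v" | "x = u" "y < v" | "x = u" "v < y" | "x = v" | "y = u" | "y = v" "x < u" | "y = v" "u < x"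
        using r by linarith
      then show ?thesis
      proof cases
        case 1 then show ?thesis using one AP by simp
      next
        case 2 then show ?thesis using adj[of x y v] r by (simp add: triples_def)
      next
        case 3 then show ?thesis using adj[of x v y] r sym AP by (simp add: triples_def)
      next
        case 4 then show ?thesis using adj[of u x y] r sym AP by (simp add: triples_def)
      next
        case 5 then show ?thesis using adj[of x y v] r by (simp add: triples_def)
      next
        case 6 then show ?thesis using adj[of x u y] r by (simp add: triples_def)
      next
        case 7 then show ?thesis using adj[of u x y] r sym AP by (simp add: triples_def)
      qed
    qed
  qed
  have "a \<otimes> b \<otimes> inv a \<otimes> inv b \<in> ?H" if "a \<in> P" "b \<in> P" for a b
  proof (rule generate_commuting_mod[OF P_subgroup H HP conj])
    show "G2 \<union> (\<lambda>(x, y). A x y) ` pairs \<subseteq> P" using G2_P pair_dual(1) by auto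
    show "a \<in> generate B (G2 \<union> (\<lambda>(x, y). A x y) ` pairs)" "b \<in> generate B (G2 \<union> (\<lambda>(x, y). A x y) ` pairs)"
      using that pure_generated by auto
    fix u v assume uv: "u \<in> G2 \<union> (\<lambda>(x, y). A x y) ` pairs" "v \<in> G2 \<union> (\<lambda>(x, y). A x y) ` pairs"
    then have "u \<in> P" "v \<in> P" using G2_P pair_dual(1) by auto
    then show "u \<otimes> v \<otimes> inv u \<otimes> inv v \<in> ?H"
      using uv comm_G3[of u v] comm_G3'[of u v] G3H pair unfolding com_def by auto
  qed
  then show ?thesis by (rule G2_least[OF H])
qed

lemma G2_mult_twist: "x \<in> G2 \<Longrightarrow> y \<in> G2 \<Longrightarrow> twist (x \<otimes> y) a b c = twist x a b c + twist y a b c"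
  using G2_P by (simp add: subset_iff pure_mult bracket_def G2_link)

text \<open>Links of pure braids are even, so each bracket is divisible by 4, and
  \<open>pure_commutator\<close> supplies the factor 6.\<close>

lemma G2_twist_dvd: assumes "x \<in> G2" shows "24 dvd twist x a b c"
proof -
  note G = subgroup.m_closed[OF G_subgroup(1)] subgroup.m_inv_closed[OF G_subgroup(1)] subgroup.one_closed[OF G_subgroup(1)]
  have i: "twist (inv x) a b c = - twist x a b c" if "x \<in> G2" for x a b c
    using pure_inv(2) G2_P that by blast
  have "subgroup {x \<in> G2. \<forall>a b c. 24 dvd twist x a b c} B"
    by (rule subgroupI) (use G G2_P P_carrier in \<open>auto simp: G2_mult_twist i Phi_one\<close>)
  then have "G2 \<subseteq> {x \<in> G2. \<forall>a b c. 24 dvd twist x a b c}"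
  proof (rule G2_least)
    fix a b assume ab: "a \<in> P" "b \<in> P"
    have "4 dvd link a x y * link b u v" for x y u v
      using mult_dvd_mono[OF pure_link_even[OF ab(1)] pure_link_even[OF ab(2)]] by simp
    moreover have "4 dvd link b x y * link a u v" for x y u v
      using mult_dvd_mono[OF pure_link_even[OF ab(2)] pure_link_even[OF ab(1)]] by simp
    ultimately have "4 dvd bracket (link a) (link b) x y z" for x y z
      by (simp add: bracket_def)
    then have "24 dvd 6 * bracket (link a) (link b) x y z" for x y z
      using mult_dvd_mono[of 6 6 4 "bracket (link a) (link b) x y z"] by simp
    then show "a \<otimes> b \<otimes> inv a \<otimes> inv b \<in> {x \<in> G2. \<forall>a b c. 24 dvd twist x a b c}"
      using ab by (simp add: pure_commutator comm_G2)
  qed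
  then show ?thesis using assms by blast
qed

text \<open>Elements of \<open>G2\<close> have link zero, so their commutators with pure braids have
  zero bracket.\<close>

lemma G3_twist: assumes "x \<in> G3" shows "twist x a b c = 0"
proof -
  note G = subgroup.m_closed[OF G_subgroup(1)] subgroup.m_inv_closed[OF G_subgroup(1)] subgroup.one_closed[OF G_subgroup(1)]
  have i: "twist (inv x) a b c = - twist x a b c" if "x \<in> G2" for x a b c
    using pure_inv(2) G2_P that by blast
  have "subgroup {x \<in> G2. \<forall>a b c. twist x a b c = 0} B"
    by (rule subgroupI) (use G G2_P P_carrier in \<open>auto simp: G2_mult_twist i Phi_one\<close>)
  then have "G3 \<subseteq> {x \<in> G2. \<forall>a b c. twist x a b c = 0}"
  proof (rule G3_least)
    fix a b assume ab: "a \<in> G2" "b \<in> P"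
    then show "a \<otimes> b \<otimes> inv a \<otimes> inv b \<in> {x \<in> G2. \<forall>a b c. twist x a b c = 0}"
      using G2_P by (auto simp: subset_iff pure_commutator comm_G2 bracket_def G2_link)
  qed
  then show ?thesis using assms by blast
qed

lemma triple_dual:
  shows "\<And>i. i \<in> triples \<Longrightarrow> omega i \<in> G2"
    and "\<And>i a b. a \<in> G2 \<Longrightarrow> b \<in> G2 \<Longrightarrow> (\<lambda>(x, y, z) p. twist p x y z) i (a \<otimes> b) =
      (\<lambda>(x, y, z) p. twist p x y z) i a + (\<lambda>(x, y, z) p. twist p x y z) i b"
    and "\<And>i j. i \<in> triples \<Longrightarrow> j \<in> triples \<Longrightarrow>
      (\<lambda>(x, y, z) p. twist p x y z) i (omega j) = (if i = j then 24 else 0)"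
proof -
  show "omega i \<in> G2" if "i \<in> triples" for i by (rule omega_G2[OF that])
  show "(\<lambda>(x, y, z) p. twist p x y z) i (a \<otimes> b) =
      (\<lambda>(x, y, z) p. twist p x y z) i a + (\<lambda>(x, y, z) p. twist p x y z) i b" if "a \<in> G2" "b \<in> G2" for i a b
    using that by (auto simp: G2_mult_twist split: prod.splits)
  show "(\<lambda>(x, y, z) p. twist p x y z) i (omega j) = (if i = j then 24 else 0)"
    if "i \<in> triples" "j \<in> triples" for i j
  proof -
    obtain x y z u v w where ij: "i = (x, y, z)" "j = (u, v, w)" by (metis prod_cases3)
    have r: "u \<in> {1..n}" "v \<in> {1..n}" "w \<in> {1..n}" "u \<noteq> v" "v \<noteq> w" using that ij by (auto simp: triples_def)
    have "x < y" "y < z" "u < v" "v < w" using that ij by (auto simp: triples_def)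
    \<comment> \<open>Both links have value 2 and meet only at their own triple, where the bracket
      is 4; then 6 * 4 = 24.\<close>
    then have "bracket (link (A u v)) (link (A v w)) x y z = (if x = u \<and> y = v \<and> z = w then 4 else 0)"
      by (auto simp: bracket_def link_A[OF r(1,2,4)] link_A[OF r(2,3,5)])
    then show ?thesis using r by (simp add: ij omega_def pure_commutator A_P)
  qed
qed

lemma comm_G2_G3: "a \<in> G2 \<Longrightarrow> b \<in> G2 \<Longrightarrow> a \<otimes> b \<otimes> inv a \<otimes> inv b \<in> G3"
  using comm_G3 G2_P by blast

lemma G2_twist_zero:
  assumes x: "x \<in> G2" and zero: "\<And>a b c. twist x a b c = 0"
  shows "x \<in> G3"
proof (rule dual_zero[OF G_subgroup G3_G2 comm_G2_G3 finite_triples triple_dual])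
  show "x \<in> generate B (G3 \<union> omega ` triples)" using x G2_generated by blast
qed (auto simp: zero G3_twist)

lemma G2_twist_surj:
  assumes w: "w \<in> triple_alg n" and dvd: "\<And>x y z. 24 dvd w x y z"
  obtains p where "p \<in> G2" "twist p = w"
proof -
  from dual_surj[OF G_subgroup G3_G2 comm_G2_G3 finite_triples triple_dual, of "\<lambda>(x, y, z). w x y z div 24"]
  obtain p where p: "p \<in> G2" "\<And>x y z. (x, y, z) \<in> triples \<Longrightarrow> twist p x y z = 24 * (w x y z div 24)" by fastforce
  have "twist p = w"
    by (rule triple_alg_eqI[OF Phi_closed(3)[OF P_carrier[OF subsetD[OF G2_P p(1)]]] w])
      (use p dvd in \<open>auto simp: triples_def\<close>)
  with p that show ?thesis by blast
qed

end

section \<open>Averaging over a finite group\<close>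

text \<open>Write S for the sum of \<delta> over the group. Summing the cocycle condition over
  \<open>h\<close>, with h g running through the group, gives S(x) - S(\<rho> g x) = |K| \<delta>(g,
  x) modulo \<open>d\<close>. As \<open>c\<close> inverts |K| modulo \<open>d\<close>, Y = -c S
  solves the coboundary equation without division.\<close>

lemma cocycle_average:
  fixes K (structure) and \<delta> :: "'k \<Rightarrow> 'x \<Rightarrow> int"
  assumes K: "group K" "finite (carrier K)"
    and coc: "\<And>h g x. h \<in> carrier K \<Longrightarrow> g \<in> carrier K \<Longrightarrow> d dvd \<delta> (h \<otimes> g) x - \<delta> h (\<rho> g x) - \<delta> g x"
    and c: "d dvd c * int (card (carrier K)) - 1" and g: "g \<in> carrier K"
  defines "Y \<equiv> \<lambda>x. - c * (\<Sum>h\<in>carrier K. \<delta> h x)"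
  shows "d dvd Y (\<rho> g x) - Y x - \<delta> g x"
proof -
  interpret K: group K by (rule K)
  let ?S = "\<lambda>x. \<Sum>h\<in>carrier K. \<delta> h x"
  have "bij_betw (\<lambda>h. h \<otimes> g) (carrier K) (carrier K)"
    by (rule bij_betw_byWitness[where f' = "\<lambda>h. h \<otimes> inv g"]) (use g in \<open>auto simp: K.m_assoc\<close>)
  then have shift: "(\<Sum>h\<in>carrier K. \<delta> (h \<otimes> g) x) = ?S x" by (rule sum.reindex_bij_betw)
  have "d dvd (\<Sum>h\<in>carrier K. \<delta> (h \<otimes> g) x - \<delta> h (\<rho> g x) - \<delta> g x)"
    using coc g by (intro dvd_sum) auto
  also have "\<dots> = ?S x - ?S (\<rho> g x) - int (card (carrier K)) * \<delta> g x"
    by (simp add: sum_subtractf shift)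
  finally have "d dvd c * (?S x - ?S (\<rho> g x) - int (card (carrier K)) * \<delta> g x) +
      (c * int (card (carrier K)) - 1) * \<delta> g x"
    using c by (intro dvd_add dvd_mult dvd_mult2)
  then show ?thesis by (simp add: Y_def algebra_simps)
qed

lemma (in group) embeds_factor_group:
  assumes K: "group K" and N: "N \<lhd> G" and f: "\<And>g. g \<in> carrier K \<Longrightarrow> f g \<in> carrier G"
    and mult: "\<And>h g. h \<in> carrier K \<Longrightarrow> g \<in> carrier K \<Longrightarrow> inv (f (h \<otimes>\<^bsub>K\<^esub> g)) \<otimes> (f h \<otimes> f g) \<in> N"
    and inj: "\<And>g. g \<in> carrier K \<Longrightarrow> f g \<in> N \<Longrightarrow> g = \<one>\<^bsub>K\<^esub>"
  shows "embeds K (G Mod N)"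
proof -
  interpret K: group K by (rule K)
  interpret N: normal N G by (rule N)
  have sN: "subgroup N G" by (rule N.subgroup_axioms)
  let ?\<phi> = "\<lambda>g. N #> f g"
  have "?\<phi> \<in> hom K (G Mod N)"
  proof (rule homI)
    show "?\<phi> g \<in> carrier (G Mod N)" if "g \<in> carrier K" for g
      using f[OF that] by (simp add: carrier_FactGroup)
    fix h g assume hg: "h \<in> carrier K" "g \<in> carrier K"
    let ?y = "f (h \<otimes>\<^bsub>K\<^esub> g)" and ?z = "f h \<otimes> f g"
    have c: "?y \<in> carrier G" "?z \<in> carrier G" using f hg by auto
    \<comment> \<open>The defect sits to the right of f (h g), whereas the cosets
      \<open>N #> _\<close> need it on the left; normality moves it across.\<close>
    have "?y \<otimes> (inv ?y \<otimes> ?z) \<otimes> inv ?y \<in> N"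
      using N.inv_op_closed2[OF c(1) mult[OF hg]] .
    then have "?z \<otimes> inv ?y \<in> N" using c by (simp add: m_assoc[symmetric])
    then have "N #> ?y = N #> ?z"
      using N.rcos_module_rev[OF is_group c] repr_independence[OF _ c(1) sN] by blast
    then show "?\<phi> (h \<otimes>\<^bsub>K\<^esub> g) = ?\<phi> h \<otimes>\<^bsub>G Mod N\<^esub> ?\<phi> g"
      using N.rcos_sum[of "f h" "f g"] f hg by simp
  qed
  moreover have "g = \<one>\<^bsub>K\<^esub>" if "g \<in> carrier K" "?\<phi> g = \<one>\<^bsub>G Mod N\<^esub>" for g
    using that rcos_self[OF f[OF that(1)] sN] by (intro inj) auto
  ultimately have "?\<phi> \<in> mon K (G Mod N)"
    using mon_iff_hom_one[OF K N.factorgroup_is_group] by blast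
  then show ?thesis unfolding embeds_def by blast
qed

lemma triple_alg_sum:
  "finite I \<Longrightarrow> (\<And>i. i \<in> I \<Longrightarrow> w i \<in> triple_alg n) \<Longrightarrow> (\<lambda>x y z. \<Sum>i\<in>I. w i x y z) \<in> triple_alg n"
  by (induction I rule: finite_induct) (auto intro: triple_alg_zero triple_alg_add)

lemma pair_alg_sum:
  "finite I \<Longrightarrow> (\<And>i. i \<in> I \<Longrightarrow> V i \<in> pair_alg n) \<Longrightarrow> (\<lambda>x y. \<Sum>i\<in>I. V i x y) \<in> pair_alg n"
  by (induction I rule: finite_induct) (auto intro: pair_alg_zero pair_alg_add)

lemma pair_alg_diff: 
  assumes "V \<in> pair_alg n" "W \<in> pair_alg n" shows "(\<lambda>x y. V x y - W x y) \<in> pair_alg n"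
  using pair_alg_add[OF assms(1) pair_alg_scale[OF assms(2), of "-1"]] by simp

lemma triple_alg_diff: 
  assumes "V \<in> triple_alg n" "W \<in> triple_alg n" shows "(\<lambda>x y z. V x y z - W x y z) \<in> triple_alg n"
  using triple_alg_add[OF assms(1) triple_alg_scale[OF assms(2), of "-1"]] by simp

section \<open>Lifting a finite permutation group\<close>

context braid
begin

text \<open>Since z p = x y with a pure factor on the right, the coordinates of \<open>p\<close>
  enter without permuted indices and are found by comparing two products, without those of an
  inverse.\<close>

lemma braid_defect:
  assumes x: "x \<in> carrier B" and y: "y \<in> carrier B" and z: "z \<in> carrier B" and perm: "perm z = perm x \<circ> perm y"
  defines "p \<equiv> inv z \<otimes> (x \<otimes> y)"
  shows "p \<in> P"
    and "link p a b = link x (perm y a) (perm y b) + link y a b - link z a b"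
    and "twist p a b c = twist x (perm y a) (perm y b) (perm y c) + twist y a b c - twist z a b c +
      3 * bracket (\<lambda>a b. link x (perm y a) (perm y b)) (link y) a b c - 3 * bracket (link z) (link p) a b c"
proof -
  have p: "p \<in> carrier B" using assms by auto
  have zp: "z \<otimes> p = x \<otimes> y" using x y z by (simp add: p_def m_assoc[symmetric])
  have "perm z \<circ> perm p = perm z" using Phi_mult(1)[OF z p] Phi_mult(1)[OF x y] perm zp by simp
  then have id: "perm p = id"
    using permutes_inj[OF Phi_closed(1)[OF z]] by (auto simp: fun_eq_iff dest: injD)
  then show "p \<in> P" using p by (simp add: P_def)
  have "link (z \<otimes> p) a b = link (x \<otimes> y) a b" "twist (z \<otimes> p) a b c = twist (x \<otimes> y) a b c"
    using zp by simp_all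
  then show "link p a b = link x (perm y a) (perm y b) + link y a b - link z a b"
    "twist p a b c = twist x (perm y a) (perm y b) (perm y c) + twist y a b c - twist z a b c +
      3 * bracket (\<lambda>a b. link x (perm y a) (perm y b)) (link y) a b c - 3 * bracket (link z) (link p) a b c"
    using x y z p id by (simp_all add: Phi_mult)
qed

context
  fixes K :: "('k, 'm) monoid_scheme" and \<rho> :: "'k \<Rightarrow> nat \<Rightarrow> nat"
  assumes K: "group K" "finite (carrier K)"
    and \<rho>: "\<rho> \<in> hom K (sym_group n)" "inj_on \<rho> (carrier K)"
begin

lemma rho_permutes: "g \<in> carrier K \<Longrightarrow> \<rho> g permutes {1..n}"
  using hom_in_carrier[OF \<rho>(1)] by (simp add: sym_group_carrier)

lemma rho_mult: "h \<in> carrier K \<Longrightarrow> g \<in> carrier K \<Longrightarrow> \<rho> (h \<otimes>\<^bsub>K\<^esub> g) = \<rho> h \<circ> \<rho> g"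
  using hom_mult[OF \<rho>(1)] by (simp add: sym_group_mult)

lemma rho_id:
  assumes "g \<in> carrier K" "\<rho> g = id" shows "g = \<one>\<^bsub>K\<^esub>"
proof -
  interpret K: group K by (rule K)
  have "group_hom K (sym_group n) \<rho>"
    using K(1) \<rho>(1) sym_group_is_group by (simp add: group_hom_def group_hom_axioms_def)
  then have "\<rho> \<one>\<^bsub>K\<^esub> = id" using group_hom.hom_one by (fastforce simp: sym_group_one)
  then show ?thesis using \<rho>(2) assms by (metis K.one_closed inj_onD)
qed

lemma mult_closed_K: "h \<in> carrier K \<Longrightarrow> g \<in> carrier K \<Longrightarrow> h \<otimes>\<^bsub>K\<^esub> g \<in> carrier K"
  using K(1) by (simp add: group.is_monoid monoid.m_closed)

text \<open>Links of arbitrary lifts form a cocycle modulo 2, because defects are pure and so have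
  even link. After correction the link is that of u \<rho>(g) u^-1 in the model, where u has degree
  1 part \<open>U\<close>.\<close>

lemma lift_link:
  assumes odd: "odd (card (carrier K))"
  obtains f U where "U \<in> pair_alg n" "\<And>g. g \<in> carrier K \<Longrightarrow> f g \<in> carrier B"
    "\<And>g. g \<in> carrier K \<Longrightarrow> perm (f g) = \<rho> g"
    "\<And>g. g \<in> carrier K \<Longrightarrow> link (f g) = (\<lambda>a b. U (\<rho> g a) (\<rho> g b) - U a b)"
proof -
  have "\<forall>g\<in>carrier K. \<exists>b. b \<in> carrier B \<and> perm b = \<rho> g" using perm_surj rho_permutes by blast
  then obtain b where b: "\<And>g. g \<in> carrier K \<Longrightarrow> b g \<in> carrier B" "\<And>g. g \<in> carrier K \<Longrightarrow> perm (b g) = \<rho> g"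
    by (metis (no_types, lifting))
  let ?\<delta> = "\<lambda>g (x, y). link (b g) x y"
  \<comment> \<open>The average with c = 1, which inverts an odd order modulo 2.\<close>
  define U where "U x y = - 1 * (\<Sum>h\<in>carrier K. link (b h) x y)" for x y
  have U: "U \<in> pair_alg n"
    using pair_alg_scale[OF pair_alg_sum[OF K(2)], of "\<lambda>h. link (b h)" n "- 1"] Phi_closed(2)[OF b(1)]
    unfolding U_def by blast
  have dvd: "2 dvd U (\<rho> g x) (\<rho> g y) - U x y - link (b g) x y" if g: "g \<in> carrier K" for g x y
  proof -
    have "2 dvd ?\<delta> (h \<otimes>\<^bsub>K\<^esub> g) z - ?\<delta> h (map_prod (\<rho> g) (\<rho> g) z) - ?\<delta> g z"
      if "h \<in> carrier K" "g \<in> carrier K" for h g z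
    proof -
      obtain x y where z: "z = (x, y)" by fastforce
      note d = braid_defect[OF b(1)[OF that(1)] b(1)[OF that(2)] b(1)[OF mult_closed_K[OF that]]]
      have "perm (b (h \<otimes>\<^bsub>K\<^esub> g)) = perm (b h) \<circ> perm (b g)" using b that mult_closed_K rho_mult by simp
      from pure_link_even[OF d(1)[OF this], of x y] d(2)[OF this, of x y]
      have "2 dvd - (link (b h) (\<rho> g x) (\<rho> g y) + link (b g) x y - link (b (h \<otimes>\<^bsub>K\<^esub> g)) x y)"
        using b that by simp
      then show ?thesis by (simp add: z algebra_simps)
    qed
    from cocycle_average[where d = 2 and c = 1 and \<delta> = ?\<delta> and \<rho> = "\<lambda>g. map_prod (\<rho> g) (\<rho> g)" and g = g and x = "(x, y)", OF K this]
    show ?thesis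
      using g odd by (simp add: U_def)
  qed
  have "\<exists>p. p \<in> P \<and> link p = (\<lambda>x y. U (\<rho> g x) (\<rho> g y) - U x y - link (b g) x y)" if "g \<in> carrier K" for g
    using pure_link_surj[OF pair_alg_diff[OF pair_alg_diff[OF pair_alg_comp[OF U rho_permutes[OF that]] U] Phi_closed(2)[OF b(1)[OF that]]] dvd[OF that]]
    by blast
  then have "\<forall>g\<in>carrier K. \<exists>p. p \<in> P \<and> link p = (\<lambda>x y. U (\<rho> g x) (\<rho> g y) - U x y - link (b g) x y)" by blast
  then obtain p where p: "\<And>g. g \<in> carrier K \<Longrightarrow> p g \<in> P"
    "\<And>g. g \<in> carrier K \<Longrightarrow> link (p g) = (\<lambda>x y. U (\<rho> g x) (\<rho> g y) - U x y - link (b g) x y)"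
    by (metis (no_types, lifting))
  show ?thesis
  proof (rule that[of U "\<lambda>g. b g \<otimes> p g", OF U])
    fix g assume g: "g \<in> carrier K"
    note c = b(1)[OF g] P_carrier[OF p(1)[OF g]]
    show "b g \<otimes> p g \<in> carrier B" "perm (b g \<otimes> p g) = \<rho> g"
      "link (b g \<otimes> p g) = (\<lambda>x y. U (\<rho> g x) (\<rho> g y) - U x y)"
      using c b(2)[OF g] p(2)[OF g] P_perm[OF p(1)[OF g]] by (simp_all add: Phi_mult)
  qed
qed

text \<open>The links of the lifts form an exact coboundary, so the defects have link zero and lie
  in \<open>G2\<close>. Injectivity is visible on permutations.\<close>

lemma odd_order_embeds:
  assumes odd: "odd (card (carrier K))"
  shows "embeds K (B Mod G2)"
proof -
  obtain f U where f: "U \<in> pair_alg n" "\<And>g. g \<in> carrier K \<Longrightarrow> f g \<in> carrier B"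
    "\<And>g. g \<in> carrier K \<Longrightarrow> perm (f g) = \<rho> g"
    "\<And>g. g \<in> carrier K \<Longrightarrow> link (f g) = (\<lambda>a b. U (\<rho> g a) (\<rho> g b) - U a b)"
    by (rule lift_link[OF odd]) blast
  show ?thesis
  proof (rule embeds_factor_group[OF K(1) G_normal(1)])
    show "f g \<in> carrier B" if "g \<in> carrier K" for g using f that by blast
    show "g = \<one>\<^bsub>K\<^esub>" if "g \<in> carrier K" "f g \<in> G2" for g
      using rho_id[OF that(1)] f(3)[OF that(1)] P_perm that(2) G2_P by auto
    fix h g assume hg: "h \<in> carrier K" "g \<in> carrier K"
    note d = braid_defect[OF f(2)[OF hg(1)] f(2)[OF hg(2)] f(2)[OF mult_closed_K[OF hg]]]
    have e: "perm (f (h \<otimes>\<^bsub>K\<^esub> g)) = perm (f h) \<circ> perm (f g)" using f hg mult_closed_K rho_mult by simp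
    show "inv (f (h \<otimes>\<^bsub>K\<^esub> g)) \<otimes> (f h \<otimes> f g) \<in> G2"
      by (rule pure_link_zero[OF d(1)[OF e]]) (use d(2)[OF e] f hg mult_closed_K rho_mult in simp)
  qed
qed

lemma coprime_six_embeds:
  assumes coprime: "coprime (card (carrier K)) 6"
  shows "embeds K (B Mod G3)"
proof -
  have c2: "coprime (card (carrier K)) 2" using coprime_divisors[of _ _ 2 6] coprime by fastforce
  then have odd: "odd (card (carrier K))" by simp
  obtain f U where f: "U \<in> pair_alg n" "\<And>g. g \<in> carrier K \<Longrightarrow> f g \<in> carrier B"
    "\<And>g. g \<in> carrier K \<Longrightarrow> perm (f g) = \<rho> g"
    "\<And>g. g \<in> carrier K \<Longrightarrow> link (f g) = (\<lambda>a b. U (\<rho> g a) (\<rho> g b) - U a b)"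
    by (rule lift_link[OF odd]) blast
  \<comment> \<open>24 is split as 2 * 2 * 6 because the order is known to be prime to 2 and to 6;
    Bezout then inverts it modulo 24.\<close>
  have "coprime (card (carrier K)) (2 * 2 * 6)" using c2 coprime by (simp only: coprime_mult_right_iff)
  then have "gcd (int (card (carrier K))) 24 = 1" by (simp flip: coprime_iff_gcd_eq_1) (metis coprime_int_iff of_nat_numeral)
  then obtain c v where cv: "c * int (card (carrier K)) + v * 24 = 1" using bezout_int by metis
  have "c * int (card (carrier K)) - 1 = 24 * (- v)" using cv by linarith
  then have c: "24 dvd c * int (card (carrier K)) - 1" by (rule dvdI)
  \<comment> \<open>The degree 2 error: in the model, u \<rho>(g) u^-1 with u = (id, U, 0) has twist
    -3 times this bracket, and \<open>f g\<close> agrees with it in degree 1.\<close>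
  define \<tau> where "\<tau> g x y z = twist (f g) x y z + 3 * bracket (\<lambda>a b. U (\<rho> g a) (\<rho> g b)) U x y z" for g x y z
  have \<tau>: "\<tau> g \<in> triple_alg n" if "g \<in> carrier K" for g
    using triple_alg_add[OF Phi_closed(3)[OF f(2)[OF that]] triple_alg_scale[OF bracket_in_triple_alg[OF pair_alg_comp[OF f(1) rho_permutes[OF that]] f(1)], of 3]]
    unfolding \<tau>_def by blast
  define Y where "Y x y z = - c * (\<Sum>h\<in>carrier K. \<tau> h x y z)" for x y z
  have Y: "Y \<in> triple_alg n"
    using triple_alg_scale[OF triple_alg_sum[OF K(2)], of \<tau> n "- c"] \<tau> unfolding Y_def by blast
  \<comment> \<open>The defect has link zero, so the last bracket of \<open>braid_defect\<close>
    vanishes; the remaining brackets are absorbed into \<tau>.\<close>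
  have defect: "inv (f (h \<otimes>\<^bsub>K\<^esub> g)) \<otimes> (f h \<otimes> f g) \<in> G2"
    "twist (inv (f (h \<otimes>\<^bsub>K\<^esub> g)) \<otimes> (f h \<otimes> f g)) x y z =
      \<tau> h (\<rho> g x) (\<rho> g y) (\<rho> g z) + \<tau> g x y z - \<tau> (h \<otimes>\<^bsub>K\<^esub> g) x y z"
    if hg: "h \<in> carrier K" "g \<in> carrier K" for h g x y z
  proof -
    note d = braid_defect[OF f(2)[OF hg(1)] f(2)[OF hg(2)] f(2)[OF mult_closed_K[OF hg]]]
    have e: "perm (f (h \<otimes>\<^bsub>K\<^esub> g)) = perm (f h) \<circ> perm (f g)" using f hg mult_closed_K rho_mult by simp
    have l: "link (inv (f (h \<otimes>\<^bsub>K\<^esub> g)) \<otimes> (f h \<otimes> f g)) = (\<lambda>a b. 0)"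
      using d(2)[OF e] f hg mult_closed_K rho_mult by (simp add: fun_eq_iff)
    show "inv (f (h \<otimes>\<^bsub>K\<^esub> g)) \<otimes> (f h \<otimes> f g) \<in> G2"
      by (rule pure_link_zero[OF d(1)[OF e]]) (simp add: l)
    show "twist (inv (f (h \<otimes>\<^bsub>K\<^esub> g)) \<otimes> (f h \<otimes> f g)) x y z =
      \<tau> h (\<rho> g x) (\<rho> g y) (\<rho> g z) + \<tau> g x y z - \<tau> (h \<otimes>\<^bsub>K\<^esub> g) x y z"
      unfolding d(3)[OF e] l
      using hg by (simp add: f mult_closed_K rho_mult \<tau>_def bracket_def algebra_simps)
  qed
  have dvd: "24 dvd Y (\<rho> g x) (\<rho> g y) (\<rho> g z) - Y x y z - \<tau> g x y z" if g: "g \<in> carrier K" for g x y z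
  proof -
    let ?\<delta> = "\<lambda>g (x, y, z). \<tau> g x y z"
    have "24 dvd ?\<delta> (h \<otimes>\<^bsub>K\<^esub> g) u - ?\<delta> h (map_prod (\<rho> g) (map_prod (\<rho> g) (\<rho> g)) u) - ?\<delta> g u"
      if hg: "h \<in> carrier K" "g \<in> carrier K" for h g u
    proof -
      obtain x y z where u: "u = (x, y, z)" by (metis prod_cases3)
      have "24 dvd - (\<tau> h (\<rho> g x) (\<rho> g y) (\<rho> g z) + \<tau> g x y z - \<tau> (h \<otimes>\<^bsub>K\<^esub> g) x y z)"
        using G2_twist_dvd[OF defect(1)[OF hg]] unfolding defect(2)[OF hg] by (simp only: dvd_minus_iff)
      then show ?thesis by (simp add: u algebra_simps)
    qed
    from cocycle_average[where \<delta> = ?\<delta> and \<rho> = "\<lambda>g. map_prod (\<rho> g) (map_prod (\<rho> g) (\<rho> g))" and x = "(x, y, z)", OF K this c g]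
    show ?thesis by (simp add: Y_def)
  qed
  have "\<exists>p. p \<in> G2 \<and> twist p = (\<lambda>x y z. Y (\<rho> g x) (\<rho> g y) (\<rho> g z) - Y x y z - \<tau> g x y z)" if "g \<in> carrier K" for g
    using G2_twist_surj[OF triple_alg_diff[OF triple_alg_diff[OF triple_alg_comp[OF Y rho_permutes[OF that]] Y] \<tau>[OF that]] dvd[OF that]]
    by blast
  then have "\<forall>g\<in>carrier K. \<exists>p. p \<in> G2 \<and> twist p = (\<lambda>x y z. Y (\<rho> g x) (\<rho> g y) (\<rho> g z) - Y x y z - \<tau> g x y z)" by blast
  then obtain p where p: "\<And>g. g \<in> carrier K \<Longrightarrow> p g \<in> G2"
    "\<And>g. g \<in> carrier K \<Longrightarrow> twist (p g) = (\<lambda>x y z. Y (\<rho> g x) (\<rho> g y) (\<rho> g z) - Y x y z - \<tau> g x y z)"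
    by (metis (no_types, lifting))
  define F where "F g = f g \<otimes> p g" for g
  \<comment> \<open>These are exactly the coordinates of u \<rho>(g) u^-1 in the model for u = (id,
    U, Y). They multiply like a homomorphism, so the defects of \<open>F\<close> have no coordinates
    at all.\<close>
  have F: "F g \<in> carrier B" "perm (F g) = \<rho> g" "link (F g) = (\<lambda>a b. U (\<rho> g a) (\<rho> g b) - U a b)"
    "twist (F g) = (\<lambda>x y z. Y (\<rho> g x) (\<rho> g y) (\<rho> g z) - Y x y z - 3 * bracket (\<lambda>a b. U (\<rho> g a) (\<rho> g b)) U x y z)"
    if g: "g \<in> carrier K" for g
  proof -
    have pP: "p g \<in> P" using p(1)[OF g] G2_P by blast
    have l: "link (p g) = (\<lambda>a b. 0)" using G2_link[OF p(1)[OF g]] by blast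
    show "F g \<in> carrier B" "perm (F g) = \<rho> g" "link (F g) = (\<lambda>a b. U (\<rho> g a) (\<rho> g b) - U a b)"
      "twist (F g) = (\<lambda>x y z. Y (\<rho> g x) (\<rho> g y) (\<rho> g z) - Y x y z - 3 * bracket (\<lambda>a b. U (\<rho> g a) (\<rho> g b)) U x y z)"
      using f(2-4)[OF g] P_carrier[OF pP] P_perm[OF pP] p(2)[OF g]
      by (simp_all add: F_def Phi_mult l) (simp add: \<tau>_def bracket_def fun_eq_iff algebra_simps)
  qed
  show ?thesis
  proof (rule embeds_factor_group[OF K(1) G_normal(2)])
    show "F g \<in> carrier B" if "g \<in> carrier K" for g using F that by blast
    show "g = \<one>\<^bsub>K\<^esub>" if "g \<in> carrier K" "F g \<in> G3" for g
      using rho_id[OF that(1)] F(2)[OF that(1)] P_perm that(2) G2_P G3_G2 by auto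
    fix h g assume hg: "h \<in> carrier K" "g \<in> carrier K"
    note d = braid_defect[OF F(1)[OF hg(1)] F(1)[OF hg(2)] F(1)[OF mult_closed_K[OF hg]]]
    have e: "perm (F (h \<otimes>\<^bsub>K\<^esub> g)) = perm (F h) \<circ> perm (F g)" using F hg mult_closed_K rho_mult by simp
    have l: "link (inv (F (h \<otimes>\<^bsub>K\<^esub> g)) \<otimes> (F h \<otimes> F g)) = (\<lambda>a b. 0)"
      using d(2)[OF e] F hg mult_closed_K rho_mult by (simp add: fun_eq_iff)
    show "inv (F (h \<otimes>\<^bsub>K\<^esub> g)) \<otimes> (F h \<otimes> F g) \<in> G3"
    proof (rule G2_twist_zero)
      show "inv (F (h \<otimes>\<^bsub>K\<^esub> g)) \<otimes> (F h \<otimes> F g) \<in> G2"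
        by (rule pure_link_zero[OF d(1)[OF e]]) (simp add: l)
      show "twist (inv (F (h \<otimes>\<^bsub>K\<^esub> g)) \<otimes> (F h \<otimes> F g)) x y z = 0" for x y z
        unfolding d(3)[OF e] l
        using hg by (simp add: F mult_closed_K rho_mult bracket_def algebra_simps)
    qed
  qed
qed

end

end

lemma finite_subgroup_sym_embeds:
  assumes "group K" "finite (carrier K)" "\<rho> \<in> hom K (sym_group n)" "inj_on \<rho> (carrier K)"
  shows "odd (card (carrier K)) \<Longrightarrow> embeds K (braid_quotient n 2)"
    and "coprime (card (carrier K)) 6 \<Longrightarrow> embeds K (braid_quotient n 3)"
proof -
  interpret b: braid "braid_group n" n
    using group_braid_group by (simp add: braid_def braid_axioms_def)
  show "odd (card (carrier K)) \<Longrightarrow> embeds K (braid_quotient n 2)"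
    using b.odd_order_embeds[OF assms] by (simp add: braid_quotient_def b.G2_def)
  show "coprime (card (carrier K)) 6 \<Longrightarrow> embeds K (braid_quotient n 3)"
    using b.coprime_six_embeds[OF assms] by (simp add: braid_quotient_def b.G3_def)
qed

section \<open>The affine action of the semidirect product\<close>

theorem theorem3:
  fixes m n :: nat and t :: int and \<theta> :: "int \<Rightarrow> int \<Rightarrow> int"
  assumes "m \<ge> 3" and "n \<ge> 3"
    and "\<theta> \<in> hom (integer_mod_group m) (AutoGroup (integer_mod_group n))"
    and "1 \<le> t" and "t < int n"
    and "\<forall>x \<in> carrier (integer_mod_group n). \<theta> 1 x = (t * x) mod int n"
    and "\<forall>l::nat. 1 \<le> l \<and> l \<le> m - 1 \<longrightarrow> gcd (t ^ l - 1) (int n) = 1"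
  shows "(odd (m * n) \<longrightarrow>
        embeds (semidirect_product (integer_mod_group n) (integer_mod_group m) \<theta>)
          (braid_quotient n 2)) \<and>
      (gcd (m * n) 6 = 1 \<longrightarrow>
        embeds (semidirect_product (integer_mod_group n) (integer_mod_group m) \<theta>)
          (braid_quotient n 3))"
proof -
  let ?N = "integer_mod_group n" and ?H = "integer_mod_group m"
  define K where "K = semidirect_product ?N ?H \<theta>"
  interpret K: group K unfolding K_def
    by (rule group_semidirect_product[OF group_integer_mod_group group_integer_mod_group assms(3)])
  have cN: "carrier ?N = {0..<int n}" and cH: "carrier ?H = {0..<int m}"
    using assms(1,2) by (simp_all add: carrier_integer_mod_group)
  have cK: "carrier K = {0..<int n} \<times> {0..<int m}"
    by (simp add: K_def semidirect_product_def cN cH)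
  have \<theta>_mult: "\<theta> ((h + k) mod int m) x = \<theta> h (\<theta> k x)"
    if "h \<in> {0..<int m}" "k \<in> {0..<int m}" "x \<in> {0..<int n}" for h k x
  proof -
    have "\<theta> h \<in> Bij (carrier ?N)" "\<theta> k \<in> Bij (carrier ?N)"
      using hom_in_carrier[OF assms(3)] that cH by (auto simp: AutoGroup_def auto_def)
    then show ?thesis
      using hom_mult[OF assms(3), of h k] that by (simp add: cN cH AutoGroup_def BijGroup_def compose_def)
  qed
  have "\<theta> \<one>\<^bsub>?H\<^esub> = \<one>\<^bsub>AutoGroup ?N\<^esub>"
    by (rule hom_one[OF assms(3)]) (simp_all add: group.AutoGroup)
  then have \<theta>0: "\<theta> 0 x = x" if "x \<in> {0..<int n}" for x
    using that by (simp add: AutoGroup_def BijGroup_def cN)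
  \<comment> \<open>The action is prescribed at 1 only, so it is iterated. Reducing \<open>j\<close>
    modulo \<open>m\<close> admits j = m, which later yields t^m = 1 modulo n.\<close>
  have \<theta>: "\<theta> (int j mod int m) x = (t ^ j * x) mod int n" if "x \<in> {0..<int n}" for j x
    using that
  proof (induction j arbitrary: x)
    case 0
    then show ?case using \<theta>0 by simp
  next
    case (Suc j)
    have 1: "(1::int) \<in> {0..<int m}" "int j mod int m \<in> {0..<int m}" "(t * x) mod int n \<in> {0..<int n}"
      using assms(1,2) by auto
    have "int (Suc j) mod int m = (int j mod int m + 1) mod int m" by (simp add: mod_simps algebra_simps)
    then have "\<theta> (int (Suc j) mod int m) x = \<theta> (int j mod int m) ((t * x) mod int n)"
      using \<theta>_mult[OF 1(2,1) Suc.prems] assms(6) Suc.prems cN by simp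
    then show ?case using Suc.IH[OF 1(3)] by (simp add: mod_simps algebra_simps)
  qed
  \<comment> \<open>The pair (a, l) sends the residue y to a + t^l y; the shifts by 1 identify the
    residues 0, ..., n - 1 with the points 1, ..., n.\<close>
  define \<rho> where "\<rho> = (\<lambda>(a, l) x. if x \<in> {1..n} then nat ((a + t ^ nat l * (int x - 1)) mod int n) + 1 else x)"
  have \<rho>_in: "\<rho> g x \<in> {1..n}" if "x \<in> {1..n}" for g x
  proof -
    obtain a l where g: "g = (a, l)" by fastforce
    have "0 \<le> (a + t ^ nat l * (int x - 1)) mod int n" "(a + t ^ nat l * (int x - 1)) mod int n < int n"
      using assms(2) by simp_all
    then have "nat ((a + t ^ nat l * (int x - 1)) mod int n) < n" by linarith
    then show ?thesis using that by (simp add: \<rho>_def g)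
  qed
  have \<rho>_out: "\<rho> g x = x" if "x \<notin> {1..n}" for g x using that by (cases g) (auto simp: \<rho>_def)
  have tm: "t ^ m mod int n = 1"
    using \<theta>[of 1 m] \<theta>0[of 1] assms(1,2) by simp
  have t_mod: "t ^ nat ((l + k) mod int m) mod int n = t ^ (nat l + nat k) mod int n"
    if "l \<in> {0..<int m}" "k \<in> {0..<int m}" for l k
  proof (cases "l + k < int m")
    case True
    then show ?thesis using that by (simp add: nat_add_distrib)
  next
    case False
    have "(l + k) mod int m = (l + k - int m) mod int m" by simp
    also have "\<dots> = l + k - int m" using that False by (intro mod_pos_pos_trivial) auto
    finally have "nat l + nat k = nat ((l + k) mod int m) + m" using that False by auto
    then have "t ^ (nat l + nat k) mod int n = t ^ nat ((l + k) mod int m) * (t ^ m mod int n) mod int n"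
      by (simp add: power_add mod_simps)
    then show ?thesis by (simp add: tm)
  qed
  have \<rho>_mult: "\<rho> (g \<otimes>\<^bsub>K\<^esub> h) = \<rho> g \<circ> \<rho> h" if gh: "g \<in> carrier K" "h \<in> carrier K" for g h
  proof
    fix x
    obtain a l b k where gh': "g = (a, l)" "h = (b, k)" by fastforce
    have r: "l \<in> {0..<int m}" "k \<in> {0..<int m}" "b \<in> {0..<int n}" using gh gh' cK by auto
    show "\<rho> (g \<otimes>\<^bsub>K\<^esub> h) x = (\<rho> g \<circ> \<rho> h) x"
    proof (cases "x \<in> {1..n}")
      case True
      let ?y = "int x - 1"
      have "\<theta> l b = (t ^ nat l * b) mod int n" using \<theta>[OF r(3), of "nat l"] r by simp
      then have "g \<otimes>\<^bsub>K\<^esub> h = ((a + t ^ nat l * b mod int n) mod int n, (l + k) mod int m)"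
        by (simp add: K_def gh' semidirect_product_def)
      then have "\<rho> (g \<otimes>\<^bsub>K\<^esub> h) x =
          nat (((a + t ^ nat l * b mod int n) mod int n + t ^ nat ((l + k) mod int m) * ?y) mod int n) + 1"
        using True by (simp add: \<rho>_def)
      also have "((a + t ^ nat l * b mod int n) mod int n + t ^ nat ((l + k) mod int m) * ?y) mod int n =
          (a + t ^ nat l * b + t ^ nat ((l + k) mod int m) * ?y) mod int n"
        by (simp add: mod_simps)
      also have "\<dots> = (a + t ^ nat l * b + t ^ (nat l + nat k) * ?y) mod int n"
        using t_mod[OF r(1,2)] by (metis mod_add_right_eq mod_mult_left_eq)
      also have "\<dots> = (a + t ^ nat l * (b + t ^ nat k * ?y)) mod int n"
        by (simp add: power_add algebra_simps)
      also have "\<dots> = (a + t ^ nat l * ((b + t ^ nat k * ?y) mod int n)) mod int n"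
        by (metis mod_add_right_eq mod_mult_right_eq)
      finally have "\<rho> (g \<otimes>\<^bsub>K\<^esub> h) x = nat ((a + t ^ nat l * ((b + t ^ nat k * ?y) mod int n)) mod int n) + 1" .
      moreover have "int (\<rho> h x) - 1 = (b + t ^ nat k * ?y) mod int n"
        using True assms(2) by (simp add: \<rho>_def gh')
      ultimately show ?thesis using \<rho>_in[OF True, of h] by (simp add: \<rho>_def gh')
    next
      case False
      then show ?thesis by (simp add: \<rho>_out)
    qed
  qed
  have one: "\<one>\<^bsub>K\<^esub> = (0, 0)" by (simp add: K_def semidirect_product_def)
  have \<rho>_one: "\<rho> \<one>\<^bsub>K\<^esub> = id"
  proof
    show "\<rho> \<one>\<^bsub>K\<^esub> x = id x" for x using assms(2) by (auto simp: \<rho>_def one)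
  qed
  have \<rho>_perm: "\<rho> g permutes {1..n}" if g: "g \<in> carrier K" for g
  proof (rule bij_imp_permutes[OF _ \<rho>_out])
    have "\<rho> (inv\<^bsub>K\<^esub> g) \<circ> \<rho> g = id" "\<rho> g \<circ> \<rho> (inv\<^bsub>K\<^esub> g) = id"
      using \<rho>_mult[of "inv\<^bsub>K\<^esub> g" g] \<rho>_mult[of g "inv\<^bsub>K\<^esub> g"] g \<rho>_one by simp_all
    then show "bij_betw (\<rho> g) {1..n} {1..n}"
      by (intro bij_betw_byWitness[where f' = "\<rho> (inv\<^bsub>K\<^esub> g)"]) (use \<rho>_in in \<open>auto simp: fun_eq_iff image_subset_iff\<close>)
  qed
  have hom: "\<rho> \<in> hom K (sym_group n)"
    by (rule homI) (use \<rho>_perm in \<open>auto simp: sym_group_carrier sym_group_mult \<rho>_mult\<close>)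
  have "\<rho> \<in> mon K (sym_group n)"
    unfolding mon_iff_hom_one[OF K.is_group sym_group_is_group]
  proof (intro conjI allI impI hom)
    fix g assume g: "g \<in> carrier K \<and> \<rho> g = \<one>\<^bsub>sym_group n\<^esub>"
    obtain a l where al: "g = (a, l)" by fastforce
    have r: "a \<in> {0..<int n}" "l \<in> {0..<int m}" using g al cK by auto
    have id: "\<rho> g x = x" for x using g by (simp add: sym_group_one)
    \<comment> \<open>The points 1 and 2 stand for the residues 0 and 1; that they are fixed gives a
      = 0 and then t^l = 1 modulo n.\<close>
    have "nat (a mod int n) = 0" using id[of 1] assms(2) by (simp add: \<rho>_def al)
    then have a: "a = 0" using r by simp
    have "nat (t ^ nat l mod int n) = 1" using id[of 2] assms(2) a by (simp add: \<rho>_def al)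
    then have "t ^ nat l mod int n = 1 mod int n" using assms(2) by simp
    then have dvd: "int n dvd t ^ nat l - 1" by (simp add: mod_eq_dvd_iff)
    have "l = 0"
    proof (rule ccontr)
      assume "l \<noteq> 0"
      then have "1 \<le> nat l \<and> nat l \<le> m - 1" using r by auto
      then have "gcd (t ^ nat l - 1) (int n) = 1" using assms(7) by blast
      \<comment> \<open>If \<open>n\<close> divides t^l - 1 the gcd is n >= 3, against the
        hypothesis that it is 1 for 0 < l < m.\<close>
      moreover have "gcd (t ^ nat l - 1) (int n) = int n" using dvd by (simp add: gcd_proj2_if_dvd_int)
      ultimately show False using assms(2) by simp
    qed
    then show "g = \<one>\<^bsub>K\<^esub>" using a al one by simp
  qed
  then have inj: "inj_on \<rho> (carrier K)" by (simp add: mon_def)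
  have fin: "finite (carrier K)" and card: "card (carrier K) = m * n" by (simp_all add: cK)
  show ?thesis
    using finite_subgroup_sym_embeds[OF K.is_group fin hom inj]
    unfolding card K_def[symmetric] by (simp add: coprime_iff_gcd_eq_1)
qed

end
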